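(* Let $n\ge 2$, $2\le k\le n$, and let $f$ be a (measurable) function on $S^n$. Consider the condition $$(\ast)\qquad \int_{\{\eta\in S^n:\ \eta_{n+1}>1-\varepsilon\}}\frac{|f(\eta)|}{(1-\eta_{n+1})^{(n+1-k)/2}}\,dS(\eta)<\infty\qquad\text{for all } 0<\varepsilon\le 2 .$$ 1. If $(\ast)$ holds, then $(\mathfrak S f)(\tau\cap S^n)$ is finite for almost all $\tau\in\mathcal T$. 2. If $f$ is nonnegative and zonal, and $(\ast)$ fails, then $(\mathfrak S f)(\tau\cap S^n)=\infty$ for all $\tau\in\mathcal T$. 3. If $f$ is continuous on $S^n\setminus\{N\}$, then $(\mathfrak S f)(\tau\cap S^n)$ is finite for each $\tau\in\mathcal T$ provided that $$\sup_{\eta\in S^n\setminus\{N\}}(1-\eta_{n+1})^{\mu}|f(\eta)|<\infty\quad\text{for some}\quad \mu<\frac{k-1}{2}.$$ The bound $(k-1)/2$ is sharp, i.e. the assertion fails if $\mu<(k-1)/2$ is replaced by $\mu\le (k-1)/2$.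
   Context: $S^n$ is the unit sphere in $\mathbb R^{n+1}$, $dS$ is its surface area measure, $e_1,\dots,e_{n+1}$ are the coordinate unit vectors, $N=e_{n+1}$ is the north pole, and $\mathbb R^n=\mathbb R e_1\oplus\cdots\oplus\mathbb R e_n\subset\mathbb R^{n+1}$. $\mathcal T$ is the manifold of all $k$-dimensional affine planes $\tau$ in $\mathbb R^{n+1}$ passing through $N$ and intersecting $\mathbb R^n$; it is identified via $\tau\mapsto\tau\cap\mathbb R^n$ with the manifold of all $(k-1)$-dimensional affine planes in $\mathbb R^n$, and "almost all" refers to the standard (smooth, rigid-motion invariant) measure there. The spherical slice transform of $f$ is $(\mathfrak S f)(\tau\cap S^n)=\int_{\tau\cap S^n} f(\eta)\,dS_\tau(\eta)$, $\tau\in\mathcal T$, where $dS_\tau$ is the standard surface area measure on the subsphere $\tau\cap S^n$. A function on $S^n$ is called zonal if it is invariant under rotations about the last coordinate axis.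
   Formalization: In item 2, "(∗) fails" is read as: the integral is infinite for every 0<ε≤2. If it is infinite only for some ε (e.g. a nonnegative zonal f singular only at the south pole), the claim is false, since Sf is then finite on almost all small subspheres near N. *)

theory Defs
  imports "HOL-Analysis.Analysis"
begin

section \<open>Surface measure on spheres and on their plane sections\<close>

definition orthonormal_basis :: "'a::euclidean_space set \<Rightarrow> 'a set \<Rightarrow> bool" where
  "orthonormal_basis V B \<longleftrightarrow>
     B \<subseteq> V \<and> pairwise orthogonal B \<and> (\<forall>b\<in>B. norm b = 1) \<and> span B = V"

text \<open>Lebesgue measure on a linear subspace \<open>V\<close>, as a Borel measure on the ambient space
  concentrated on \<open>V\<close>. This is the definition of \<open>lborel\<close> relative to an orthonormal basis of
  \<open>V\<close>; the result does not depend on the basis chosen.\<close>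

definition subspace_lborel :: "'a::euclidean_space set \<Rightarrow> 'a measure" where
  "subspace_lborel V =
     (let B = (SOME B. orthonormal_basis V B)
      in distr (Pi\<^sub>M B (\<lambda>_. lborel)) borel (\<lambda>t. \<Sum>b\<in>B. t b *\<^sub>R b))"

text \<open>Surface area on the unit sphere of \<open>V\<close>, from polar coordinates:
  \<open>\<sigma>(E) = dim V \<cdot> vol {u \<in> V. 0 < \<bar>u\<bar> \<le> 1, u/\<bar>u\<bar> \<in> E}\<close>.\<close>

definition unit_sphere_measure :: "'a::euclidean_space set \<Rightarrow> 'a measure" where
  "unit_sphere_measure V =
     scale_measure (of_nat (dim V))
       (distr (restrict_space (subspace_lborel V) (V \<inter> cball 0 1 - {0}))
              (restrict_space borel (V \<inter> sphere 0 1)) sgn)"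

text \<open>The measure \<open>dS\<close>. It is complete, so measurability of a function means Lebesgue
  measurability, and it lives on the sphere, so values of functions off the sphere play no role.\<close>

definition sphere_measure :: "'a::euclidean_space measure" where
  "sphere_measure = completion (unit_sphere_measure UNIV)"

text \<open>For an affine plane \<open>\<tau>\<close> that meets the open unit ball, \<open>\<tau> \<inter> sphere 0 1\<close> is the sphere in
  \<open>\<tau>\<close> whose centre \<open>c\<close> is the foot of the perpendicular from the origin and whose radius is
  \<open>r = sqrt (1 - \<bar>c\<bar>\<^sup>2)\<close>; its surface measure is that of the unit sphere in the direction space
  of \<open>\<tau>\<close>, transported by \<open>u \<mapsto> c + r u\<close>.\<close>

definition subsphere_measure :: "'a::euclidean_space set \<Rightarrow> 'a measure" where
  "subsphere_measure \<tau> =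
     (let c = closest_point \<tau> 0; r = sqrt (1 - (norm c)\<^sup>2); V = (\<lambda>x. x - c) ` \<tau>
      in completion (scale_measure (ennreal (r ^ (dim V - 1)))
           (distr (unit_sphere_measure V) (restrict_space borel (\<tau> \<inter> sphere 0 1))
                  (\<lambda>u. c + r *\<^sub>R u))))"

section \<open>The invariant measure on affine planes\<close>

definition affine_planes :: "nat \<Rightarrow> 'a::euclidean_space set set" where
  "affine_planes d = {\<zeta>. affine \<zeta> \<and> aff_dim \<zeta> = int d}"

definition frame_plane :: "nat \<Rightarrow> (nat \<Rightarrow> 'a::euclidean_space) \<times> 'a \<Rightarrow> 'a set" where
  "frame_plane d = (\<lambda>(v, x). (+) x ` span (v ` {..<d}))"

text \<open>The span of \<open>d\<close> independent vectors, each uniformly distributed in the unit ball, is a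
  random \<open>d\<close>-dimensional linear subspace \<open>V\<close> whose law is the rotation invariant probability on the
  Grassmannian. Given \<open>V\<close>, the plane \<open>x + V\<close> has to be weighted by Lebesgue measure on the
  orthogonal complement of \<open>V\<close>; letting \<open>x\<close> run over the set where its orthogonal projection
  to \<open>V\<close> has norm at most 1 achieves this up to the volume of the unit ball of \<open>V\<close>, which
  is divided out in \<open>affine_plane_measure\<close>.\<close>

definition frame_space ::
    "nat \<Rightarrow> ((nat \<Rightarrow> 'a::euclidean_space) \<times> 'a) measure" where
  "frame_space d =
     restrict_space
       (Pi\<^sub>M {..<d} (\<lambda>_. uniform_measure lborel (ball 0 1)) \<Otimes>\<^sub>M lborel)
       {(v, x). dim (v ` {..<d}) = d \<and> norm (closest_point (span (v ` {..<d})) x) \<le> 1}"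

text \<open>The rigid motion invariant measure
  \<open>A \<mapsto> \<integral> vol {y \<in> V\<^sup>\<bottom>. y + V \<in> A} dV\<close>. A set of planes is measurable iff its preimage in the
  parameter space is; these are the Borel sets of the affine Grassmannian.\<close>

definition affine_plane_measure :: "nat \<Rightarrow> 'a::euclidean_space set measure" where
  "affine_plane_measure d =
     scale_measure (ennreal (1 / unit_ball_vol (real d)))
       (distr (frame_space d)
          (sigma (affine_planes d)
             {A. A \<subseteq> affine_planes d \<and>
                 frame_plane d -` A \<inter> space (frame_space d) \<in> sets (frame_space d)})
          (frame_plane d))"

section \<open>The spherical slice transform\<close>

text \<open>\<open>\<real>\<^sup>n\<^sup>+\<^sup>1\<close> is represented as \<open>'a \<times> real\<close> with \<open>n = DIM('a)\<close>: the second component is the last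
  coordinate, and \<open>\<real>\<^sup>n\<close> is the set of points \<open>(x, 0)\<close>.\<close>

definition north_pole :: "'a::euclidean_space \<times> real" where
  "north_pole = (0, 1)"

definition slice_planes :: "nat \<Rightarrow> ('a::euclidean_space \<times> real) set set" where
  "slice_planes k =
     {\<tau>. affine \<tau> \<and> aff_dim \<tau> = int k \<and> north_pole \<in> \<tau> \<and> (\<exists>x. (x, 0) \<in> \<tau>)}"

definition trace_plane :: "('a::euclidean_space \<times> real) set \<Rightarrow> 'a set" where
  "trace_plane \<tau> = {x. (x, 0) \<in> \<tau>}"

text \<open>The identification \<open>trace_plane\<close> of \<open>slice_planes k\<close> with \<open>affine_planes (k - 1)\<close>, used to
  carry the invariant measure over.\<close>

definition slice_plane_measure ::
    "nat \<Rightarrow> ('a::euclidean_space \<times> real) set measure" where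
  "slice_plane_measure k =
     embed_measure (affine_plane_measure (k - 1)) (inv_into (slice_planes k) trace_plane)"

text \<open>The slice transform at \<open>\<tau>\<close> is the integral over \<open>\<tau> \<inter> sphere 0 1\<close>. It is finite if the
  integral converges absolutely, and, for nonnegative functions, infinite if the integral is
  \<open>\<infinity>\<close>.\<close>

definition slice_transform ::
    "(('a::euclidean_space \<times> real) \<Rightarrow> ennreal) \<Rightarrow> ('a \<times> real) set \<Rightarrow> ennreal" where
  "slice_transform g \<tau> = (\<integral>\<^sup>+\<eta>. g \<eta> \<partial>subsphere_measure \<tau>)"

definition slice_transform_finite ::
    "(('a::euclidean_space \<times> real) \<Rightarrow> 'b::{banach,second_countable_topology}) \<Rightarrow>
     ('a \<times> real) set \<Rightarrow> bool" where
  "slice_transform_finite f \<tau> \<longleftrightarrow>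
     f \<in> borel_measurable (subsphere_measure \<tau>) \<and>
     slice_transform (\<lambda>\<eta>. ennreal (norm (f \<eta>))) \<tau> < \<infinity>"

lemma slice_transform_finite_iff_integrable:
  "slice_transform_finite f \<tau> \<longleftrightarrow> integrable (subsphere_measure \<tau>) f"
  by (simp add: slice_transform_finite_def slice_transform_def integrable_iff_bounded)

text \<open>The integral in the growth condition, over the cap of height \<open>\<epsilon>\<close> around the north pole. It
  increases with \<open>\<epsilon>\<close>, and for functions locally integrable off the pole its finiteness does not
  depend on \<open>\<epsilon>\<close>. In general it does: a zonal function whose only singularity is at the south pole may
  have an infinite integral for \<open>\<epsilon> = 2\<close> although its slice transform vanishes on all slices near the
  north pole. So for divergence on all slices the failure of the growth condition has to be read as
  divergence for every \<open>\<epsilon>\<close>.\<close>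

definition slice_cap_integral ::
    "nat \<Rightarrow> (('a::euclidean_space \<times> real) \<Rightarrow> 'b::real_normed_vector) \<Rightarrow> real \<Rightarrow> ennreal" where
  "slice_cap_integral k f \<epsilon> =
     (\<integral>\<^sup>+\<eta>\<in>{\<eta>. snd \<eta> > 1 - \<epsilon>}.
        ennreal (norm (f \<eta>) / (1 - snd \<eta>) powr ((real DIM('a) + 1 - real k) / 2))
      \<partial>sphere_measure)"

definition zonal :: "((real^'n) \<times> real \<Rightarrow> 'b) \<Rightarrow> bool" where
  "zonal f \<longleftrightarrow>
     (\<forall>Q x t. rotation_matrix Q \<longrightarrow> (x, t) \<in> sphere 0 1 \<longrightarrow> f (Q *v x, t) = f (x, t))"

end

theory Submission
  imports Defs
begin

text \<open>
  Stereographic projection from the north pole maps the sphere onto \<open>\<real>\<^sup>n\<close>, and it maps the subsphere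
  \<open>\<tau> \<inter> S\<^sup>n\<close> onto the affine plane \<open>\<tau> \<inter> \<real>\<^sup>n\<close>. Both maps are conformal with the same factor
  \<open>2 / (1 + \<bar>x\<bar>\<^sup>2)\<close>, which is also the value of \<open>1 - \<eta>\<^sub>n\<^sub>+\<^sub>1\<close> at the point over \<open>x\<close>
  (\<open>nn_integral_sphere_stereo\<close>, \<open>slice_transform_stereo\<close>). Hence, with \<open>d = k - 1\<close>, the slice transform of
  \<open>f\<close> is the \<open>d\<close>-plane transform of \<open>h(x) = (2 / (1 + \<bar>x\<bar>\<^sup>2))\<^sup>d f\<close>, and the growth condition for \<open>\<epsilon> = 2\<close>
  says that \<open>h\<close> is integrable against \<open>(1 + \<bar>x\<bar>\<^sup>2)\<^bsup>-(n - d)/2\<^esup>\<close> (\<open>nn_integral_plane_weight\<close>).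

  For finiteness on almost all slices, integrate the plane transform of \<open>\<bar>h\<bar>\<close> over all planes \<open>x + V\<close>
  with \<open>\<bar>x\<bar> \<le> R\<close>, where \<open>V\<close> is a random subspace. By Fubini's theorem this is the integral of \<open>\<bar>h(z)\<bar>\<close>
  against the mean volume of the part of \<open>V\<close> within distance \<open>R\<close> of \<open>z\<close>. That mean volume is rotation
  invariant and decreases with \<open>\<bar>z\<bar>\<close>, so it is at most its average over the ball of radius \<open>\<bar>z\<bar>\<close>, which
  is of the order \<open>\<bar>z\<bar>\<^bsup>d - n\<^esup>\<close> (\<open>mean_section_volume_average\<close>, \<open>mean_section_volume_bound\<close>). The
  measurability of \<open>f\<close> on almost all slices comes from the same estimate, applied to the function that is
  \<open>\<infinity>\<close> on the null set where \<open>f\<close> differs from a Borel function.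

  For the statements about all slices, describe points of the unit sphere in the direction space of \<open>\<tau>\<close>
  by their latitude \<open>a\<close> with respect to the pole. The surface measure then has a density
  proportional to \<open>(1 - a\<^sup>2)\<^bsup>(k - 3)/2\<^esup>\<close>, and on a slice of radius \<open>r\<close> the height satisfies \<open>1 - \<eta>\<^sub>n\<^sub>+\<^sub>1 = r\<^sup>2 (1 - a)\<close>
  (\<open>slice_transform_zonal\<close>). So near the pole every slice integrates the profile of a zonal function
  against \<open>(1 - a)\<^bsup>(k - 3)/2\<^esup>\<close>, up to bounded factors. On the whole sphere, where the exponent is
  \<open>(n - 2)/2\<close>, the weight of the growth condition produces the same power, hence divergence of one integral
  is divergence of the other. For the power \<open>(1 - \<eta>\<^sub>n\<^sub>+\<^sub>1)\<^bsup>-\<mu>\<^esup>\<close> the integral converges exactly if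
  \<open>(k - 3)/2 - \<mu> > -1\<close>.
\<close>

section \<open>Lebesgue measure on linear subspaces\<close>

text \<open>Families rather than sets of vectors: a basis that depends measurably on parameters, such as the
  result of the Gram-Schmidt process, has a fixed index set.\<close>

definition orthonormal_family :: "'i set \<Rightarrow> ('i \<Rightarrow> 'a::euclidean_space) \<Rightarrow> bool" where
  "orthonormal_family I w \<longleftrightarrow>
     finite I \<and> (\<forall>i\<in>I. \<forall>j\<in>I. w i \<bullet> w j = (if i = j then 1 else 0))"

lemma orthonormal_familyI:
  assumes "finite I"
    and "\<And>i j. i \<in> I \<Longrightarrow> j \<in> I \<Longrightarrow> w i \<bullet> w j = (if i = j then 1 else 0)"
  shows "orthonormal_family I w"
  unfolding orthonormal_family_def using assms by blast

definition lincomb :: "'i set \<Rightarrow> ('i \<Rightarrow> 'a::real_vector) \<Rightarrow> ('i \<Rightarrow> real) \<Rightarrow> 'a" where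
  "lincomb I w t = (\<Sum>i\<in>I. t i *\<^sub>R w i)"

definition frame_lborel :: "'i set \<Rightarrow> ('i \<Rightarrow> 'a::euclidean_space) \<Rightarrow> 'a measure" where
  "frame_lborel I w = distr (Pi\<^sub>M I (\<lambda>_. lborel)) borel (lincomb I w)"

interpretation lborel_product: product_sigma_finite "\<lambda>_. lborel :: real measure"
  by standard

lemma measurable_lincomb [measurable]:
  "lincomb I w \<in> Pi\<^sub>M I (\<lambda>_. lborel) \<rightarrow>\<^sub>M (borel :: 'a::euclidean_space measure)"
  unfolding lincomb_def by measurable

lemma sets_frame_lborel [simp, measurable_cong]: "sets (frame_lborel I w) = sets borel"
  and space_frame_lborel [simp]: "space (frame_lborel I w) = UNIV"
  by (simp_all add: frame_lborel_def)

lemma nn_integral_frame_lborel: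
  assumes [measurable]: "h \<in> borel_measurable borel"
  shows "(\<integral>\<^sup>+x. h x \<partial>frame_lborel I w) = (\<integral>\<^sup>+t. h (lincomb I w t) \<partial>Pi\<^sub>M I (\<lambda>_. lborel))"
  unfolding frame_lborel_def by (subst nn_integral_distr) auto

context
  fixes I :: "'i set" and w :: "'i \<Rightarrow> 'a::euclidean_space"
  assumes ortho: "orthonormal_family I w"
begin

lemma orthonormal_family_finite [simp]: "finite I"
  using ortho by (simp add: orthonormal_family_def)

lemma orthonormal_family_inner: "i \<in> I \<Longrightarrow> j \<in> I \<Longrightarrow> w i \<bullet> w j = (if i = j then 1 else 0)"
  using ortho by (simp add: orthonormal_family_def)

lemma orthonormal_family_inj: "inj_on w I"
  by (rule inj_onI) (metis orthonormal_family_inner zero_neq_one)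

lemma lincomb_inner: "i \<in> I \<Longrightarrow> lincomb I w t \<bullet> w i = t i"
  by (simp add: lincomb_def inner_sum_left orthonormal_family_inner if_distrib [of "(*) _"]
      cong: if_cong)

lemma norm_lincomb: "norm (lincomb I w t) = sqrt (\<Sum>i\<in>I. (t i)\<^sup>2)"
proof -
  have "lincomb I w t \<bullet> lincomb I w t = (\<Sum>i\<in>I. t i * (lincomb I w t \<bullet> w i))"
    by (subst (2) lincomb_def) (simp add: inner_sum_right)
  then show ?thesis
    by (simp add: norm_eq_sqrt_inner lincomb_inner power2_eq_square)
qed

lemma lincomb_in_span: "lincomb I w t \<in> span (w ` I)"
  unfolding lincomb_def by (intro span_sum span_scale span_base) auto

lemma lincomb_inner_eq:
  assumes "x \<in> span (w ` I)"
  shows "lincomb I w (\<lambda>i. x \<bullet> w i) = x"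
  using assms
proof (induction rule: span_induct_alt)
  case (step c x y)
  then obtain j where j: "j \<in> I" "x = w j" by auto
  have "lincomb I w (\<lambda>i. (c *\<^sub>R x + y) \<bullet> w i)
      = c *\<^sub>R lincomb I w (\<lambda>i. w j \<bullet> w i) + lincomb I w (\<lambda>i. y \<bullet> w i)"
    by (simp add: lincomb_def j inner_add_left scaleR_left_distrib sum.distrib scaleR_sum_right)
  also have "lincomb I w (\<lambda>i. w j \<bullet> w i) = w j"
    using j(1) by (simp add: lincomb_def orthonormal_family_inner if_distrib [of "\<lambda>a. a *\<^sub>R _"]
        cong: if_cong sum.cong)
  finally show ?case using step j by simp
qed (simp add: lincomb_def)

lemma dim_orthonormal_family: "dim (span (w ` I)) = card I"
proof -
  have "independent (w ` I)"
  proof (rule pairwise_orthogonal_independent)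
    show "pairwise orthogonal (w ` I)"
      using orthonormal_family_inner by (auto simp: pairwise_def orthogonal_def)
    show "0 \<notin> w ` I"
      using orthonormal_family_inner by (metis imageE inner_zero_left zero_neq_one)
  qed
  then show ?thesis
    by (metis card_image dim_eq_card_independent dim_span orthonormal_family_inj)
qed

lemma emeasure_frame_lborel_cball:
  assumes "r > 0"
  shows "emeasure (frame_lborel I w) (cball 0 r) = ennreal (unit_ball_vol (card I) * r ^ card I)"
proof -
  have "emeasure (frame_lborel I w) (cball 0 r)
      = emeasure (Pi\<^sub>M I (\<lambda>_. lborel))
          ({t. sqrt (\<Sum>i\<in>I. (t i)\<^sup>2) \<le> r} \<inter> space (Pi\<^sub>M I (\<lambda>_. lborel)))"
    unfolding frame_lborel_def
    by (subst emeasure_distr) (auto simp: norm_lincomb vimage_def intro!: arg_cong2[where f=emeasure])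
  then show ?thesis using emeasure_cball_aux[of I r] assms by simp
qed

lemma sigma_finite_frame_lborel: "sigma_finite_measure (frame_lborel I w)"
proof
  let ?A = "range (\<lambda>n::nat. cball (0::'a) (real (Suc n)))"
  have "x \<in> \<Union>?A" for x :: 'a
  proof -
    obtain n :: nat where "norm x \<le> real n" using real_arch_simple by blast
    then have "x \<in> cball 0 (real (Suc n))" by simp
    then show ?thesis by blast
  qed
  moreover have "\<forall>a\<in>?A. emeasure (frame_lborel I w) a \<noteq> \<infinity>"
    by (auto simp: emeasure_frame_lborel_cball simp del: of_nat_Suc)
  ultimately show "\<exists>A. countable A \<and> A \<subseteq> sets (frame_lborel I w) \<and>
      \<Union>A = space (frame_lborel I w) \<and> (\<forall>a\<in>A. emeasure (frame_lborel I w) a \<noteq> \<infinity>)"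
    by (intro exI[of _ ?A]) auto
qed

end

lemma nn_integral_lborel_PiM_affine:
  fixes c :: real
  assumes "finite I" and c: "c \<noteq> 0" and "h \<in> borel_measurable (Pi\<^sub>M I (\<lambda>_. lborel))"
  shows "(\<integral>\<^sup>+t. h t \<partial>Pi\<^sub>M I (\<lambda>_. lborel))
    = ennreal (\<bar>c\<bar> ^ card I) * (\<integral>\<^sup>+t. h (\<lambda>i\<in>I. a i + c * t i) \<partial>Pi\<^sub>M I (\<lambda>_. lborel))"
  using assms(1,3)
proof (induction arbitrary: h)
  case empty
  then show ?case by (simp add: PiM_empty nn_integral_count_space_finite)
next
  case (insert j I)
  note [measurable] = insert.prems
  have upd: "(\<lambda>i\<in>insert j I. a i + c * (x(j := y)) i) = (\<lambda>i\<in>I. a i + c * x i)(j := a j + c * y)"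
    for x y using insert.hyps by (auto simp: restrict_def)
  let ?P = "\<lambda>I. Pi\<^sub>M I (\<lambda>_. lborel :: real measure)"
  have [measurable]: "(\<lambda>z. (fst z)(j := k (snd z))) \<in> ?P I \<Otimes>\<^sub>M lborel \<rightarrow>\<^sub>M ?P (insert j I)"
    if [measurable]: "k \<in> borel_measurable borel" for k :: "real \<Rightarrow> real"
    by (rule measurable_fun_upd[where J=I]) auto
  have m1: "(\<lambda>z. h ((fst z)(j := a j + c * snd z))) \<in> borel_measurable (?P I \<Otimes>\<^sub>M lborel)"
    by (rule measurable_compose[OF _ insert.prems]) measurable
  have m2 [measurable]: "(\<lambda>x. \<integral>\<^sup>+y. h (x(j := a j + c * y)) \<partial>lborel) \<in> borel_measurable (?P I)"
    using lborel.borel_measurable_nn_integral[of "\<lambda>x y. h (x(j := a j + c * y))" "?P I"] m1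
    by (simp add: case_prod_unfold)
  have m3: "(\<lambda>y. h (x(j := y))) \<in> borel_measurable borel" if "x \<in> space (?P I)" for x
    using measurable_comp[OF measurable_component_update[OF that insert.hyps(2)] insert.prems]
    by (simp add: comp_def)
  have m4: "(\<lambda>t. h (\<lambda>i\<in>insert j I. a i + c * t i)) \<in> borel_measurable (?P (insert j I))"
    by (rule measurable_compose[OF _ insert.prems]) measurable
  have "(\<integral>\<^sup>+t. h t \<partial>?P (insert j I)) = (\<integral>\<^sup>+x. \<integral>\<^sup>+y. h (x(j := y)) \<partial>lborel \<partial>?P I)"
    by (intro lborel_product.product_nn_integral_insert insert)
  also have "\<dots> = (\<integral>\<^sup>+x. ennreal \<bar>c\<bar> * (\<integral>\<^sup>+y. h (x(j := a j + c * y)) \<partial>lborel) \<partial>?P I)"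
    by (intro nn_integral_cong nn_integral_real_affine c m3)
  also have "\<dots> = ennreal \<bar>c\<bar> * (\<integral>\<^sup>+x. (\<integral>\<^sup>+y. h (x(j := a j + c * y)) \<partial>lborel) \<partial>?P I)"
    by (intro nn_integral_cmult m2)
  also have "(\<integral>\<^sup>+x. (\<integral>\<^sup>+y. h (x(j := a j + c * y)) \<partial>lborel) \<partial>?P I)
     = ennreal (\<bar>c\<bar> ^ card I)
        * (\<integral>\<^sup>+x. (\<integral>\<^sup>+y. h ((\<lambda>i\<in>I. a i + c * x i)(j := a j + c * y)) \<partial>lborel) \<partial>?P I)"
    by (rule insert.IH[OF m2])
  also have "(\<integral>\<^sup>+x. (\<integral>\<^sup>+y. h ((\<lambda>i\<in>I. a i + c * x i)(j := a j + c * y)) \<partial>lborel) \<partial>?P I)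
     = (\<integral>\<^sup>+t. h (\<lambda>i\<in>insert j I. a i + c * t i) \<partial>?P (insert j I))"
    unfolding lborel_product.product_nn_integral_insert[OF insert.hyps m4] upd ..
  finally show ?case
    unfolding card_insert_disjoint[OF insert.hyps] power_Suc
    by (simp only: ennreal_mult' abs_ge_zero mult.assoc)
qed

lemma nn_integral_frame_lborel_affine:
  fixes c :: real and a :: "'a::euclidean_space"
  assumes ortho: "orthonormal_family I w" and c: "c \<noteq> 0" and a: "a \<in> span (w ` I)"
    and [measurable]: "h \<in> borel_measurable borel"
  shows "(\<integral>\<^sup>+x. h x \<partial>frame_lborel I w)
    = ennreal (\<bar>c\<bar> ^ card I) * (\<integral>\<^sup>+x. h (a + c *\<^sub>R x) \<partial>frame_lborel I w)"
proof -
  note [simp] = orthonormal_family_finite[OF ortho]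
  have "lincomb I w (\<lambda>i\<in>I. a \<bullet> w i + c * t i) = a + c *\<^sub>R lincomb I w t" for t
  proof -
    have "lincomb I w (\<lambda>i\<in>I. a \<bullet> w i + c * t i) = lincomb I w (\<lambda>i. a \<bullet> w i) + c *\<^sub>R lincomb I w t"
      by (simp add: lincomb_def scaleR_left_distrib sum.distrib scaleR_sum_right cong: sum.cong)
    then show ?thesis by (simp add: lincomb_inner_eq[OF ortho a])
  qed
  note eq = this
  have "(\<integral>\<^sup>+x. h x \<partial>frame_lborel I w) = (\<integral>\<^sup>+t. h (lincomb I w t) \<partial>Pi\<^sub>M I (\<lambda>_. lborel))"
    by (simp add: nn_integral_frame_lborel)
  also have "\<dots> = ennreal (\<bar>c\<bar> ^ card I)
      * (\<integral>\<^sup>+t. h (lincomb I w (\<lambda>i\<in>I. a \<bullet> w i + c * t i)) \<partial>Pi\<^sub>M I (\<lambda>_. lborel))"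
    by (rule nn_integral_lborel_PiM_affine[OF _ c]) simp_all
  also have "\<dots> = ennreal (\<bar>c\<bar> ^ card I) * (\<integral>\<^sup>+x. h (a + c *\<^sub>R x) \<partial>frame_lborel I w)"
    by (simp add: nn_integral_frame_lborel eq)
  finally show ?thesis .
qed

lemma AE_frame_lborel_span:
  assumes "orthonormal_family I w"
  shows "AE x in frame_lborel I w. x \<in> span (w ` I)"
  unfolding frame_lborel_def
  by (subst AE_distr_iff) (auto simp: lincomb_in_span[OF assms] borel_closed)

text \<open>This is the uniqueness of Haar measure. If \<open>\<mu>\<close> and \<open>\<nu>\<close> are translation invariant on \<open>V\<close> and \<open>B\<close> is the
  unit ball, then shearing \<open>\<integral>\<integral> h(x) 1\<^sub>B(y) d\<nu>(y) d\<mu>(x)\<close> first in \<open>x\<close> and then in \<open>y\<close> yields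
  \<open>\<nu>(B) \<integral> h d\<mu> = \<mu>(B) \<integral> h d\<nu>\<close>; and the unit ball has the same volume in all orthonormal frames.\<close>

lemma frame_lborel_cong_span:
  fixes w :: "'i \<Rightarrow> 'a::euclidean_space" and w' :: "'j \<Rightarrow> 'a"
  assumes o: "orthonormal_family I w" and o': "orthonormal_family J w'"
    and span: "span (w ` I) = span (w' ` J)"
  shows "frame_lborel I w = frame_lborel J w'"
proof -
  let ?M = "frame_lborel I w" and ?N = "frame_lborel J w'" and ?V = "span (w ` I)"
  define b :: "'a \<Rightarrow> ennreal" where "b = indicator (cball 0 1)"
  have [measurable]: "b \<in> borel_measurable borel" by (auto simp: b_def intro!: borel_measurable_indicator)
  define \<kappa> where "\<kappa> = ennreal (unit_ball_vol (card I))"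
  have card: "card J = card I"
    using dim_orthonormal_family[OF o] dim_orthonormal_family[OF o'] span by simp
  have \<kappa>: "integral\<^sup>N ?M b = \<kappa>" "integral\<^sup>N ?N b = \<kappa>"
    using emeasure_frame_lborel_cball[OF o, of 1] emeasure_frame_lborel_cball[OF o', of 1]
    by (auto simp: b_def \<kappa>_def card)
  have \<kappa>0: "\<kappa> \<noteq> 0" "\<kappa> \<noteq> \<infinity>" by (auto simp: \<kappa>_def ennreal_eq_0_iff not_le)
  interpret M: sigma_finite_measure ?M by (rule sigma_finite_frame_lborel[OF o])
  interpret N: sigma_finite_measure ?N by (rule sigma_finite_frame_lborel[OF o'])
  interpret P: pair_sigma_finite ?M ?N ..
  note AEM = AE_frame_lborel_span[OF o] and AEN = AE_frame_lborel_span[OF o', folded span]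
  have "integral\<^sup>N ?M h = integral\<^sup>N ?N h" if [measurable]: "h \<in> borel_measurable borel" for h
  proof -
    have "integral\<^sup>N ?M h * \<kappa> = (\<integral>\<^sup>+x. \<integral>\<^sup>+y. h x * b y \<partial>?N \<partial>?M)"
      by (simp add: nn_integral_cmult nn_integral_multc \<kappa>)
    also have "\<dots> = (\<integral>\<^sup>+y. \<integral>\<^sup>+x. h x * b y \<partial>?M \<partial>?N)"
      by (rule P.Fubini'[symmetric]) measurable
    also have "\<dots> = (\<integral>\<^sup>+y. \<integral>\<^sup>+x. h (y + x) * b y \<partial>?M \<partial>?N)"
    proof (intro nn_integral_cong_AE, use AEN in eventually_elim)
      case (elim y)
      then show ?case
        using nn_integral_frame_lborel_affine[OF o, of 1 y "\<lambda>x. h x * b y"] by simp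
    qed
    also have "\<dots> = (\<integral>\<^sup>+x. \<integral>\<^sup>+y. h (y + x) * b y \<partial>?N \<partial>?M)"
      by (rule P.Fubini') measurable
    also have "\<dots> = (\<integral>\<^sup>+x. \<integral>\<^sup>+y. h y * b (y - x) \<partial>?N \<partial>?M)"
    proof (intro nn_integral_cong_AE, use AEM in eventually_elim)
      case (elim x)
      then show ?case
        using nn_integral_frame_lborel_affine[OF o', of 1 x "\<lambda>y. h y * b (y - x)"]
        by (simp add: span add.commute)
    qed
    also have "\<dots> = (\<integral>\<^sup>+y. \<integral>\<^sup>+x. h y * b (y - x) \<partial>?M \<partial>?N)"
      by (rule P.Fubini'[symmetric]) measurable
    also have "\<dots> = (\<integral>\<^sup>+y. h y * \<kappa> \<partial>?N)"
    proof (intro nn_integral_cong_AE, use AEN in eventually_elim)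
      case (elim y)
      then have "\<kappa> = (\<integral>\<^sup>+x. b (y - x) \<partial>?M)"
        using nn_integral_frame_lborel_affine[OF o, of "-1" y b] \<kappa>(1) by simp
      then show ?case by (simp add: nn_integral_cmult)
    qed
    also have "\<dots> = integral\<^sup>N ?N h * \<kappa>"
      by (simp add: nn_integral_multc)
    finally show ?thesis
      using \<kappa>0 by (simp add: mult.commute[of _ \<kappa>] ennreal_mult_cancel_left)
  qed
  note eq = this
  show ?thesis
  proof (rule measure_eqI)
    fix A assume "A \<in> sets ?M"
    then show "emeasure ?M A = emeasure ?N A"
      using eq[of "indicator A"] by simp
  qed simp
qed

lemma orthonormal_basis_family:
  assumes "orthonormal_basis V B"
  shows "orthonormal_family B id" "span (id ` B) = V"
proof -
  have "finite B"
    using assms pairwise_orthogonal_imp_finite by (auto simp: orthonormal_basis_def)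
  moreover have "b \<bullet> b' = (if b = b' then 1 else 0)" if "b \<in> B" "b' \<in> B" for b b'
  proof (cases "b = b'")
    case True
    then show ?thesis using assms that by (simp add: orthonormal_basis_def norm_eq_1)
  next
    case False
    then show ?thesis
      using assms that pairwiseD[of orthogonal B b b']
      by (simp add: orthonormal_basis_def orthogonal_def)
  qed
  ultimately show "orthonormal_family B id"
    unfolding orthonormal_family_def id_apply by blast
  show "span (id ` B) = V"
    using assms by (simp add: orthonormal_basis_def)
qed

lemma orthonormal_family_subspace_exists:
  fixes V :: "'a::euclidean_space set"
  assumes "subspace V"
  obtains B where "orthonormal_basis V B"
proof -
  obtain B where "B \<subseteq> V" "pairwise orthogonal B" "\<And>x. x \<in> B \<Longrightarrow> norm x = 1" "span B = V"
    using orthonormal_basis_subspace[OF assms] by metis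
  then show ?thesis
    by (intro that[of B]) (simp add: orthonormal_basis_def)
qed

lemma subspace_lborel_eq_frame_lborel:
  assumes o: "orthonormal_family I w" and V: "span (w ` I) = V"
  shows "subspace_lborel V = frame_lborel I w"
proof -
  define B where "B = (SOME B. orthonormal_basis V B)"
  have "subspace V" using V by auto
  then obtain B' where "orthonormal_basis V B'"
    by (rule orthonormal_family_subspace_exists)
  then have B: "orthonormal_basis V B"
    unfolding B_def by (rule someI)
  have "subspace_lborel V = frame_lborel B id"
    unfolding subspace_lborel_def frame_lborel_def lincomb_def[abs_def] B_def Let_def id_apply ..
  also have "\<dots> = frame_lborel I w"
    using orthonormal_basis_family[OF B] V by (intro frame_lborel_cong_span o) auto
  finally show ?thesis .
qed

lemma subspace_lborel_eq_frame_lborelE: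
  fixes V :: "'a::euclidean_space set"
  assumes "subspace V"
  obtains B where "orthonormal_family B id" "span (id ` B) = V" "card B = dim V"
    "subspace_lborel V = frame_lborel B id"
proof -
  obtain B where "orthonormal_basis V B"
    by (rule orthonormal_family_subspace_exists[OF assms])
  note B = orthonormal_basis_family[OF this]
  show ?thesis
    using that[OF B] dim_orthonormal_family[OF B(1)] subspace_lborel_eq_frame_lborel[OF B] B(2)
    by metis
qed

lemma sets_subspace_lborel [simp, measurable_cong]: "sets (subspace_lborel V) = sets borel"
  and space_subspace_lborel [simp]: "space (subspace_lborel V) = UNIV"
  by (simp_all add: subspace_lborel_def Let_def)

context
  fixes V :: "'a::euclidean_space set"
  assumes V: "subspace V"
begin

lemma sigma_finite_subspace_lborel: "sigma_finite_measure (subspace_lborel V)"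
  by (rule subspace_lborel_eq_frame_lborelE[OF V]) (simp add: sigma_finite_frame_lborel)

lemma AE_subspace_lborel: "AE x in subspace_lborel V. x \<in> V"
  by (rule subspace_lborel_eq_frame_lborelE[OF V]) (metis AE_frame_lborel_span)

lemma nn_integral_subspace_lborel_cong:
  "(\<And>x. x \<in> V \<Longrightarrow> f x = g x) \<Longrightarrow> integral\<^sup>N (subspace_lborel V) f = integral\<^sup>N (subspace_lborel V) g"
  by (rule nn_integral_cong_AE) (use AE_subspace_lborel in eventually_elim, auto)

lemma nn_integral_subspace_lborel_affine:
  fixes c :: real
  assumes "c \<noteq> 0" "a \<in> V" "h \<in> borel_measurable borel"
  shows "(\<integral>\<^sup>+x. h x \<partial>subspace_lborel V)
    = ennreal (\<bar>c\<bar> ^ dim V) * (\<integral>\<^sup>+x. h (a + c *\<^sub>R x) \<partial>subspace_lborel V)"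
proof (rule subspace_lborel_eq_frame_lborelE[OF V])
  fix B
  assume "orthonormal_family B id" "span (id ` B) = V" "card B = dim V"
    "subspace_lborel V = frame_lborel B id"
  then show ?thesis
    using nn_integral_frame_lborel_affine[of B id c a h] assms by simp
qed

lemma emeasure_subspace_lborel_cball:
  "r > 0 \<Longrightarrow> emeasure (subspace_lborel V) (cball 0 r) = ennreal (unit_ball_vol (dim V) * r ^ dim V)"
  by (rule subspace_lborel_eq_frame_lborelE[OF V]) (simp add: emeasure_frame_lborel_cball)

text \<open>Fubini's theorem for the orthogonal splitting of a subspace into a hyperplane and a line.\<close>

lemma nn_integral_subspace_lborel_insert:
  assumes p: "norm p = 1" and orth: "\<And>x. x \<in> V \<Longrightarrow> x \<bullet> p = 0"
    and [measurable]: "h \<in> borel_measurable borel"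
  shows "(\<integral>\<^sup>+x. h x \<partial>subspace_lborel (span (insert p V)))
    = (\<integral>\<^sup>+y. \<integral>\<^sup>+a. h (a *\<^sub>R p + y) \<partial>lborel \<partial>subspace_lborel V)" (is ?Fubini)
    and "dim (span (insert p V)) = Suc (dim V)" (is ?dim)
proof -
  obtain B where B: "orthonormal_family B id" "span (id ` B) = V" "card B = dim V"
    "subspace_lborel V = frame_lborel B id"
    by (rule subspace_lborel_eq_frame_lborelE[OF V])
  have [simp]: "finite B" by (rule orthonormal_family_finite[OF B(1)])
  have BV: "B \<subseteq> V" using B(2) span_superset by auto
  have pB: "p \<notin> B" using orth[of p] p BV by (auto simp: norm_eq_1)
  have o: "orthonormal_family (insert p B) id"
  proof (rule orthonormal_familyI)
    fix i j assume "i \<in> insert p B" "j \<in> insert p B"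
    then consider "i \<in> B" "j \<in> B" | "i = p" "j \<in> B" | "i \<in> B" "j = p" | "i = p" "j = p" by blast
    then show "id i \<bullet> id j = (if i = j then 1 else 0)"
    proof cases
      case 1
      then show ?thesis using orthonormal_family_inner[OF B(1)] by simp
    next
      case 2
      then show ?thesis using orth[of j] BV pB by (auto simp: inner_commute)
    next
      case 3
      then show ?thesis using orth[of i] BV pB by auto
    next
      case 4
      then show ?thesis using p by (simp add: norm_eq_1)
    qed
  qed simp
  have span: "span (id ` insert p B) = span (insert p V)"
    using B(2) by (simp add: span_insert span_eq_iff[THEN iffD2, OF V])
  have lc: "lincomb (insert p B) id (t(p := a)) = a *\<^sub>R p + lincomb B id t" for t a
  proof -
    have "(\<Sum>i\<in>B. (if i = p then a else t i) *\<^sub>R i) = (\<Sum>i\<in>B. t i *\<^sub>R i)"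
      using pB by (intro sum.cong) auto
    then show ?thesis using pB by (simp add: lincomb_def)
  qed
  show ?dim
    using dim_orthonormal_family[OF o] B(3) pB by (simp add: span[symmetric])
  have "(\<integral>\<^sup>+x. h x \<partial>subspace_lborel (span (insert p V)))
      = (\<integral>\<^sup>+t. h (lincomb (insert p B) id t) \<partial>Pi\<^sub>M (insert p B) (\<lambda>_. lborel))"
    by (subst subspace_lborel_eq_frame_lborel[OF o span]) (simp add: nn_integral_frame_lborel)
  also have "\<dots> = (\<integral>\<^sup>+t. \<integral>\<^sup>+a. h (a *\<^sub>R p + lincomb B id t) \<partial>lborel \<partial>Pi\<^sub>M B (\<lambda>_. lborel))"
    by (subst lborel_product.product_nn_integral_insert) (use pB in \<open>auto simp: lc\<close>)
  also have "\<dots> = (\<integral>\<^sup>+y. \<integral>\<^sup>+a. h (a *\<^sub>R p + y) \<partial>lborel \<partial>subspace_lborel V)"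
    unfolding B(4) by (subst nn_integral_frame_lborel) auto
  finally show ?Fubini .
qed

end

lemma orthonormal_family_Basis: "orthonormal_family (Basis :: 'a::euclidean_space set) id"
  by (rule orthonormal_familyI) (simp_all add: inner_Basis)

lemma subspace_lborel_UNIV: "subspace_lborel UNIV = (lborel :: 'a::euclidean_space measure)"
  by (subst subspace_lborel_eq_frame_lborel[OF orthonormal_family_Basis])
     (auto simp: frame_lborel_def lborel_eq[where 'a='a] lincomb_def[abs_def])

text \<open>An orthogonal map carries an orthonormal basis to another one, and both define Lebesgue measure.\<close>

lemma nn_integral_lborel_orthogonal_transformation:
  fixes Q :: "'a::euclidean_space \<Rightarrow> 'a"
  assumes Q: "orthogonal_transformation Q" and [measurable]: "h \<in> borel_measurable borel"
  shows "(\<integral>\<^sup>+x. h (Q x) \<partial>lborel) = (\<integral>\<^sup>+x. h x \<partial>lborel)"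
proof -
  have lin: "linear Q" by (rule orthogonal_transformation_linear[OF Q])
  then have [measurable]: "Q \<in> borel \<rightarrow>\<^sub>M borel"
    by (intro borel_measurable_continuous_onI linear_continuous_on)
       (simp add: linear_conv_bounded_linear)
  have o: "orthonormal_family Basis Q"
    using Q by (intro orthonormal_familyI) (simp_all add: orthogonal_transformation_def inner_Basis)
  have span: "span (Q ` Basis) = UNIV"
    using linear_span_image[OF lin, of Basis] orthogonal_transformation_surj[OF Q] by simp
  have eq: "Q (lincomb Basis id t) = lincomb Basis Q t" for t
    by (simp add: lincomb_def linear_sum[OF lin] linear_scale[OF lin])
  have "(\<integral>\<^sup>+x. h (Q x) \<partial>lborel) = (\<integral>\<^sup>+x. h (Q x) \<partial>frame_lborel Basis id)"
    by (subst subspace_lborel_UNIV[symmetric])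
       (simp add: subspace_lborel_eq_frame_lborel[OF orthonormal_family_Basis])
  also have "\<dots> = (\<integral>\<^sup>+x. h x \<partial>frame_lborel Basis Q)"
    by (simp add: nn_integral_frame_lborel eq)
  also have "frame_lborel Basis Q = lborel"
    by (metis subspace_lborel_eq_frame_lborel[OF o span] subspace_lborel_UNIV)
  finally show ?thesis .
qed

lemma nn_integral_subspace_lborel_Times_0:
  fixes W :: "'a::euclidean_space set"
  assumes W: "subspace W" and [measurable]: "h \<in> borel_measurable borel"
  shows "(\<integral>\<^sup>+z. h z \<partial>subspace_lborel (W \<times> {0::real})) = (\<integral>\<^sup>+y. h (y, 0) \<partial>subspace_lborel W)"
    and "dim (W \<times> {0::real}) = dim W"
proof -
  obtain B where B: "orthonormal_family B id" "span (id ` B) = W" "card B = dim W"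
    "subspace_lborel W = frame_lborel B id"
    by (rule subspace_lborel_eq_frame_lborelE[OF W])
  let ?w = "\<lambda>b::'a. (b, 0::real)"
  have lin: "linear ?w" by (auto intro!: linearI)
  have o: "orthonormal_family B ?w"
    using orthonormal_family_finite[OF B(1)] orthonormal_family_inner[OF B(1)]
    by (intro orthonormal_familyI) simp_all
  have span: "span (?w ` B) = W \<times> {0}"
    using linear_span_image[OF lin, of B] B(2) by auto
  have lc: "lincomb B ?w t = (lincomb B id t, 0)" for t
    by (simp add: lincomb_def prod_eq_iff fst_sum snd_sum)
  show "dim (W \<times> {0::real}) = dim W"
    using dim_orthonormal_family[OF o] B(3) by (simp add: span)
  show "(\<integral>\<^sup>+z. h z \<partial>subspace_lborel (W \<times> {0::real})) = (\<integral>\<^sup>+y. h (y, 0) \<partial>subspace_lborel W)"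
    by (subst subspace_lborel_eq_frame_lborel[OF o span], subst B(4))
       (simp add: nn_integral_frame_lborel lc)
qed

section \<open>Integration over unit spheres\<close>

lemma null_sets_subspace_lborel_0:
  assumes V: "subspace V" and dim: "dim V > 0"
  shows "{0} \<in> null_sets (subspace_lborel V)"
proof -
  have "emeasure (subspace_lborel V) {0} \<le> ennreal (unit_ball_vol (dim V) * e ^ dim V)" if "e > 0" for e
    unfolding emeasure_subspace_lborel_cball[OF V that, symmetric]
    using that by (intro emeasure_mono) auto
  then have "\<forall>\<^sub>F e in at_right 0. emeasure (subspace_lborel V) {0} \<le> ennreal (unit_ball_vol (dim V) * e ^ dim V)"
    by (auto simp: eventually_at_right_field intro: exI[of _ 1])
  moreover have "((\<lambda>e. ennreal (unit_ball_vol (dim V) * e ^ dim V)) \<longlongrightarrow> ennreal (unit_ball_vol (dim V) * 0 ^ dim V)) (at_right 0)"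
    by (intro tendsto_intros)
  ultimately have "emeasure (subspace_lborel V) {0} \<le> ennreal (unit_ball_vol (dim V) * 0 ^ dim V)"
    by (intro tendsto_lowerbound[of _ _ "at_right (0::real)"]) auto
  also have "\<dots> = 0" using dim by (simp only: zero_power mult_zero_right ennreal_0)
  finally show ?thesis by (auto intro!: null_setsI)
qed

text \<open>The surface measure as a Borel measure on the ambient space, so that joint measurability on products
  can be derived from that of functions on the whole space.\<close>

definition sphere_borel :: "'a::euclidean_space set \<Rightarrow> 'a measure" where
  "sphere_borel V = distr (unit_sphere_measure V) borel (\<lambda>x. x)"

lemma sets_sphere_borel [simp, measurable_cong]: "sets (sphere_borel V) = sets borel"
  and space_sphere_borel [simp]: "space (sphere_borel V) = UNIV"
  by (simp_all add: sphere_borel_def)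

lemma sets_unit_sphere_measure [simp]:
  "sets (unit_sphere_measure V) = sets (restrict_space borel (V \<inter> sphere 0 1))"
  and space_unit_sphere_measure [simp]: "space (unit_sphere_measure V) = V \<inter> sphere 0 1"
  by (simp_all add: unit_sphere_measure_def space_scale_measure space_restrict_space)

lemma measurable_unit_sphere_measure:
  "G \<in> borel_measurable borel \<Longrightarrow> G \<in> borel_measurable (unit_sphere_measure V)"
  by (subst measurable_cong_sets[OF sets_unit_sphere_measure refl])
     (rule measurable_restrict_space1)

lemma nn_integral_unit_sphere_measure:
  assumes "G \<in> borel_measurable borel"
  shows "(\<integral>\<^sup>+x. G x \<partial>unit_sphere_measure V) = (\<integral>\<^sup>+x. G x \<partial>sphere_borel V)"
  unfolding sphere_borel_def using assms
  by (subst nn_integral_distr) (auto intro!: measurable_unit_sphere_measure)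

lemma nn_integral_sphere_borel:
  assumes V: "subspace V" and [measurable]: "G \<in> borel_measurable borel"
  shows "(\<integral>\<^sup>+x. G x \<partial>sphere_borel V)
    = of_nat (dim V) * (\<integral>\<^sup>+x. indicator {x. x \<noteq> 0 \<and> norm x \<le> 1} x * G (sgn x) \<partial>subspace_lborel V)"
proof -
  have [measurable]: "V \<in> sets borel" by (intro borel_closed closed_subspace V)
  let ?D = "V \<inter> cball 0 1 - {0}"
  have [measurable]: "sgn \<in> borel \<rightarrow>\<^sub>M (borel :: 'a measure)"
    by (simp add: sgn_div_norm[abs_def])
  have D: "?D \<in> sets borel" by measurable
  have sgn: "sgn \<in> restrict_space (subspace_lborel V) ?D \<rightarrow>\<^sub>M restrict_space borel (V \<inter> sphere 0 1)"
    by (rule measurable_restrict_space2)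
       (auto simp: space_restrict_space norm_sgn sgn_div_norm subspace_scale[OF V]
          intro!: measurable_restrict_space1)
  have "(\<integral>\<^sup>+x. G x \<partial>sphere_borel V)
    = of_nat (dim V) * (\<integral>\<^sup>+x. G (sgn x) \<partial>restrict_space (subspace_lborel V) ?D)"
    unfolding nn_integral_unit_sphere_measure[OF assms(2), symmetric] unit_sphere_measure_def
    using nn_integral_distr[OF sgn, of G] measurable_restrict_space1[OF assms(2)]
    by (subst nn_integral_scale_measure) (auto intro!: measurable_restrict_space1)
  also have "(\<integral>\<^sup>+x. G (sgn x) \<partial>restrict_space (subspace_lborel V) ?D)
     = (\<integral>\<^sup>+x. G (sgn x) * indicator ?D x \<partial>subspace_lborel V)"
    using D by (subst nn_integral_restrict_space) auto
  also have "\<dots> = (\<integral>\<^sup>+x. indicator {x. x \<noteq> 0 \<and> norm x \<le> 1} x * G (sgn x) \<partial>subspace_lborel V)"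
    by (intro nn_integral_subspace_lborel_cong V) (auto simp: indicator_def)
  finally show ?thesis .
qed

context
  fixes V :: "'a::euclidean_space set"
  assumes V: "subspace V"
begin

lemma AE_sphere_borel: "AE x in sphere_borel V. x \<in> V \<and> norm x = 1"
proof -
  have [measurable]: "V \<in> sets borel" by (intro borel_closed closed_subspace V)
  have "AE x in unit_sphere_measure V. x \<in> V \<and> norm x = 1"
    by (rule AE_I2) auto
  then show ?thesis
    unfolding sphere_borel_def by (subst AE_distr_iff) (auto intro: measurable_unit_sphere_measure)
qed

lemma nn_integral_sphere_borel_cong:
  "(\<And>x. x \<in> V \<Longrightarrow> norm x = 1 \<Longrightarrow> f x = g x) \<Longrightarrow> integral\<^sup>N (sphere_borel V) f = integral\<^sup>N (sphere_borel V) g"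
  by (rule nn_integral_cong_AE) (use AE_sphere_borel in eventually_elim, auto)

lemma emeasure_sphere_borel:
  assumes "dim V > 0"
  shows "emeasure (sphere_borel V) UNIV = ennreal (dim V * unit_ball_vol (dim V))"
proof -
  have "emeasure (sphere_borel V) UNIV = (\<integral>\<^sup>+x. 1 \<partial>sphere_borel V)" by simp
  also have "\<dots> = of_nat (dim V) * (\<integral>\<^sup>+x. indicator {x. x \<noteq> 0 \<and> norm x \<le> 1} x \<partial>subspace_lborel V)"
    by (subst nn_integral_sphere_borel[OF V]) auto
  also have "(\<integral>\<^sup>+x. indicator {x. x \<noteq> 0 \<and> norm x \<le> 1} x \<partial>subspace_lborel V)
      = emeasure (subspace_lborel V) (cball 0 1 - {0})"
    by (subst nn_integral_indicator) (auto intro!: arg_cong[where f="emeasure _"])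
  also have "\<dots> = emeasure (subspace_lborel V) (cball 0 1)"
    by (rule emeasure_Diff_null_set[OF null_sets_subspace_lborel_0[OF V assms]]) simp
  finally show ?thesis
    by (simp add: emeasure_subspace_lborel_cball[OF V] ennreal_mult' ennreal_of_nat_eq_real_of_nat)
qed

lemma finite_measure_sphere_borel: "finite_measure (sphere_borel V)"
proof (cases "dim V = 0")
  case True
  have "emeasure (sphere_borel V) UNIV = (\<integral>\<^sup>+x. 1 \<partial>sphere_borel V)" by simp
  also have "\<dots> = 0" by (subst nn_integral_sphere_borel[OF V]) (auto simp: True)
  finally show ?thesis by (intro finite_measureI) simp
next
  case False
  then have "emeasure (sphere_borel V) UNIV \<noteq> \<infinity>"
    by (subst emeasure_sphere_borel) auto
  then show ?thesis by (intro finite_measureI) simp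
qed

lemma sigma_finite_sphere_borel: "sigma_finite_measure (sphere_borel V)"
proof -
  interpret finite_measure "sphere_borel V" by (rule finite_measure_sphere_borel)
  show ?thesis by unfold_locales
qed

end

text \<open>The radial integral left over in polar coordinates, where the surface measure is expressed by cones
  over sets of directions.\<close>

lemma nn_integral_power_tail:
  fixes a :: real and d :: nat
  assumes "a > 0" "d > 0"
  shows "(\<integral>\<^sup>+t. ennreal (1 / t ^ Suc d) * indicator {a..} t \<partial>lborel) = ennreal (1 / (d * a ^ d))"
proof -
  have "(\<integral>\<^sup>+t. ennreal (1 / t ^ Suc d) * indicator {a..} t \<partial>lborel)
      = ennreal (0 - (- 1 / (d * a ^ d)))"
  proof (rule nn_integral_FTC_atLeast)
    fix x assume "a \<le> x"
    with assms have x: "x > 0" by simp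
    have "((\<lambda>x. - 1 / (d * x ^ d)) has_real_derivative
        - (0 * (d * x ^ d) - 1 * (d * (d * x ^ (d - 1)))) / (d * x ^ d * (d * x ^ d))) (at x)"
      using x assms by (auto intro!: derivative_eq_intros)
    also have "- (0 * (d * x ^ d) - 1 * (d * (d * x ^ (d - 1)))) / (d * x ^ d * (d * x ^ d)) = 1 / x ^ Suc d"
    proof -
      obtain y where y: "x ^ (d - 1) = y" "x ^ d = x * y" "y > 0"
        using x assms(2) by (cases d) auto
      show ?thesis
        using x assms(2) y(3) unfolding power_Suc y by (simp add: field_simps)
    qed
    finally show "((\<lambda>x. - 1 / (d * x ^ d)) has_real_derivative 1 / x ^ Suc d) (at x)" .
    show "0 \<le> 1 / x ^ Suc d" using x by simp
  next
    have "((\<lambda>x::real. - (1 / d) * (inverse x) ^ d) \<longlongrightarrow> - (1 / d) * 0 ^ d) at_top"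
      by (intro tendsto_intros tendsto_inverse_0_at_top filterlim_ident)
    also have "- (1 / d) * (0::real) ^ d = 0" using assms by (simp add: zero_power)
    finally show "((\<lambda>x::real. - 1 / (d * x ^ d)) \<longlongrightarrow> 0) at_top"
      by (simp add: divide_inverse power_inverse)
  qed measurable
  then show ?thesis by simp
qed

lemma of_nat_mult_ennreal_inverse:
  "n > 0 \<Longrightarrow> of_nat n * ennreal (1 / real n) = 1"
  by (simp add: ennreal_of_nat_eq_real_of_nat flip: ennreal_mult)

text \<open>The surface measure of the unit sphere is defined by cones inside the unit ball. After the dilation
  \<open>\<rho> = t \<bar>y\<bar>\<close> and an exchange of the integrals, the dilation \<open>z = t y\<close> turns the right-hand side into
  the integral of \<open>d h(z) \<bar>z\<bar>\<^sup>d t\<^bsup>-d-1\<^esup>\<close> over all \<open>z\<close> and all \<open>t \<ge> \<bar>z\<bar>\<close>.\<close>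

lemma nn_integral_polar:
  fixes W :: "'a::euclidean_space set"
  assumes W: "subspace W" and d: "dim W > 0" and [measurable]: "h \<in> borel_measurable borel"
  shows "(\<integral>\<^sup>+x. h x \<partial>subspace_lborel W)
    = (\<integral>\<^sup>+\<theta>. \<integral>\<^sup>+\<rho>. indicator {0<..} \<rho> * ennreal (\<rho> ^ (dim W - 1)) * h (\<rho> *\<^sub>R \<theta>) \<partial>lborel \<partial>sphere_borel W)"
proof -
  let ?d = "dim W" and ?\<mu> = "subspace_lborel W"
  let ?p = "\<lambda>t::real. indicator {0<..} t * ennreal (t ^ (?d - 1))"
  let ?B = "indicator {x. x \<noteq> 0 \<and> norm x \<le> 1} :: 'a \<Rightarrow> ennreal"
  let ?m = "\<lambda>z y. ennreal (norm z ^ ?d) * h y"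
  let ?L = "\<lambda>y. \<integral>\<^sup>+\<rho>. ?p \<rho> * h (\<rho> *\<^sub>R sgn y) \<partial>lborel"
  let ?T = "\<lambda>t z. indicator {0<..} t * ennreal (1 / t ^ Suc ?d) * (indicator {t. norm z \<le> t} t * (indicator {x. x \<noteq> 0} z * ?m z z))"
  interpret W: sigma_finite_measure ?\<mu> by (rule sigma_finite_subspace_lborel[OF W])
  interpret P: pair_sigma_finite ?\<mu> "lborel :: real measure" ..
  have [measurable]: "sgn \<in> borel \<rightarrow>\<^sub>M (borel :: 'a measure)"
    by (simp add: sgn_div_norm[abs_def])
  have scale: "?L y = (\<integral>\<^sup>+t. ?p t * ?m y (t *\<^sub>R y) \<partial>lborel)"
    if y: "y \<noteq> 0" for y
  proof -
    have "?L y
      = ennreal (norm y) * (\<integral>\<^sup>+t. indicator {0<..} (norm y * t) * ennreal ((norm y * t) ^ (?d - 1)) * h ((norm y * t) *\<^sub>R sgn y) \<partial>lborel)"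
      using nn_integral_real_affine[of "\<lambda>\<rho>. ?p \<rho> * h (\<rho> *\<^sub>R sgn y)" "norm y" 0] y
      by simp
    also have "\<dots> = (\<integral>\<^sup>+t. ennreal (norm y) * (indicator {0<..} (norm y * t) * ennreal ((norm y * t) ^ (?d - 1)) * h ((norm y * t) *\<^sub>R sgn y)) \<partial>lborel)"
      by (rule nn_integral_cmult[symmetric]) measurable
    also have "\<dots> = (\<integral>\<^sup>+t. ?p t * ?m y (t *\<^sub>R y) \<partial>lborel)"
    proof (rule nn_integral_cong)
      fix t :: real
      have 1: "(norm y * t) *\<^sub>R sgn y = t *\<^sub>R y"
        using y by (simp add: sgn_div_norm)
      have 2: "norm y * (norm y * t) ^ (?d - 1) = t ^ (?d - 1) * norm y ^ ?d"
        using d by (cases ?d) (auto simp: power_mult_distrib)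
      show "ennreal (norm y) * (indicator {0<..} (norm y * t) * ennreal ((norm y * t) ^ (?d - 1)) * h ((norm y * t) *\<^sub>R sgn y))
         = ?p t * ?m y (t *\<^sub>R y)"
      proof (cases "t > 0")
        case True
        then have "ennreal (norm y) * ennreal ((norm y * t) ^ (?d - 1)) = ennreal (t ^ (?d - 1)) * ennreal (norm y ^ ?d)"
          using 2 by (simp flip: ennreal_mult)
        with True y show ?thesis unfolding 1 by (simp add: mult.assoc[symmetric])
      qed (use y in \<open>simp add: zero_less_mult_iff\<close>)
    qed
    finally show ?thesis .
  qed
  have dil: "(\<integral>\<^sup>+y. ?B y * ?m y (t *\<^sub>R y) \<partial>?\<mu>)
      = (\<integral>\<^sup>+z. ennreal (1 / t ^ (2 * ?d)) * (indicator {x. x \<noteq> 0 \<and> norm x \<le> t} z * ?m z z) \<partial>?\<mu>)"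
    if t: "t > 0" for t :: real
  proof -
    let ?g = "\<lambda>z. ennreal (1 / t ^ (2 * ?d)) * (indicator {x. x \<noteq> 0 \<and> norm x \<le> t} z * ?m z z)"
    have g: "?g \<in> borel_measurable borel" by measurable
    have "(\<integral>\<^sup>+z. ?g z \<partial>?\<mu>) = ennreal (t ^ ?d) * (\<integral>\<^sup>+y. ?g (t *\<^sub>R y) \<partial>?\<mu>)"
      by (subst nn_integral_subspace_lborel_affine[OF W, of t 0]) (use t subspace_0[OF W] g in auto)
    also have "\<dots> = (\<integral>\<^sup>+y. ennreal (t ^ ?d) * ?g (t *\<^sub>R y) \<partial>?\<mu>)"
      by (rule nn_integral_cmult[symmetric]) measurable
    also have "\<dots> = (\<integral>\<^sup>+y. ?B y * ?m y (t *\<^sub>R y) \<partial>?\<mu>)"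
    proof (rule nn_integral_cong)
      fix y :: 'a
      have ind: "indicator {x. x \<noteq> 0 \<and> norm x \<le> t} (t *\<^sub>R y) = ?B y"
        using t by (auto simp: indicator_def)
      have "ennreal (t ^ ?d) * (ennreal (1 / t ^ (2 * ?d)) * ennreal (norm (t *\<^sub>R y) ^ ?d)) = ennreal (norm y ^ ?d)"
        using t by (simp flip: ennreal_mult add: power_mult_distrib mult_2 power_add)
      note e = this
      have "ennreal (t ^ ?d) * ?g (t *\<^sub>R y)
        = ?B y * ((ennreal (t ^ ?d) * (ennreal (1 / t ^ (2 * ?d)) * ennreal (norm (t *\<^sub>R y) ^ ?d))) * h (t *\<^sub>R y))"
        unfolding ind by (simp only: mult_ac)
      then show "ennreal (t ^ ?d) * ?g (t *\<^sub>R y) = ?B y * ?m y (t *\<^sub>R y)"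
        unfolding e .
    qed
    finally show ?thesis by simp
  qed
  have "(\<integral>\<^sup>+\<theta>. \<integral>\<^sup>+\<rho>. ?p \<rho> * h (\<rho> *\<^sub>R \<theta>) \<partial>lborel \<partial>sphere_borel W)
     = of_nat ?d * (\<integral>\<^sup>+y. ?B y * ?L y \<partial>?\<mu>)"
    by (rule nn_integral_sphere_borel[OF W]) measurable
  also have "(\<integral>\<^sup>+y. ?B y * ?L y \<partial>?\<mu>)
     = (\<integral>\<^sup>+y. \<integral>\<^sup>+t. ?p t * (?B y * ?m y (t *\<^sub>R y)) \<partial>lborel \<partial>?\<mu>)"
  proof (rule nn_integral_cong)
    fix y :: 'a
    show "?B y * ?L y
       = (\<integral>\<^sup>+t. ?p t * (?B y * ?m y (t *\<^sub>R y)) \<partial>lborel)"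
      by (cases "y \<noteq> 0 \<and> norm y \<le> 1") (use scale[of y] in auto)
  qed
  also have "\<dots> = (\<integral>\<^sup>+t. \<integral>\<^sup>+y. ?p t * (?B y * ?m y (t *\<^sub>R y)) \<partial>?\<mu> \<partial>lborel)"
    by (rule P.Fubini'[symmetric]) measurable
  also have "\<dots> = (\<integral>\<^sup>+t. \<integral>\<^sup>+z. ?T t z \<partial>?\<mu> \<partial>lborel)"
  proof (rule nn_integral_cong)
    fix t :: real
    show "(\<integral>\<^sup>+y. ?p t * (?B y * ?m y (t *\<^sub>R y)) \<partial>?\<mu>)
        = (\<integral>\<^sup>+z. ?T t z \<partial>?\<mu>)"
    proof (cases "t > 0")
      case t: True
      have e: "ennreal (t ^ (?d - 1)) * ennreal (1 / t ^ (2 * ?d)) = ennreal (1 / t ^ Suc ?d)"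
        using t d by (cases ?d) (auto simp flip: ennreal_mult simp: power_add mult_2)
      have ind: "indicator {x. x \<noteq> 0 \<and> norm x \<le> t} z = (indicator {t. norm z \<le> t} t * indicator {x. x \<noteq> 0} z :: ennreal)" for z :: 'a
        by (auto simp: indicator_def)
      have "(\<integral>\<^sup>+y. ?p t * (?B y * ?m y (t *\<^sub>R y)) \<partial>?\<mu>)
        = ennreal (t ^ (?d - 1)) * (\<integral>\<^sup>+y. ?B y * ?m y (t *\<^sub>R y) \<partial>?\<mu>)"
        using t by (simp add: nn_integral_cmult)
      also have "\<dots> = (\<integral>\<^sup>+z. ennreal (t ^ (?d - 1)) * (ennreal (1 / t ^ (2 * ?d)) *
             (indicator {x. x \<noteq> 0 \<and> norm x \<le> t} z * ?m z z)) \<partial>?\<mu>)"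
        unfolding dil[OF t] by (rule nn_integral_cmult[symmetric]) measurable
      also have "\<dots> = (\<integral>\<^sup>+z. ennreal (1 / t ^ Suc ?d) *
             (indicator {x. x \<noteq> 0 \<and> norm x \<le> t} z * ?m z z) \<partial>?\<mu>)"
        by (simp only: mult.assoc[symmetric] e)
      finally show ?thesis using t by (simp add: ind mult.assoc)
    qed simp
  qed
  also have "\<dots> = (\<integral>\<^sup>+z. \<integral>\<^sup>+t. ?T t z \<partial>lborel \<partial>?\<mu>)"
    by (rule P.Fubini') measurable
  also have "\<dots> = (\<integral>\<^sup>+z. ennreal (1 / ?d) * (indicator {x. x \<noteq> 0} z * h z) \<partial>?\<mu>)"
  proof (rule nn_integral_cong)
    fix z :: 'a
    show "(\<integral>\<^sup>+t. ?T t z \<partial>lborel)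
       = ennreal (1 / ?d) * (indicator {x. x \<noteq> 0} z * h z)"
    proof (cases "z = 0")
      case False
      have "(\<integral>\<^sup>+t. ?T t z \<partial>lborel)
        = (\<integral>\<^sup>+t. (ennreal (1 / t ^ Suc ?d) * indicator {norm z..} t) * ?m z z \<partial>lborel)"
      proof (rule nn_integral_cong)
        fix t :: real
        have "0 < norm z" using False by simp
        then show "?T t z
          = (ennreal (1 / t ^ Suc ?d) * indicator {norm z..} t) * ?m z z"
          by (cases "norm z \<le> t") (simp_all add: False order.strict_trans2 del: zero_less_norm_iff)
      qed
      also have "\<dots> = ennreal (1 / (?d * norm z ^ ?d)) * ?m z z"
        using False d by (subst nn_integral_multc) (auto simp: nn_integral_power_tail simp del: power_Suc)
      also have "\<dots> = ennreal (1 / ?d) * h z"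
        using False by (simp add: mult.assoc[symmetric] flip: ennreal_mult)
      finally show ?thesis using False by simp
    qed simp
  qed
  also have "\<dots> = ennreal (1 / ?d) * (\<integral>\<^sup>+z. indicator {x. x \<noteq> 0} z * h z \<partial>?\<mu>)"
    by (rule nn_integral_cmult) measurable
  also have "of_nat ?d * \<dots> = (\<integral>\<^sup>+z. indicator {x. x \<noteq> 0} z * h z \<partial>?\<mu>)"
    by (simp only: mult.assoc[symmetric] of_nat_mult_ennreal_inverse[OF d] mult_1)
  also have "\<dots> = (\<integral>\<^sup>+z. h z \<partial>?\<mu>)"
  proof (rule nn_integral_cong_AE)
    have "AE z in ?\<mu>. z \<noteq> 0"
      using AE_not_in[OF null_sets_subspace_lborel_0[OF W d]] by simp
    then show "AE z in ?\<mu>. indicator {x. x \<noteq> 0} z * h z = h z"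
      by eventually_elim auto
  qed
  finally show ?thesis ..
qed

text \<open>A monotone bijection from an interval onto the line pushes its derivative forward to Lebesgue
  measure.\<close>

lemma nn_integral_substitution_onto_real:
  fixes g g' gi :: "real \<Rightarrow> real"
  assumes A: "is_interval A" and [measurable]: "A \<in> sets borel"
    and g [measurable]: "g \<in> borel_measurable borel" and g' [measurable]: "g' \<in> borel_measurable borel"
    and deriv: "\<And>x. x \<in> A \<Longrightarrow> (g has_real_derivative g' x) (at x)"
    and pos: "\<And>x. x \<in> A \<Longrightarrow> 0 < g' x"
    and cont: "\<And>x. x \<in> A \<Longrightarrow> isCont g' x"
    and gi: "\<And>u. gi u \<in> A" "\<And>u. g (gi u) = u"
    and [measurable]: "f \<in> borel_measurable borel"
  shows "(\<integral>\<^sup>+u. f u \<partial>lborel) = (\<integral>\<^sup>+x. indicator A x * ennreal (g' x) * f (g x) \<partial>lborel)"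
proof -
  have mono: "g x < g y" if "x \<in> A" "y \<in> A" "x < y" for x y
  proof (rule DERIV_pos_imp_increasing[OF \<open>x < y\<close>])
    fix z assume "x \<le> z" "z \<le> y"
    then have "z \<in> A" using A that by (meson mem_is_interval_1_I)
    then show "\<exists>D. (g has_real_derivative D) (at z) \<and> 0 < D" using deriv pos by blast
  qed
  let ?D = "density lborel (\<lambda>x. indicator A x * ennreal (g' x))"
  have "lborel = distr ?D borel g"
  proof (rule lborel_eqI)
    fix l u :: real assume "\<And>b. b \<in> Basis \<Longrightarrow> l \<bullet> b \<le> u \<bullet> b"
    then have lu: "l \<le> u" by simp
    have less_iff: "g x < g y \<longleftrightarrow> x < y" if "x \<in> A" "y \<in> A" for x y
      using mono[of x y] mono[of y x] that by (cases x y rule: linorder_cases) auto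
    have le: "gi l \<le> gi u"
      using less_iff[of "gi u" "gi l"] gi lu by auto
    have sub: "{gi l..gi u} \<subseteq> A"
      by (auto intro: mem_is_interval_1_I[OF A gi(1)[of l] gi(1)[of u]])
    have iff: "x \<in> A \<and> l < g x \<and> g x < u \<longleftrightarrow> gi l < x \<and> x < gi u" for x
    proof (cases "x \<in> A")
      case True
      then show ?thesis
        using less_iff[of "gi l" x] less_iff[of x "gi u"] gi by auto
    next
      case False
      then have "\<not> (gi l < x \<and> x < gi u)" using subsetD[OF sub, of x] by auto
      with False show ?thesis by blast
    qed
    have "emeasure (distr ?D borel g) (box l u) = emeasure ?D {x. l < g x \<and> g x < u}"
      by (subst emeasure_distr) (auto simp: box_real vimage_def)
    also have "\<dots> = (\<integral>\<^sup>+x. indicator A x * ennreal (g' x) * indicator {x. l < g x \<and> g x < u} x \<partial>lborel)"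
      by (subst emeasure_density) auto
    also have "\<dots> = (\<integral>\<^sup>+x. ennreal (g' x) * indicator {gi l..gi u} x \<partial>lborel)"
    proof (rule nn_integral_cong_AE)
      have "AE x in lborel. x \<noteq> gi l" "AE x in lborel. x \<noteq> gi u"
        by (rule AE_lborel_singleton)+
      then show "AE x in lborel. indicator A x * ennreal (g' x) * indicator {x. l < g x \<and> g x < u} x
          = ennreal (g' x) * indicator {gi l..gi u} x"
      proof eventually_elim
        case (elim x)
        then have "x \<in> {gi l..gi u} \<longleftrightarrow> x \<in> A \<and> l < g x \<and> g x < u"
          unfolding iff by auto
        then show ?case by (auto simp: indicator_def)
      qed
    qed
    also have "\<dots> = ennreal (g (gi u) - g (gi l))"
      by (rule nn_integral_FTC_Icc) (use subsetD[OF sub] deriv less_imp_le[OF pos] le in auto)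
    also have "\<dots> = (\<Prod>b\<in>Basis. (u - l) \<bullet> b)"
      using lu by (simp add: gi)
    finally show "emeasure (distr ?D borel g) (box l u) = (\<Prod>b\<in>Basis. (u - l) \<bullet> b)" .
  qed simp
  then have "(\<integral>\<^sup>+u. f u \<partial>lborel) = (\<integral>\<^sup>+u. f u \<partial>distr ?D borel g)" by simp
  also have "\<dots> = (\<integral>\<^sup>+x. indicator A x * ennreal (g' x) * f (g x) \<partial>lborel)"
    by (simp add: nn_integral_distr nn_integral_density)
  finally show ?thesis .
qed

text \<open>From here on a subspace \<open>V\<close> is split into a hyperplane \<open>W\<close> and a unit normal \<open>p\<close>.\<close>

locale hyperplane_split =
  fixes W :: "'a::euclidean_space set" and p :: 'a and V :: "'a set"
  assumes W: "subspace W" and dim_W: "dim W > 0"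
    and p: "norm p = 1" and orth: "\<And>x. x \<in> W \<Longrightarrow> x \<bullet> p = 0"
    and V_eq: "V = span (insert p W)"
begin

lemma subspace_V: "subspace V"
  by (simp add: V_eq)

lemma dim_V: "dim V = Suc (dim W)"
  unfolding V_eq by (rule nn_integral_subspace_lborel_insert(2)[OF W p orth, of "\<lambda>_. 0"]) auto

lemma norm_comb:
  assumes "\<theta> \<in> W"
  shows "norm (a *\<^sub>R p + b *\<^sub>R \<theta>) = sqrt (a\<^sup>2 + b\<^sup>2 * (norm \<theta>)\<^sup>2)"
proof -
  have "(norm (a *\<^sub>R p + b *\<^sub>R \<theta>))\<^sup>2 = a\<^sup>2 + b\<^sup>2 * (norm \<theta>)\<^sup>2"
    using orth[OF assms] p
    by (simp add: norm_add_Pythagorean orthogonal_def inner_commute power_mult_distrib)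
  then show ?thesis by (metis norm_ge_zero real_sqrt_unique)
qed

text \<open>Central projection: the ray through \<open>s p + \<theta>\<close>, where \<open>\<theta>\<close> is a unit vector of \<open>W\<close>. It needs only
  polar coordinates in \<open>W\<close> and dilations of the line, and the stereographic and the latitude coordinates
  follow from it by substitutions in the single variable \<open>s\<close>.\<close>

lemma nn_integral_sphere_gnomonic:
  assumes [measurable]: "G \<in> borel_measurable borel"
  shows "(\<integral>\<^sup>+x. G x \<partial>sphere_borel V)
    = (\<integral>\<^sup>+s. \<integral>\<^sup>+\<theta>. ennreal ((1 / sqrt (1 + s\<^sup>2)) ^ Suc (dim W)) *
        G ((s / sqrt (1 + s\<^sup>2)) *\<^sub>R p + (1 / sqrt (1 + s\<^sup>2)) *\<^sub>R \<theta>) \<partial>sphere_borel W \<partial>lborel)"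
proof -
  let ?d = "dim W" and ?\<mu> = "subspace_lborel W" and ?\<sigma> = "sphere_borel W"
  let ?q = "\<lambda>s::real. 1 / sqrt (1 + s\<^sup>2)"
  let ?k = "\<lambda>\<rho> s. indicator {\<rho>. 0 < \<rho> \<and> \<rho> \<le> ?q s} \<rho> :: ennreal" and ?k' = "\<lambda>\<rho> s. ennreal (\<rho> ^ ?d) * indicator {0..?q s} \<rho>"
  interpret S: sigma_finite_measure ?\<sigma> by (rule sigma_finite_sphere_borel[OF W])
  interpret P: pair_sigma_finite ?\<sigma> "lborel :: real measure" ..
  have q: "?q s > 0" for s by (simp add: add_pos_nonneg)
  have [measurable]: "sgn \<in> borel \<rightarrow>\<^sub>M (borel :: 'a measure)"
    by (simp add: sgn_div_norm[abs_def])
  define F where "F x = indicator {x. x \<noteq> 0 \<and> norm x \<le> 1} x * G (sgn x)" for x :: 'a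
  have [measurable]: "F \<in> borel_measurable borel" unfolding F_def by measurable
  define g where "g s \<theta> = G ((s * ?q s) *\<^sub>R p + ?q s *\<^sub>R \<theta>)" for s \<theta>
  have [measurable]: "(\<lambda>x. g (f x) (h x)) \<in> borel_measurable M"
    if [measurable]: "f \<in> borel_measurable M" "h \<in> borel_measurable M" for f h and M :: "'z measure"
    unfolding g_def by measurable
  have F: "F ((\<rho> * s) *\<^sub>R p + \<rho> *\<^sub>R \<theta>) = indicator {..?q s} \<rho> * g s \<theta>"
    if "\<rho> > 0" "\<theta> \<in> W" "norm \<theta> = 1" for \<rho> s \<theta>
  proof -
    let ?x = "(\<rho> * s) *\<^sub>R p + \<rho> *\<^sub>R \<theta>"
    have "norm ?x = sqrt ((\<rho> * s)\<^sup>2 + \<rho>\<^sup>2 * (norm \<theta>)\<^sup>2)"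
      by (rule norm_comb[OF that(2)])
    also have "\<dots> = sqrt (\<rho>\<^sup>2 * (1 + s\<^sup>2))"
      using that(3) by (simp add: algebra_simps power_mult_distrib)
    also have "\<dots> = \<rho> / ?q s"
      using that(1) by (simp add: real_sqrt_mult)
    finally have n: "norm ?x = \<rho> / ?q s" .
    have "norm ?x > 0" unfolding n using q that(1) by (intro divide_pos_pos) auto
    then have "?x \<noteq> 0" by auto
    moreover have "norm ?x \<le> 1 \<longleftrightarrow> \<rho> \<le> ?q s"
      unfolding n using q[of s] by (simp add: pos_le_divide_eq)
    moreover have "sgn ?x = (s * ?q s) *\<^sub>R p + ?q s *\<^sub>R \<theta>"
    proof -
      have "inverse (\<rho> / ?q s) * (\<rho> * s) = s * ?q s" "inverse (\<rho> / ?q s) * \<rho> = ?q s"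
        using that(1) q[of s] by (simp_all add: field_simps)
      then show ?thesis
        unfolding sgn_div_norm n scaleR_right_distrib scaleR_scaleR by simp
    qed
    ultimately show ?thesis by (simp add: F_def g_def indicator_def)
  qed
  let ?R = "\<lambda>\<rho> \<theta>. indicator {0<..} \<rho> * ennreal (\<rho> ^ (?d - 1)) * (\<integral>\<^sup>+a. F (a *\<^sub>R p + \<rho> *\<^sub>R \<theta>) \<partial>lborel)"
  have "(\<integral>\<^sup>+x. G x \<partial>sphere_borel V) = of_nat (Suc ?d) * (\<integral>\<^sup>+x. F x \<partial>subspace_lborel V)"
    unfolding F_def by (subst nn_integral_sphere_borel[OF subspace_V]) (auto simp: dim_V)
  also have "(\<integral>\<^sup>+x. F x \<partial>subspace_lborel V) = (\<integral>\<^sup>+y. \<integral>\<^sup>+a. F (a *\<^sub>R p + y) \<partial>lborel \<partial>?\<mu>)"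
    unfolding V_eq by (rule nn_integral_subspace_lborel_insert[OF W p orth]) auto
  also have "\<dots> = (\<integral>\<^sup>+\<theta>. \<integral>\<^sup>+\<rho>. ?R \<rho> \<theta> \<partial>lborel \<partial>?\<sigma>)"
    by (rule nn_integral_polar[OF W dim_W]) measurable
  also have "\<dots> = (\<integral>\<^sup>+\<theta>. \<integral>\<^sup>+s. \<integral>\<^sup>+\<rho>. ?k' \<rho> s * g s \<theta> \<partial>lborel \<partial>lborel \<partial>?\<sigma>)"
  proof (rule nn_integral_sphere_borel_cong[OF W])
    fix \<theta> assume \<theta>: "\<theta> \<in> W" "norm \<theta> = 1"
    have "(\<integral>\<^sup>+\<rho>. ?R \<rho> \<theta> \<partial>lborel)
        = (\<integral>\<^sup>+\<rho>. \<integral>\<^sup>+s. (ennreal (\<rho> ^ ?d) * ?k \<rho> s) * g s \<theta> \<partial>lborel \<partial>lborel)"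
    proof (rule nn_integral_cong)
      fix \<rho> :: real
      show "?R \<rho> \<theta>
         = (\<integral>\<^sup>+s. (ennreal (\<rho> ^ ?d) * ?k \<rho> s) * g s \<theta> \<partial>lborel)"
      proof (cases "\<rho> > 0")
        case \<rho>: True
        have "(\<integral>\<^sup>+a. F (a *\<^sub>R p + \<rho> *\<^sub>R \<theta>) \<partial>lborel)
           = ennreal \<rho> * (\<integral>\<^sup>+s. F ((\<rho> * s) *\<^sub>R p + \<rho> *\<^sub>R \<theta>) \<partial>lborel)"
          using nn_integral_real_affine[of "\<lambda>a. F (a *\<^sub>R p + \<rho> *\<^sub>R \<theta>)" \<rho> 0] \<rho> by simp
        also have "\<dots> = ennreal \<rho> * (\<integral>\<^sup>+s. ?k \<rho> s * g s \<theta> \<partial>lborel)"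
          using \<rho> \<theta> by (simp add: F indicator_def)
        finally have "?R \<rho> \<theta>
            = (ennreal (\<rho> ^ (?d - 1)) * ennreal \<rho>) * (\<integral>\<^sup>+s. ?k \<rho> s * g s \<theta> \<partial>lborel)"
          using \<rho> by (simp add: mult.assoc)
        also have "ennreal (\<rho> ^ (?d - 1)) * ennreal \<rho> = ennreal (\<rho> ^ ?d)"
          using \<rho> dim_W by (cases ?d) (auto simp flip: ennreal_mult simp: mult.commute)
        finally show ?thesis
          by (simp add: nn_integral_cmult[symmetric] mult.assoc)
      qed simp
    qed
    also have "\<dots> = (\<integral>\<^sup>+s. \<integral>\<^sup>+\<rho>. (ennreal (\<rho> ^ ?d) * ?k \<rho> s) * g s \<theta> \<partial>lborel \<partial>lborel)"
      by (rule lborel_pair.Fubini') measurable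
    also have "\<dots> = (\<integral>\<^sup>+s. \<integral>\<^sup>+\<rho>. ?k' \<rho> s * g s \<theta> \<partial>lborel \<partial>lborel)"
    proof (rule nn_integral_cong, rule nn_integral_cong_AE)
      fix s :: real
      show "AE \<rho> in lborel. (ennreal (\<rho> ^ ?d) * ?k \<rho> s) * g s \<theta>
          = ?k' \<rho> s * g s \<theta>"
        using AE_lborel_singleton[of 0] by eventually_elim (auto simp: indicator_def)
    qed
    finally show "(\<integral>\<^sup>+\<rho>. ?R \<rho> \<theta> \<partial>lborel)
        = (\<integral>\<^sup>+s. \<integral>\<^sup>+\<rho>. ?k' \<rho> s * g s \<theta> \<partial>lborel \<partial>lborel)" .
  qed
  also have "\<dots> = (\<integral>\<^sup>+\<theta>. \<integral>\<^sup>+s. ennreal (?q s ^ Suc ?d / Suc ?d) * g s \<theta> \<partial>lborel \<partial>?\<sigma>)"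
  proof (intro nn_integral_cong)
    fix \<theta> s
    have "(\<integral>\<^sup>+\<rho>. ennreal (\<rho> ^ ?d) * indicator {0..?q s} \<rho> \<partial>lborel) = ennreal (?q s ^ Suc ?d / Suc ?d - 0 ^ Suc ?d / Suc ?d)"
    proof (rule nn_integral_FTC_Icc)
      fix x :: real
      show "((\<lambda>x. x ^ Suc ?d / Suc ?d) has_real_derivative x ^ ?d) (at x)"
        using DERIV_cdivide[OF DERIV_pow[of "Suc ?d" x], of "real (Suc ?d)"]
        by (simp del: of_nat_Suc power_Suc)
    qed (use q[of s] in auto)
    then show "(\<integral>\<^sup>+\<rho>. ?k' \<rho> s * g s \<theta> \<partial>lborel)
        = ennreal (?q s ^ Suc ?d / Suc ?d) * g s \<theta>"
      by (subst nn_integral_multc) auto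
  qed
  also have "\<dots> = (\<integral>\<^sup>+s. \<integral>\<^sup>+\<theta>. ennreal (?q s ^ Suc ?d / Suc ?d) * g s \<theta> \<partial>?\<sigma> \<partial>lborel)"
    by (rule P.Fubini'[symmetric]) measurable
  also have "\<dots> = (\<integral>\<^sup>+s. ennreal (1 / Suc ?d) * (\<integral>\<^sup>+\<theta>. ennreal (?q s ^ Suc ?d) * g s \<theta> \<partial>?\<sigma>) \<partial>lborel)"
  proof (rule nn_integral_cong)
    fix s
    have "ennreal (?q s ^ Suc ?d / Suc ?d) = ennreal (1 / Suc ?d) * ennreal (?q s ^ Suc ?d)"
      using q[of s] by (simp flip: ennreal_mult)
    then show "(\<integral>\<^sup>+\<theta>. ennreal (?q s ^ Suc ?d / Suc ?d) * g s \<theta> \<partial>?\<sigma>)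
       = ennreal (1 / Suc ?d) * (\<integral>\<^sup>+\<theta>. ennreal (?q s ^ Suc ?d) * g s \<theta> \<partial>?\<sigma>)"
      by (simp only: mult.assoc) (rule nn_integral_cmult, measurable)
  qed
  also have "\<dots> = ennreal (1 / Suc ?d) * (\<integral>\<^sup>+s. \<integral>\<^sup>+\<theta>. ennreal (?q s ^ Suc ?d) * g s \<theta> \<partial>?\<sigma> \<partial>lborel)"
    by (rule nn_integral_cmult) measurable
  also have "of_nat (Suc ?d) * \<dots> = (\<integral>\<^sup>+s. \<integral>\<^sup>+\<theta>. ennreal (?q s ^ Suc ?d) * g s \<theta> \<partial>?\<sigma> \<partial>lborel)"
    by (simp only: mult.assoc[symmetric] of_nat_mult_ennreal_inverse[OF zero_less_Suc] mult_1)
  finally show ?thesis by (simp add: g_def)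
qed

text \<open>The point over \<open>z = \<rho> \<theta>\<close> lies on the ray through \<open>s p + \<theta>\<close> with \<open>s = (\<rho> - 1/\<rho>) / 2\<close>. This
  substitution satisfies \<open>sqrt (1 + s\<^sup>2) = (\<rho> + 1/\<rho>) / 2\<close>, so all square roots disappear.\<close>

lemma nn_integral_sphere_stereographic:
  assumes [measurable]: "G \<in> borel_measurable borel"
  shows "(\<integral>\<^sup>+x. G x \<partial>sphere_borel V)
    = (\<integral>\<^sup>+z. ennreal ((2 / (1 + (norm z)\<^sup>2)) ^ dim W) * G (p + (2 / (1 + (norm z)\<^sup>2)) *\<^sub>R (z - p)) \<partial>subspace_lborel W)"
proof -
  let ?d = "dim W" and ?\<sigma> = "sphere_borel W"
  let ?h = "\<lambda>z. ennreal ((2 / (1 + (norm z)\<^sup>2)) ^ ?d) * G (p + (2 / (1 + (norm z)\<^sup>2)) *\<^sub>R (z - p))"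
  interpret S: sigma_finite_measure ?\<sigma> by (rule sigma_finite_sphere_borel[OF W])
  interpret P: pair_sigma_finite ?\<sigma> "lborel :: real measure" ..
  define H where "H s \<theta> = ennreal ((1 / sqrt (1 + s\<^sup>2)) ^ Suc ?d) *
        G ((s / sqrt (1 + s\<^sup>2)) *\<^sub>R p + (1 / sqrt (1 + s\<^sup>2)) *\<^sub>R \<theta>)" for s \<theta>
  have [measurable]: "(\<lambda>x. H (f x) (h x)) \<in> borel_measurable M"
    if [measurable]: "f \<in> borel_measurable M" "h \<in> borel_measurable M" for f h and M :: "'z measure"
    unfolding H_def by measurable
  let ?g = "\<lambda>\<rho>::real. (\<rho> - 1 / \<rho>) / 2" and ?g' = "\<lambda>\<rho>::real. (1 + 1 / \<rho>\<^sup>2) / 2"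
  let ?s = "\<lambda>\<rho>. sqrt (1 + (?g \<rho>)\<^sup>2)" and ?j = "\<lambda>\<rho> \<theta>. indicator {0<..} \<rho> * ennreal (?g' \<rho>) * H (?g \<rho>) \<theta>"
  have HG: "ennreal (?g' \<rho>) * H (?g \<rho>) \<theta>
     = ennreal (\<rho> ^ (?d - 1)) * ?h (\<rho> *\<^sub>R \<theta>)"
    if "\<rho> > 0" "norm \<theta> = 1" for \<rho> \<theta>
  proof -
    have n: "norm (\<rho> *\<^sub>R \<theta>) = \<rho>" using that by simp
    have pos: "0 < 1 + \<rho>\<^sup>2" by (simp add: add_pos_nonneg)
    have "1 + (?g \<rho>)\<^sup>2 = ((1 + \<rho>\<^sup>2) / (2 * \<rho>))\<^sup>2"
      using that by (simp add: field_simps power2_eq_square)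
    then have sq: "?s \<rho> = (1 + \<rho>\<^sup>2) / (2 * \<rho>)"
      using that pos by (simp add: real_sqrt_unique)
    have q: "1 / ?s \<rho> = 2 / (1 + \<rho>\<^sup>2) * \<rho>"
      unfolding sq using that pos by simp
    have "?g \<rho> / ?s \<rho> = 1 - 2 / (1 + \<rho>\<^sup>2)"
    proof -
      have cancel: "(a / u) / (b / u) = a / b" if "u \<noteq> 0" for a b u :: real
        using that by simp
      have "?g \<rho> = (\<rho>\<^sup>2 - 1) / (2 * \<rho>)"
        using that by (simp add: field_simps power2_eq_square)
      then have "?g \<rho> / ?s \<rho> = (\<rho>\<^sup>2 - 1) / (1 + \<rho>\<^sup>2)"
        unfolding sq using cancel[of "2 * \<rho>"] that by (simp only:)
      then show ?thesis using pos by (simp add: field_simps)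
    qed
    note cos = this
    have arg: "(?g \<rho> / ?s \<rho>) *\<^sub>R p + (1 / ?s \<rho>) *\<^sub>R \<theta>
        = p + (2 / (1 + \<rho>\<^sup>2)) *\<^sub>R (\<rho> *\<^sub>R \<theta> - p)"
      unfolding q cos by (simp only: scaleR_diff_left scaleR_diff_right scaleR_scaleR scaleR_one) simp
    obtain m where m: "?d = Suc m" using dim_W by (cases ?d) auto
    have g': "?g' \<rho> = (1 + \<rho>\<^sup>2) / (2 * \<rho>\<^sup>2)" using that by (simp add: field_simps)
    have "?g' \<rho> * (2 / (1 + \<rho>\<^sup>2) * \<rho>) ^ Suc ?d = (2 / (1 + \<rho>\<^sup>2)) ^ ?d * \<rho> ^ m * (?g' \<rho> * (2 / (1 + \<rho>\<^sup>2)) * \<rho>\<^sup>2)"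
      unfolding m by (simp only: power_mult_distrib power_Suc power2_eq_square mult_ac)
    also have "?g' \<rho> * (2 / (1 + \<rho>\<^sup>2)) * \<rho>\<^sup>2 = 1"
      unfolding g' using that pos by simp
    finally have w: "?g' \<rho> * (2 / (1 + \<rho>\<^sup>2) * \<rho>) ^ Suc ?d = \<rho> ^ (?d - 1) * (2 / (1 + \<rho>\<^sup>2)) ^ ?d"
      by (simp add: m)
    have "ennreal (?g' \<rho>) * ennreal ((2 / (1 + \<rho>\<^sup>2) * \<rho>) ^ Suc ?d)
        = ennreal (\<rho> ^ (?d - 1)) * ennreal ((2 / (1 + \<rho>\<^sup>2)) ^ ?d)"
      using that pos by (subst (1 2) ennreal_mult[symmetric]) (auto simp only: w intro!: zero_le_power divide_nonneg_nonneg mult_nonneg_nonneg, auto)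
    then show ?thesis
      unfolding H_def arg n unfolding q by (simp only: mult.assoc[symmetric])
  qed
  have "(\<integral>\<^sup>+x. G x \<partial>sphere_borel V) = (\<integral>\<^sup>+s. \<integral>\<^sup>+\<theta>. H s \<theta> \<partial>?\<sigma> \<partial>lborel)"
    unfolding H_def by (rule nn_integral_sphere_gnomonic) measurable
  also have "\<dots> = (\<integral>\<^sup>+\<rho>. indicator {0<..} \<rho> * ennreal (?g' \<rho>) * (\<integral>\<^sup>+\<theta>. H (?g \<rho>) \<theta> \<partial>?\<sigma>) \<partial>lborel)"
  proof (rule nn_integral_substitution_onto_real[where gi = "\<lambda>u. u + sqrt (1 + u\<^sup>2)"])
    fix u :: real
    have "\<bar>u\<bar> < sqrt (1 + u\<^sup>2)" by (rule real_less_rsqrt) simp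
    then have pos: "0 < u + sqrt (1 + u\<^sup>2)" by linarith
    then show "u + sqrt (1 + u\<^sup>2) \<in> {0<..}" by simp
    have "(u + sqrt (1 + u\<^sup>2)) * (sqrt (1 + u\<^sup>2) - u) = 1"
      by (simp add: algebra_simps flip: power2_eq_square)
    then have "1 / (u + sqrt (1 + u\<^sup>2)) = sqrt (1 + u\<^sup>2) - u"
      using pos by (simp add: divide_eq_eq mult.commute)
    then show "?g (u + sqrt (1 + u\<^sup>2)) = u" by simp
  next
    fix x :: real assume "x \<in> {0<..}"
    then have x: "x > 0" by simp
    have "(?g has_real_derivative ((1 - (0 * x - 1 * 1) / (x * x)) / 2)) (at x)"
      using x by (auto intro!: derivative_eq_intros)
    then show "(?g has_real_derivative ?g' x) (at x)" by (simp add: power2_eq_square)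
    show "0 < ?g' x" by (simp add: add_pos_nonneg)
    show "isCont ?g' x" using x by (intro continuous_intros) auto
  qed (auto simp: is_interval_1)
  also have "\<dots> = (\<integral>\<^sup>+\<rho>. \<integral>\<^sup>+\<theta>. ?j \<rho> \<theta> \<partial>?\<sigma> \<partial>lborel)"
    by (intro nn_integral_cong nn_integral_cmult[symmetric]) measurable
  also have "\<dots> = (\<integral>\<^sup>+\<theta>. \<integral>\<^sup>+\<rho>. ?j \<rho> \<theta> \<partial>lborel \<partial>?\<sigma>)"
    by (rule P.Fubini') measurable
  also have "\<dots> = (\<integral>\<^sup>+\<theta>. \<integral>\<^sup>+\<rho>. indicator {0<..} \<rho> * ennreal (\<rho> ^ (?d - 1)) *
      ?h (\<rho> *\<^sub>R \<theta>) \<partial>lborel \<partial>?\<sigma>)"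
  proof (intro nn_integral_sphere_borel_cong[OF W] nn_integral_cong)
    fix \<theta> \<rho> assume "\<theta> \<in> W" and \<theta>: "norm \<theta> = 1"
    show "?j \<rho> \<theta> = indicator {0<..} \<rho> * ennreal (\<rho> ^ (?d - 1)) *
      ?h (\<rho> *\<^sub>R \<theta>)"
      using HG[OF _ \<theta>, of \<rho>] by (cases "\<rho> > 0") (simp_all only: mult.assoc, simp_all)
  qed
  also have "\<dots> = (\<integral>\<^sup>+z. ennreal ((2 / (1 + (norm z)\<^sup>2)) ^ ?d) * G (p + (2 / (1 + (norm z)\<^sup>2)) *\<^sub>R (z - p)) \<partial>subspace_lborel W)"
    by (rule nn_integral_polar[OF W dim_W, symmetric]) measurable
  finally show ?thesis .
qed

text \<open>The substitution \<open>s = a / sqrt (1 - a\<^sup>2)\<close> in the central projection.\<close>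

lemma nn_integral_sphere_latitude:
  assumes [measurable]: "G \<in> borel_measurable borel"
  shows "(\<integral>\<^sup>+x. G x \<partial>sphere_borel V)
    = (\<integral>\<^sup>+a. indicator {-1<..<1} a * ennreal ((1 - a\<^sup>2) powr ((real (dim W) - 2) / 2)) *
        (\<integral>\<^sup>+\<theta>. G (a *\<^sub>R p + sqrt (1 - a\<^sup>2) *\<^sub>R \<theta>) \<partial>sphere_borel W) \<partial>lborel)"
proof -
  let ?d = "dim W" and ?\<sigma> = "sphere_borel W"
  let ?w = "\<lambda>a::real. ennreal ((1 - a\<^sup>2) powr ((real ?d - 2) / 2))"
  interpret S: sigma_finite_measure ?\<sigma> by (rule sigma_finite_sphere_borel[OF W])
  interpret P: pair_sigma_finite ?\<sigma> "lborel :: real measure" ..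
  define K where "K a b = (\<integral>\<^sup>+\<theta>. G (a *\<^sub>R p + b *\<^sub>R \<theta>) \<partial>?\<sigma>)" for a b
  have [measurable]: "(\<lambda>x. K (f x) (h x)) \<in> borel_measurable M"
    if [measurable]: "f \<in> borel_measurable M" "h \<in> borel_measurable M" for f h and M :: "'z measure"
    unfolding K_def by measurable
  let ?g = "\<lambda>a::real. a / sqrt (1 - a\<^sup>2)" and ?g' = "\<lambda>a::real. 1 / sqrt (1 - a\<^sup>2) ^ 3"
  have "(\<integral>\<^sup>+x. G x \<partial>sphere_borel V)
     = (\<integral>\<^sup>+s. ennreal ((1 / sqrt (1 + s\<^sup>2)) ^ Suc ?d) * K (s / sqrt (1 + s\<^sup>2)) (1 / sqrt (1 + s\<^sup>2)) \<partial>lborel)"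
    unfolding nn_integral_sphere_gnomonic[OF assms] K_def
    by (intro nn_integral_cong nn_integral_cmult) measurable
  also have "\<dots> = (\<integral>\<^sup>+a. indicator {-1<..<1} a * ennreal (?g' a) *
      (ennreal ((1 / sqrt (1 + (?g a)\<^sup>2)) ^ Suc ?d) * K (?g a / sqrt (1 + (?g a)\<^sup>2)) (1 / sqrt (1 + (?g a)\<^sup>2))) \<partial>lborel)"
  proof (rule nn_integral_substitution_onto_real[where gi = "\<lambda>u. u / sqrt (1 + u\<^sup>2)"])
    fix u :: real
    have pos: "0 < 1 + u\<^sup>2" by (simp add: add_pos_nonneg)
    have "\<bar>u\<bar> < sqrt (1 + u\<^sup>2)" by (rule real_less_rsqrt) simp
    then show "u / sqrt (1 + u\<^sup>2) \<in> {-1<..<1}"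
      using pos by (auto simp: field_simps abs_less_iff)
    have "1 - (u / sqrt (1 + u\<^sup>2))\<^sup>2 = (1 / sqrt (1 + u\<^sup>2))\<^sup>2"
      using pos by (simp add: power_divide field_simps)
    then have "sqrt (1 - (u / sqrt (1 + u\<^sup>2))\<^sup>2) = 1 / sqrt (1 + u\<^sup>2)"
      using pos by (simp add: real_sqrt_unique)
    then show "?g (u / sqrt (1 + u\<^sup>2)) = u"
      using pos by simp
  next
    fix x :: real assume "x \<in> {-1<..<1}"
    then have "\<bar>x\<bar> < 1" by auto
    then have x: "0 < 1 - x\<^sup>2" by (simp add: abs_square_less_1)
    let ?r = "sqrt (1 - x\<^sup>2)"
    have r: "?r > 0" "?r\<^sup>2 = 1 - x\<^sup>2" using x by simp_all
    have "(?g has_real_derivative (1 * ?r - x * ((0 - 2 * x) * (inverse ?r / 2))) / (?r * ?r)) (at x)"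
      using x r by (auto intro!: derivative_eq_intros)
    also have "(1 * ?r - x * ((0 - 2 * x) * (inverse ?r / 2))) / (?r * ?r) = (?r\<^sup>2 + x\<^sup>2) / ?r ^ 3"
      using r(1) by (simp add: field_simps power2_eq_square power3_eq_cube)
    also have "\<dots> = ?g' x" using r by simp
    finally show "(?g has_real_derivative ?g' x) (at x)" .
    show "0 < ?g' x" using r by simp
    show "isCont ?g' x" using r by (intro continuous_intros) auto
  qed (auto simp: is_interval_1)
  also have "\<dots> = (\<integral>\<^sup>+a. indicator {-1<..<1} a * ?w a * K a (sqrt (1 - a\<^sup>2)) \<partial>lborel)"
  proof (rule nn_integral_cong)
    fix a :: real
    show "indicator {-1<..<1} a * ennreal (?g' a) *
      (ennreal ((1 / sqrt (1 + (?g a)\<^sup>2)) ^ Suc ?d) * K (?g a / sqrt (1 + (?g a)\<^sup>2)) (1 / sqrt (1 + (?g a)\<^sup>2)))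
      = indicator {-1<..<1} a * ?w a * K a (sqrt (1 - a\<^sup>2))"
    proof (cases "a \<in> {-1<..<1}")
      case True
      then have "\<bar>a\<bar> < 1" by auto
      then have x: "0 < 1 - a\<^sup>2" by (simp add: abs_square_less_1)
      let ?r = "sqrt (1 - a\<^sup>2)"
      have r: "?r > 0" "?r\<^sup>2 = 1 - a\<^sup>2" using x by simp_all
      have "1 + (?g a)\<^sup>2 = (1 / ?r)\<^sup>2"
        using r x by (simp add: power_divide field_simps)
      then have sq: "sqrt (1 + (?g a)\<^sup>2) = 1 / ?r"
        using r by (simp add: real_sqrt_unique)
      have "(1 - a\<^sup>2) powr ((real ?d - 2) / 2) = ?r powr (real ?d - 2)"
        using x by (simp add: powr_half_sqrt[symmetric] powr_powr)
      also have "\<dots> = ?r powr (real (Suc ?d) - real 3)" by simp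
      also have "\<dots> = ?r ^ Suc ?d / ?r ^ 3"
        unfolding powr_diff using r by (simp add: powr_realpow del: of_nat_Suc)
      finally have w: "(1 - a\<^sup>2) powr ((real ?d - 2) / 2) = ?g' a * ?r ^ Suc ?d" by simp
      have "ennreal (?g' a) * ennreal (?r ^ Suc ?d) = ?w a"
        unfolding w using r by (subst ennreal_mult) auto
      then show ?thesis
        unfolding sq using True r by (simp add: mult.assoc[symmetric])
    qed simp
  qed
  finally show ?thesis by (simp add: K_def)
qed

end

section \<open>Stereographic coordinates on the sphere and on its plane sections\<close>

text \<open>The inversion with centre \<open>north_pole\<close> and squared radius 2, restricted to \<open>\<real>\<^sup>n\<close>.\<close>

definition stereo :: "'a::euclidean_space \<Rightarrow> 'a \<times> real" where
  "stereo x = north_pole + (2 / (1 + (norm x)\<^sup>2)) *\<^sub>R ((x, 0) - north_pole)"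

lemma norm_north_pole [simp]: "norm (north_pole :: 'a::euclidean_space \<times> real) = 1"
  by (simp add: north_pole_def)

lemma inner_north_pole [simp]: "z \<bullet> north_pole = snd z" "north_pole \<bullet> z = snd z"
  for z :: "'a::euclidean_space \<times> real"
  by (simp_all add: north_pole_def inner_prod_def)

lemma measurable_snd_borel:
  "snd \<in> (borel :: ('a::euclidean_space \<times> real) measure) \<rightarrow>\<^sub>M borel"
  by (intro borel_measurable_continuous_onI continuous_intros)

lemma measurable_stereo [measurable]: "stereo \<in> borel \<rightarrow>\<^sub>M (borel :: ('a::euclidean_space \<times> real) measure)"
proof (rule borel_measurable_continuous_onI)
  have "1 + (norm x)\<^sup>2 \<noteq> 0" for x :: 'a
    by (metis add_pos_nonneg less_irrefl zero_le_power2 zero_less_one)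
  then show "continuous_on UNIV (stereo :: 'a \<Rightarrow> 'a \<times> real)"
    unfolding stereo_def[abs_def] by (intro continuous_intros) auto
qed

lemma snd_stereo: "snd (stereo x) = 1 - 2 / (1 + (norm x)\<^sup>2)"
  by (simp add: stereo_def north_pole_def)

lemma hyperplane_split_UNIV:
  "hyperplane_split (UNIV \<times> {0}) north_pole (UNIV :: ('a::euclidean_space \<times> real) set)"
  and dim_UNIV_Times_0: "dim ((UNIV :: 'a set) \<times> {0::real}) = DIM('a)"
proof -
  let ?W = "(UNIV :: 'a set) \<times> {0::real}"
  show dim: "dim ?W = DIM('a)"
    using nn_integral_subspace_lborel_Times_0(2)[of "UNIV :: 'a set" "\<lambda>_. 0"] by simp
  have sub: "subspace ?W"
    by (auto simp: subspace_def zero_prod_def)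
  have span: "span (insert (north_pole :: 'a \<times> real) ?W) = UNIV"
  proof -
    have "x - snd x *\<^sub>R north_pole \<in> ?W" for x :: "'a \<times> real"
      by (cases x) (simp add: north_pole_def)
    then show ?thesis
      unfolding span_insert span_eq_iff[THEN iffD2, OF sub] by blast
  qed
  show "hyperplane_split ?W north_pole UNIV"
    by unfold_locales (simp_all add: sub dim span, auto simp: north_pole_def)
qed

lemma nn_integral_sphere_stereo:
  fixes g :: "'a::euclidean_space \<times> real \<Rightarrow> ennreal"
  assumes [measurable]: "g \<in> borel_measurable borel"
  shows "(\<integral>\<^sup>+\<eta>. g \<eta> \<partial>sphere_borel UNIV)
    = (\<integral>\<^sup>+x. ennreal ((2 / (1 + (norm x)\<^sup>2)) ^ DIM('a)) * g (stereo x) \<partial>lborel)"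
proof -
  let ?W = "(UNIV :: 'a set) \<times> {0::real}"
  interpret hyperplane_split ?W north_pole UNIV by (rule hyperplane_split_UNIV)
  have "(\<integral>\<^sup>+\<eta>. g \<eta> \<partial>sphere_borel UNIV)
    = (\<integral>\<^sup>+z. ennreal ((2 / (1 + (norm z)\<^sup>2)) ^ dim ?W) * g (north_pole + (2 / (1 + (norm z)\<^sup>2)) *\<^sub>R (z - north_pole)) \<partial>subspace_lborel ?W)"
    by (rule nn_integral_sphere_stereographic) measurable
  also have "\<dots> = (\<integral>\<^sup>+x. ennreal ((2 / (1 + (norm x)\<^sup>2)) ^ DIM('a)) * g (stereo x) \<partial>subspace_lborel UNIV)"
    by (subst nn_integral_subspace_lborel_Times_0(1)) (auto simp: dim_UNIV_Times_0 stereo_def norm_Pair)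
  finally show ?thesis by (simp add: subspace_lborel_UNIV)
qed

text \<open>The section of the sphere by \<open>\<tau>\<close> is \<open>centre + radius u\<close> for unit vectors \<open>u\<close> of the direction space. The
  vector \<open>pole\<close> is the value of \<open>u\<close> at the north pole, and since \<open>centre\<close> is orthogonal to the directions,
  the last coordinate of a direction is \<open>radius\<close> times its inner product with \<open>pole\<close>. So the
  horizontal directions form the hyperplane orthogonal to \<open>pole\<close>.\<close>

locale slice_plane =
  fixes k :: nat and \<tau> :: "('a::euclidean_space \<times> real) set"
  assumes k: "2 \<le> k" and \<tau>: "\<tau> \<in> slice_planes k"
begin

definition centre where "centre = closest_point \<tau> 0"
definition radius where "radius = sqrt (1 - (norm centre)\<^sup>2)"
definition directions where "directions = (\<lambda>x. x - centre) ` \<tau>"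
definition pole where "pole = (1 / radius) *\<^sub>R (north_pole - centre)"
definition horizontal where "horizontal = {w \<in> directions. snd w = 0}"

lemma affine_\<tau>: "affine \<tau>" and north_pole_in: "north_pole \<in> \<tau>"
  and aff_dim_\<tau>: "aff_dim \<tau> = int k"
  using \<tau> by (auto simp: slice_planes_def)

lemma centre_in: "centre \<in> \<tau>"
  using north_pole_in affine_closed[OF affine_\<tau>] closest_point_in_set[of \<tau> 0]
  by (auto simp: centre_def)

lemma subspace_directions: "subspace directions"
  unfolding directions_def by (rule affine_diffs_subspace_subtract[OF affine_\<tau> centre_in])

lemma dim_directions: "dim directions = k"
proof -
  have "int (dim directions) = aff_dim directions"
    by (simp add: aff_dim_subspace subspace_directions)
  also have "\<dots> = int k"
    unfolding directions_def by (simp add: aff_dim_translation_eq_subtract aff_dim_\<tau>)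
  finally show ?thesis by simp
qed

lemma centre_plus_in: "w \<in> directions \<Longrightarrow> centre + w \<in> \<tau>"
  and minus_centre_in: "x \<in> \<tau> \<Longrightarrow> x - centre \<in> directions"
  by (auto simp: directions_def)

lemma centre_orthogonal:
  assumes "w \<in> directions"
  shows "centre \<bullet> w = 0"
proof -
  have le: "0 \<le> centre \<bullet> w" if "w \<in> directions" for w
    using closest_point_dot[OF affine_imp_convex[OF affine_\<tau>] affine_closed[OF affine_\<tau>] centre_plus_in[OF that], of 0]
    by (simp add: centre_def)
  from le[OF assms] le[of "- w"] assms show ?thesis
    by (simp add: subspace_neg[OF subspace_directions])
qed

lemma snd_centre: "snd centre = (norm centre)\<^sup>2"
proof -
  have "centre \<bullet> (north_pole - centre) = 0"
    by (rule centre_orthogonal[OF minus_centre_in[OF north_pole_in]])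
  then have "centre \<bullet> north_pole = (norm centre)\<^sup>2"
    by (simp only: inner_diff_right right_minus_eq power2_norm_eq_inner)
  then show ?thesis by simp
qed

lemma radius_pos: "radius > 0" and radius_sq: "radius\<^sup>2 = 1 - (norm centre)\<^sup>2"
proof -
  have N: "(norm (north_pole - centre))\<^sup>2 = 1 - (norm centre)\<^sup>2"
    using dot_norm_neg[of north_pole centre] by (simp add: snd_centre)
  have "centre \<noteq> north_pole"
  proof
    assume c: "centre = north_pole"
    obtain x where "(x, 0) \<in> \<tau>" using \<tau> by (auto simp: slice_planes_def)
    then have "centre \<bullet> ((x, 0) - centre) = 0"
      by (rule centre_orthogonal[OF minus_centre_in])
    then show False unfolding c by (simp add: north_pole_def)
  qed
  then have "0 < (norm (north_pole - centre))\<^sup>2" by simp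
  then have "0 < 1 - (norm centre)\<^sup>2" using N by simp
  then show "radius > 0" "radius\<^sup>2 = 1 - (norm centre)\<^sup>2"
    by (simp_all add: radius_def)
qed

lemma north_pole_eq: "north_pole = centre + radius *\<^sub>R pole"
  using radius_pos by (simp add: pole_def)

lemma pole_in: "pole \<in> directions"
  unfolding pole_def
  by (intro subspace_scale subspace_directions minus_centre_in north_pole_in)

lemma snd_direction:
  assumes "w \<in> directions"
  shows "snd w = radius * (w \<bullet> pole)"
proof -
  have "radius * (w \<bullet> pole) = w \<bullet> (north_pole - centre)"
    using radius_pos by (simp add: pole_def)
  also have "\<dots> = w \<bullet> north_pole"
    using centre_orthogonal[OF assms] by (simp add: inner_diff_right inner_commute)
  finally show ?thesis by simp
qed

lemma norm_pole: "norm pole = 1"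
proof -
  have "(norm (north_pole - centre))\<^sup>2 = radius\<^sup>2"
    using dot_norm_neg[of north_pole centre] by (simp add: snd_centre radius_sq)
  then have "norm (north_pole - centre) = radius"
    using radius_pos by simp
  then show ?thesis using radius_pos by (simp add: pole_def)
qed

lemma horizontal_iff: "w \<in> horizontal \<longleftrightarrow> w \<in> directions \<and> w \<bullet> pole = 0"
  using radius_pos by (auto simp: horizontal_def snd_direction)

lemma subspace_horizontal: "subspace horizontal"
  using subspace_directions by (auto simp: horizontal_def subspace_def)

lemma span_pole_horizontal: "span (insert pole horizontal) = directions"
proof
  have "insert pole horizontal \<subseteq> directions"
    using pole_in by (auto simp: horizontal_def)
  then show "span (insert pole horizontal) \<subseteq> directions"
    by (metis span_mono span_eq_iff subspace_directions)
  show "directions \<subseteq> span (insert pole horizontal)"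
  proof
    fix w assume w: "w \<in> directions"
    have "w - (w \<bullet> pole) *\<^sub>R pole \<in> horizontal"
      unfolding horizontal_iff using norm_pole
      by (auto simp: inner_diff_left norm_eq_1 intro!: subspace_diff subspace_scale subspace_directions w pole_in)
    then show "w \<in> span (insert pole horizontal)"
      unfolding span_insert span_eq_iff[THEN iffD2, OF subspace_horizontal] by blast
  qed
qed

lemma dim_horizontal: "dim horizontal = k - 1"
  using nn_integral_subspace_lborel_insert(2)[OF subspace_horizontal norm_pole, of "\<lambda>_. 0"]
  by (simp add: horizontal_iff span_pole_horizontal dim_directions)

sublocale hyperplane_split horizontal pole directions
  using k by unfold_locales
    (auto simp: subspace_horizontal dim_horizontal norm_pole horizontal_iff span_pole_horizontal)

text \<open>The measure \<open>subsphere_measure\<close> before its completion.\<close>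

definition slice_measure where
  "slice_measure = scale_measure (ennreal (radius ^ (k - 1)))
     (distr (unit_sphere_measure directions) (restrict_space borel (\<tau> \<inter> sphere 0 1))
        (\<lambda>u. centre + radius *\<^sub>R u))"

lemma subsphere_measure_eq: "subsphere_measure \<tau> = completion slice_measure"
  unfolding subsphere_measure_def slice_measure_def Let_def
  by (simp flip: centre_def radius_def directions_def add: dim_directions)

lemma space_slice_measure [simp]: "space slice_measure = \<tau> \<inter> sphere 0 1"
  and sets_slice_measure: "sets slice_measure = sets (restrict_space borel (\<tau> \<inter> sphere 0 1))"
  by (simp_all add: slice_measure_def space_scale_measure space_restrict_space)

lemma measurable_slice_measure:
  "g \<in> borel_measurable borel \<Longrightarrow> g \<in> borel_measurable slice_measure"
  by (subst measurable_cong_sets[OF sets_slice_measure refl]) (rule measurable_restrict_space1)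

lemma sphere_param_in:
  assumes "u \<in> directions" "norm u = 1"
  shows "centre + radius *\<^sub>R u \<in> \<tau> \<inter> sphere 0 1"
proof -
  have "(norm (centre + radius *\<^sub>R u))\<^sup>2 = 1"
    using centre_orthogonal[OF assms(1)] assms(2) radius_sq radius_pos
    by (simp add: norm_add_Pythagorean orthogonal_def power_mult_distrib)
  then have "norm (centre + radius *\<^sub>R u) = 1"
    by (simp add: power2_eq_1_iff)
       (metis add_neg_numeral_special(7) linorder_not_less norm_ge_zero zero_less_one neg_less_0_iff_less)
  then show ?thesis
    using assms by (auto intro: centre_plus_in subspace_scale subspace_directions)
qed

lemma nn_integral_slice_measure:
  assumes g: "g \<in> borel_measurable borel"
  shows "(\<integral>\<^sup>+\<eta>. g \<eta> \<partial>slice_measure)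
    = ennreal (radius ^ (k - 1)) * (\<integral>\<^sup>+u. g (centre + radius *\<^sub>R u) \<partial>sphere_borel directions)"
proof -
  have "(\<lambda>u. centre + radius *\<^sub>R u) \<in> unit_sphere_measure directions \<rightarrow>\<^sub>M borel"
    unfolding measurable_cong_sets[OF sets_unit_sphere_measure refl]
    by (intro measurable_restrict_space1) measurable
  then have T: "(\<lambda>u. centre + radius *\<^sub>R u) \<in> unit_sphere_measure directions \<rightarrow>\<^sub>M restrict_space borel (\<tau> \<inter> sphere 0 1)"
    by (rule measurable_restrict_space2[rotated]) (use sphere_param_in in auto)
  have g': "g \<in> borel_measurable (restrict_space borel (\<tau> \<inter> sphere 0 1))"
    by (rule measurable_restrict_space1[OF g])
  have "(\<integral>\<^sup>+\<eta>. g \<eta> \<partial>slice_measure)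
     = ennreal (radius ^ (k - 1)) * (\<integral>\<^sup>+u. g (centre + radius *\<^sub>R u) \<partial>unit_sphere_measure directions)"
    unfolding slice_measure_def using nn_integral_distr[OF T, of g] g'
    by (subst nn_integral_scale_measure) auto
  also have "(\<integral>\<^sup>+u. g (centre + radius *\<^sub>R u) \<partial>unit_sphere_measure directions)
     = (\<integral>\<^sup>+u. g (centre + radius *\<^sub>R u) \<partial>sphere_borel directions)"
    by (intro nn_integral_unit_sphere_measure measurable_compose[OF _ g]) measurable
  finally show ?thesis .
qed

lemma slice_transform_eq: "slice_transform g \<tau> = (\<integral>\<^sup>+\<eta>. g \<eta> \<partial>slice_measure)"
  by (simp add: slice_transform_def subsphere_measure_eq nn_integral_completion)

lemma snd_sphere_param:
  assumes "\<theta> \<in> horizontal"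
  shows "snd (centre + radius *\<^sub>R (a *\<^sub>R pole + b *\<^sub>R \<theta>)) = 1 - radius\<^sup>2 * (1 - a)"
proof -
  have "snd \<theta> = 0" using assms by (simp add: horizontal_def)
  moreover have "snd pole = radius"
    using snd_direction[OF pole_in] norm_pole by (simp add: norm_eq_1)
  ultimately show ?thesis
    by (simp add: snd_centre radius_sq algebra_simps power2_eq_square[of radius, symmetric])
qed

text \<open>At latitude \<open>a\<close> the height \<open>\<eta>\<^sub>n\<^sub>+\<^sub>1\<close> is \<open>1 - radius\<^sup>2 (1 - a)\<close>, because the horizontal directions do not
  contribute to it. The constant is the surface area of the parallels, scaled to radius 1.\<close>

lemma slice_transform_zonal:
  assumes [measurable]: "g \<in> borel_measurable borel"
  shows "slice_transform (\<lambda>\<eta>. g (snd \<eta>)) \<tau>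
    = ennreal (radius ^ (k - 1)) * ennreal (real (k - 1) * unit_ball_vol (real (k - 1))) *
      (\<integral>\<^sup>+a. indicator {-1<..<1} a * ennreal ((1 - a\<^sup>2) powr ((real k - 3) / 2)) *
          g (1 - radius\<^sup>2 * (1 - a)) \<partial>lborel)"
proof -
  let ?K = "ennreal (real (k - 1) * unit_ball_vol (real (k - 1)))"
  have K: "emeasure (sphere_borel horizontal) UNIV = ?K"
    using emeasure_sphere_borel[OF subspace_horizontal] k by (simp add: dim_horizontal)
  have e: "(real (dim horizontal) - 2) / 2 = (real k - 3) / 2"
    using k by (simp add: dim_horizontal)
  have "slice_transform (\<lambda>\<eta>. g (snd \<eta>)) \<tau>
      = ennreal (radius ^ (k - 1)) * (\<integral>\<^sup>+u. g (snd (centre + radius *\<^sub>R u)) \<partial>sphere_borel directions)"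
    unfolding slice_transform_eq
    by (rule nn_integral_slice_measure) (rule measurable_compose[OF measurable_snd_borel assms])
  also have "(\<integral>\<^sup>+u. g (snd (centre + radius *\<^sub>R u)) \<partial>sphere_borel directions)
     = (\<integral>\<^sup>+a. indicator {-1<..<1} a * ennreal ((1 - a\<^sup>2) powr ((real k - 3) / 2)) *
         (\<integral>\<^sup>+\<theta>. g (snd (centre + radius *\<^sub>R (a *\<^sub>R pole + sqrt (1 - a\<^sup>2) *\<^sub>R \<theta>))) \<partial>sphere_borel horizontal) \<partial>lborel)"
    unfolding e[symmetric]
    by (rule nn_integral_sphere_latitude)
       (intro measurable_compose[OF _ assms] measurable_compose[OF _ measurable_snd_borel], measurable)
  also have "\<dots> = (\<integral>\<^sup>+a. ?K * (indicator {-1<..<1} a * ennreal ((1 - a\<^sup>2) powr ((real k - 3) / 2)) *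
         g (1 - radius\<^sup>2 * (1 - a))) \<partial>lborel)"
  proof (rule nn_integral_cong)
    fix a :: real
    have "(\<integral>\<^sup>+\<theta>. g (snd (centre + radius *\<^sub>R (a *\<^sub>R pole + sqrt (1 - a\<^sup>2) *\<^sub>R \<theta>))) \<partial>sphere_borel horizontal)
      = (\<integral>\<^sup>+\<theta>. g (1 - radius\<^sup>2 * (1 - a)) \<partial>sphere_borel horizontal)"
      by (intro nn_integral_sphere_borel_cong subspace_horizontal) (simp only: snd_sphere_param)
    also have "\<dots> = ?K * g (1 - radius\<^sup>2 * (1 - a))"
      by (simp add: K mult.commute)
    finally show "indicator {-1<..<1} a * ennreal ((1 - a\<^sup>2) powr ((real k - 3) / 2)) *
         (\<integral>\<^sup>+\<theta>. g (snd (centre + radius *\<^sub>R (a *\<^sub>R pole + sqrt (1 - a\<^sup>2) *\<^sub>R \<theta>))) \<partial>sphere_borel horizontal)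
       = ?K * (indicator {-1<..<1} a * ennreal ((1 - a\<^sup>2) powr ((real k - 3) / 2)) * g (1 - radius\<^sup>2 * (1 - a)))"
      by (simp only: mult_ac)
  qed
  also have "\<dots> = ?K * (\<integral>\<^sup>+a. indicator {-1<..<1} a * ennreal ((1 - a\<^sup>2) powr ((real k - 3) / 2)) *
         g (1 - radius\<^sup>2 * (1 - a)) \<partial>lborel)"
    by (rule nn_integral_cmult) measurable
  finally show ?thesis by (simp only: mult.assoc)
qed

text \<open>The stereographic coordinate \<open>z\<close> in the direction space satisfies \<open>1 + \<bar>z\<bar>\<^sup>2 = r\<^sup>2 (1 + \<bar>x + y\<bar>\<^sup>2)\<close>, where
  \<open>r\<close> is the radius of the slice. The resulting factor \<open>r\<^bsup>-2(k-1)\<^esup>\<close> is cancelled by the scaling of the surface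
  measure and by that of the plane, so the conformal factor is the same for all slices.\<close>

lemma slice_transform_stereo:
  assumes [measurable]: "g \<in> borel_measurable borel"
    and W\<^sub>0: "subspace W\<^sub>0" and trace: "trace_plane \<tau> = (+) x ` W\<^sub>0"
  shows "slice_transform g \<tau>
    = (\<integral>\<^sup>+y. ennreal ((2 / (1 + (norm (x + y))\<^sup>2)) ^ (k - 1)) * g (stereo (x + y)) \<partial>subspace_lborel W\<^sub>0)"
proof -
  let ?r = radius and ?d = "k - 1"
  have x_in: "(x, 0) \<in> \<tau>"
    using trace subspace_0[OF W\<^sub>0] by (force simp: trace_plane_def)
  have horizontal: "horizontal = W\<^sub>0 \<times> {0}"
  proof -
    have "(y, 0) \<in> directions \<longleftrightarrow> y \<in> W\<^sub>0" for y
    proof -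
      have "(y, 0) \<in> directions \<longleftrightarrow> ((x, 0) - centre) + (y, 0) \<in> directions"
      proof
        assume "(y, 0) \<in> directions"
        then show "((x, 0) - centre) + (y, 0) \<in> directions"
          by (intro subspace_add subspace_directions minus_centre_in x_in)
      next
        assume "((x, 0) - centre) + (y, 0) \<in> directions"
        from subspace_diff[OF subspace_directions this minus_centre_in[OF x_in]]
        show "(y, 0) \<in> directions" by simp
      qed
      also have "\<dots> \<longleftrightarrow> (x + y, 0) \<in> \<tau>"
        using centre_plus_in[of "(x, 0) - centre + (y, 0)"] minus_centre_in[of "(x + y, 0)"]
        by (auto simp: algebra_simps)
      also have "\<dots> \<longleftrightarrow> x + y \<in> trace_plane \<tau>" by (simp add: trace_plane_def)
      also have "\<dots> \<longleftrightarrow> y \<in> W\<^sub>0" unfolding trace by auto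
      finally show ?thesis .
    qed
    then have "(y, t) \<in> horizontal \<longleftrightarrow> (y, t) \<in> W\<^sub>0 \<times> {0}" for y t
      by (cases "t = 0") (simp_all add: horizontal_def)
    then show ?thesis by (intro set_eqI) (metis surj_pair)
  qed
  \<comment> \<open>The line from the north pole through \<open>x + y\<close> has the direction of \<open>z - pole\<close> for \<open>z = ?a + ?r y\<close>,
    which is therefore the stereographic coordinate, in the direction space, of the same point.\<close>
  let ?a = "?r *\<^sub>R ((x, 0) - north_pole) + pole"
  have a_in: "?a \<in> horizontal"
  proof -
    have "(x, 0) - north_pole = ((x, 0) - centre) - ?r *\<^sub>R pole"
      by (simp add: north_pole_eq)
    then have "(x, 0) - north_pole \<in> directions"
      by (simp only:) (intro subspace_diff subspace_scale subspace_directions pole_in minus_centre_in x_in)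
    moreover have "snd ?a = 0"
      using snd_direction[OF pole_in] norm_pole by (simp add: north_pole_def norm_eq_1)
    ultimately show ?thesis
      by (simp add: horizontal_def subspace_add subspace_scale subspace_directions pole_in)
  qed
  let ?h = "\<lambda>z. ennreal ((2 / (1 + (norm z)\<^sup>2)) ^ ?d) *
      g (centre + ?r *\<^sub>R (pole + (2 / (1 + (norm z)\<^sup>2)) *\<^sub>R (z - pole)))"
  have h: "?h \<in> borel_measurable borel" by measurable
  have point: "ennreal (?r ^ ?d) * (ennreal (?r ^ ?d) * ?h (?a + ?r *\<^sub>R (y, 0)))
      = ennreal ((2 / (1 + (norm (x + y))\<^sup>2)) ^ ?d) * g (stereo (x + y))" if y: "y \<in> W\<^sub>0" for y
  proof -
    let ?z = "?a + ?r *\<^sub>R (y, 0)" and ?n = "1 + (norm (x + y))\<^sup>2"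
    have n: "?n > 0" by (simp add: add_pos_nonneg)
    have z: "?z = ?r *\<^sub>R ((x + y, 0) - north_pole) + pole"
      by (simp add: algebra_simps flip: scaleR_add_right)
    have "(y, 0) \<in> horizontal" using y horizontal by auto
    then have "?z \<in> horizontal"
      by (rule subspace_add[OF subspace_horizontal a_in subspace_scale[OF subspace_horizontal]])
    then have "?z \<bullet> pole = 0" by (simp add: horizontal_iff)
    then have "(norm (?z - pole))\<^sup>2 = (norm ?z)\<^sup>2 + 1"
      using dot_norm_neg[of ?z pole] norm_pole by simp
    moreover have "(norm (?z - pole))\<^sup>2 = ?r\<^sup>2 * ?n"
      unfolding z by (simp add: power_mult_distrib north_pole_def norm_Pair distrib_left)
    ultimately have nz: "1 + (norm ?z)\<^sup>2 = ?r\<^sup>2 * ?n" by simp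
    have "centre + ?r *\<^sub>R (pole + (2 / (?r\<^sup>2 * ?n)) *\<^sub>R (?z - pole))
       = north_pole + (?r * (2 / (?r\<^sup>2 * ?n)) * ?r) *\<^sub>R ((x + y, 0) - north_pole)"
      unfolding z by (subst (2) north_pole_eq) (simp add: scaleR_add_right mult.assoc)
    also have "?r * (2 / (?r\<^sup>2 * ?n)) * ?r = 2 / ?n"
      using radius_pos n by (simp add: power2_eq_square)
    finally have arg: "centre + ?r *\<^sub>R (pole + (2 / (?r\<^sup>2 * ?n)) *\<^sub>R (?z - pole)) = stereo (x + y)"
      by (simp add: stereo_def)
    have "?r ^ ?d * (?r ^ ?d * (2 / (?r\<^sup>2 * ?n)) ^ ?d) = (?r * (?r * (2 / (?r\<^sup>2 * ?n)))) ^ ?d"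
      by (simp only: power_mult_distrib)
    also have "?r * (?r * (2 / (?r\<^sup>2 * ?n))) = 2 / ?n"
      using radius_pos n by (simp add: power2_eq_square)
    finally have w: "(2 / ?n) ^ ?d = ?r ^ ?d * (?r ^ ?d * (2 / (?r\<^sup>2 * ?n)) ^ ?d)" ..
    have "ennreal (?r ^ ?d) * (ennreal (?r ^ ?d) * ennreal ((2 / (?r\<^sup>2 * ?n)) ^ ?d)) = ennreal ((2 / ?n) ^ ?d)"
      unfolding w using radius_pos by (simp only: ennreal_mult' zero_le_power less_imp_le)
    then show ?thesis unfolding nz arg by (simp only: mult.assoc[symmetric])
  qed
  have "slice_transform g \<tau>
      = ennreal (?r ^ ?d) * (\<integral>\<^sup>+u. g (centre + ?r *\<^sub>R u) \<partial>sphere_borel directions)"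
    unfolding slice_transform_eq by (rule nn_integral_slice_measure) measurable
  also have "(\<integral>\<^sup>+u. g (centre + ?r *\<^sub>R u) \<partial>sphere_borel directions) = (\<integral>\<^sup>+z. ?h z \<partial>subspace_lborel horizontal)"
    unfolding dim_horizontal[symmetric] by (rule nn_integral_sphere_stereographic) measurable
  also have "\<dots> = ennreal (?r ^ ?d) * (\<integral>\<^sup>+z. ?h (?a + ?r *\<^sub>R z) \<partial>subspace_lborel horizontal)"
    using nn_integral_subspace_lborel_affine[OF subspace_horizontal, of ?r ?a ?h] h a_in radius_pos
    by (simp only: dim_horizontal) simp
  also have "(\<integral>\<^sup>+z. ?h (?a + ?r *\<^sub>R z) \<partial>subspace_lborel horizontal) = (\<integral>\<^sup>+y. ?h (?a + ?r *\<^sub>R (y, 0)) \<partial>subspace_lborel W\<^sub>0)"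
    unfolding horizontal by (rule nn_integral_subspace_lborel_Times_0(1)[OF W\<^sub>0]) measurable
  also have "ennreal (?r ^ ?d) * (ennreal (?r ^ ?d) * \<dots>)
     = (\<integral>\<^sup>+y. ennreal (?r ^ ?d) * (ennreal (?r ^ ?d) * ?h (?a + ?r *\<^sub>R (y, 0))) \<partial>subspace_lborel W\<^sub>0)"
    by (simp add: nn_integral_cmult)
  also have "\<dots> = (\<integral>\<^sup>+y. ennreal ((2 / (1 + (norm (x + y))\<^sup>2)) ^ ?d) * g (stereo (x + y)) \<partial>subspace_lborel W\<^sub>0)"
    by (intro nn_integral_subspace_lborel_cong W\<^sub>0 point)
  finally show ?thesis .
qed

end

lemma mem_translation_iff: "y \<in> (+) a ` S \<longleftrightarrow> y - a \<in> S"
  for a y :: "'a::ab_group_add"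
  by (auto simp: image_iff intro!: bexI[where x = "y - a"])

text \<open>The plane through the north pole over a given affine plane of \<open>\<real>\<^sup>n\<close>; hence \<open>trace_plane\<close> is onto.\<close>

lemma slice_plane_over_affine_plane:
  fixes x :: "'a::euclidean_space"
  assumes W: "subspace W" and k: "1 \<le> k" "dim W = k - 1"
  obtains \<tau> where "\<tau> \<in> slice_planes k" "trace_plane \<tau> = (+) x ` W"
proof -
  define V where "V = span (insert (x, -1) (W \<times> {0::real}))"
  define \<tau> where "\<tau> = (+) north_pole ` V"
  have sub: "subspace (W \<times> {0::real})"
    using W by (auto simp: subspace_def zero_prod_def)
  have V_iff: "z \<in> V \<longleftrightarrow> (\<exists>c. z - c *\<^sub>R (x, -1) \<in> W \<times> {0})" for z
    unfolding V_def span_insert span_eq_iff[THEN iffD2, OF sub] by simp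
  have "(x, -1) \<notin> span (W \<times> {0::real})"
    unfolding span_eq_iff[THEN iffD2, OF sub] by simp
  then have "dim V = Suc (dim (W \<times> {0::real}))"
    unfolding V_def dim_span by (subst dim_insert) auto
  also have "dim (W \<times> {0::real}) = dim W"
    by (rule nn_integral_subspace_lborel_Times_0(2)[OF W, of "\<lambda>_. 0"]) simp
  finally have dim: "dim V = k" using k by simp
  have mem: "(z, 0) \<in> \<tau> \<longleftrightarrow> z - x \<in> W" for z
  proof -
    have "(z, 0) \<in> \<tau> \<longleftrightarrow> (z, -1) \<in> V"
      unfolding \<tau>_def north_pole_def mem_translation_iff by simp
    also have "\<dots> \<longleftrightarrow> z - x \<in> W" unfolding V_iff by auto
    finally show ?thesis .
  qed
  have "(x, 0) \<in> \<tau>" unfolding mem using subspace_0[OF W] by simp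
  moreover have "north_pole \<in> \<tau>"
    unfolding \<tau>_def V_def mem_translation_iff by (simp add: span_0)
  moreover have "affine \<tau>"
    unfolding \<tau>_def V_def by (simp add: affine_translation[symmetric] subspace_imp_affine)
  moreover have "aff_dim \<tau> = int k"
    unfolding \<tau>_def aff_dim_translation_eq using dim by (subst aff_dim_subspace) (auto simp: V_def)
  ultimately have "\<tau> \<in> slice_planes k" by (auto simp: slice_planes_def)
  moreover have "trace_plane \<tau> = (+) x ` W"
    unfolding trace_plane_def mem by (auto simp: mem_translation_iff)
  ultimately show ?thesis by (rule that)
qed

section \<open>Random subspaces\<close>

text \<open>A basis of the span that depends measurably on the vectors. Since \<open>sgn 0 = 0\<close>, a vector that depends on
  its predecessors is replaced by 0, and the recursion goes on.\<close>

fun gram_schmidt :: "(nat \<Rightarrow> 'a::euclidean_space) \<Rightarrow> nat \<Rightarrow> 'a" where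
  "gram_schmidt v i = sgn (v i - (\<Sum>j<i. (v i \<bullet> gram_schmidt v j) *\<^sub>R gram_schmidt v j))"

declare gram_schmidt.simps [simp del]

lemma gram_schmidt_inner_self: "gram_schmidt v i \<bullet> gram_schmidt v i = (if gram_schmidt v i = 0 then 0 else 1)"
proof -
  have "norm (gram_schmidt v i) = (if gram_schmidt v i = 0 then 0 else 1)"
    by (subst (1 2) gram_schmidt.simps) (simp add: norm_sgn sgn_zero_iff)
  then show ?thesis by (simp add: dot_square_norm)
qed

lemma gram_schmidt_orthogonal_less: "j < i \<Longrightarrow> gram_schmidt v i \<bullet> gram_schmidt v j = 0"
proof (induction i arbitrary: j rule: less_induct)
  case (less i)
  let ?e = "gram_schmidt v"
  have "(\<Sum>l<i. (v i \<bullet> ?e l) *\<^sub>R ?e l) \<bullet> ?e j = (\<Sum>l<i. (v i \<bullet> ?e l) * (?e l \<bullet> ?e j))"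
    by (simp add: inner_sum_left)
  also have "\<dots> = (\<Sum>l<i. if l = j then (v i \<bullet> ?e j) * (?e j \<bullet> ?e j) else 0)"
  proof (rule sum.cong)
    fix l assume "l \<in> {..<i}"
    then have l: "l < i" by simp
    consider "l = j" | "l < j" | "j < l" by linarith
    then show "(v i \<bullet> ?e l) * (?e l \<bullet> ?e j) = (if l = j then (v i \<bullet> ?e j) * (?e j \<bullet> ?e j) else 0)"
    proof cases
      case 2
      then show ?thesis using less.IH[OF less.prems, of l] by (simp add: inner_commute)
    next
      case 3
      then show ?thesis using less.IH[OF l, of j] by simp
    qed simp
  qed simp
  also have "\<dots> = (v i \<bullet> ?e j) * (?e j \<bullet> ?e j)"
    using less.prems by simp
  also have "\<dots> = v i \<bullet> ?e j"
    by (simp add: gram_schmidt_inner_self)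
  finally have "(v i - (\<Sum>l<i. (v i \<bullet> ?e l) *\<^sub>R ?e l)) \<bullet> ?e j = 0"
    by (simp add: inner_diff_left)
  then show ?case
    by (subst gram_schmidt.simps) (simp add: sgn_div_norm)
qed

lemma gram_schmidt_inner:
  "gram_schmidt v i \<bullet> gram_schmidt v j = (if i = j \<and> gram_schmidt v i \<noteq> 0 then 1 else 0)"
  using gram_schmidt_orthogonal_less[of i j v] gram_schmidt_orthogonal_less[of j i v]
  by (cases i j rule: linorder_cases) (simp_all add: inner_commute gram_schmidt_inner_self)

lemma span_gram_schmidt: "span (gram_schmidt v ` {..<d}) = span (v ` {..<d})"
proof (induction d)
  case (Suc d)
  let ?e = "gram_schmidt v" and ?E = "gram_schmidt v ` {..<d}"
  let ?s = "\<Sum>j<d. (v d \<bullet> ?e j) *\<^sub>R ?e j"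
  have s: "?s \<in> span ?E"
    by (intro span_sum span_scale span_base) auto
  define u where "u = v d - ?s"
  have e: "?e d = sgn u" by (subst gram_schmidt.simps) (simp add: u_def)
  have "span (insert (?e d) ?E) = span (insert u ?E)"
  proof -
    have "norm u *\<^sub>R ?e d = u" unfolding e by (cases "u = 0") (simp_all add: sgn_div_norm)
    then have "u \<in> span (insert (?e d) ?E)"
      by (metis insertI1 span_base span_scale)
    moreover have "?e d \<in> span (insert u ?E)"
      unfolding e sgn_div_norm by (intro span_scale span_base) simp
    ultimately show ?thesis
      by (intro subset_antisym span_minimal) (auto intro: span_base)
  qed
  also have "\<dots> = span (insert (v d) ?E)"
  proof -
    have "x - c *\<^sub>R u \<in> span ?E \<longleftrightarrow> x - c *\<^sub>R v d \<in> span ?E" for x c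
    proof -
      have "x - c *\<^sub>R u = (x - c *\<^sub>R v d) + c *\<^sub>R ?s"
        unfolding u_def by (simp only: scaleR_diff_right) simp
      then show ?thesis by (simp only: span_add_eq2[OF span_scale[OF s]])
    qed
    then show ?thesis unfolding span_insert by simp
  qed
  also have "\<dots> = span (insert (v d) (v ` {..<d}))"
    unfolding span_insert Suc.IH ..
  finally show ?case by (simp add: lessThan_Suc)
qed simp

definition independent_frame :: "nat \<Rightarrow> (nat \<Rightarrow> 'a::euclidean_space) \<Rightarrow> bool" where
  "independent_frame d v \<longleftrightarrow> (\<forall>i<d. gram_schmidt v i \<noteq> 0)"

lemma orthonormal_family_gram_schmidt:
  "independent_frame d v \<Longrightarrow> orthonormal_family {..<d} (gram_schmidt v)"
  by (intro orthonormal_familyI) (auto simp: gram_schmidt_inner independent_frame_def)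

lemma independent_frame_iff: "dim (v ` {..<d}) = d \<longleftrightarrow> independent_frame d v"
proof
  assume "independent_frame d v"
  from dim_orthonormal_family[OF orthonormal_family_gram_schmidt[OF this]]
  show "dim (v ` {..<d}) = d" by (metis card_lessThan dim_span span_gram_schmidt)
next
  assume dim: "dim (v ` {..<d}) = d"
  show "independent_frame d v"
  proof (rule ccontr)
    assume "\<not> ?thesis"
    then obtain i where i: "i < d" "gram_schmidt v i = 0" by (auto simp: independent_frame_def)
    let ?E = "gram_schmidt v ` ({..<d} - {i})"
    have "gram_schmidt v ` {..<d} = insert 0 ?E" using i by auto
    then have "d = dim ?E"
      using dim span_gram_schmidt[of v d] by (metis dim_span span_insert_0)
    also have "\<dots> \<le> card ?E" by (intro dim_le_card') simp
    also have "\<dots> \<le> card ({..<d} - {i})" by (intro card_image_le) simp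
    finally show False using i by simp
  qed
qed

lemma measurable_gram_schmidt:
  assumes M: "\<And>i. sets (M i) = sets (borel :: 'a::euclidean_space measure)" and "i < d"
  shows "(\<lambda>v. gram_schmidt v i) \<in> Pi\<^sub>M {..<d} M \<rightarrow>\<^sub>M borel"
  using \<open>i < d\<close>
proof (induction i rule: less_induct)
  case (less i)
  have [measurable]: "(\<lambda>v. v i) \<in> Pi\<^sub>M {..<d} M \<rightarrow>\<^sub>M borel"
    using measurable_component_singleton[of i "{..<d}" M] less.prems
    by (simp add: measurable_cong_sets[OF refl M])
  have [measurable]: "(\<lambda>v. gram_schmidt v j) \<in> Pi\<^sub>M {..<d} M \<rightarrow>\<^sub>M borel" if "j \<in> {..<i}" for j
    using less.IH[of j] less.prems that by simp
  show ?case
    unfolding gram_schmidt.simps[of _ i] sgn_div_norm by measurable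
qed

definition frame_prob :: "nat \<Rightarrow> (nat \<Rightarrow> 'a::euclidean_space) measure" where
  "frame_prob d = Pi\<^sub>M {..<d} (\<lambda>_. uniform_measure lborel (ball 0 1))"

lemma emeasure_unit_ball_bounds: "emeasure lborel (ball (0::'a::euclidean_space) 1) \<noteq> 0"
    "emeasure lborel (ball (0::'a::euclidean_space) 1) \<noteq> \<infinity>"
  by (simp_all add: emeasure_ball ennreal_eq_0_iff not_le)

lemma emeasure_uniform_ball_UNIV:
  "emeasure (uniform_measure lborel (ball (0::'a::euclidean_space) 1)) UNIV = 1"
  using emeasure_uniform_measure_1[OF emeasure_unit_ball_bounds]
  by (simp add: emeasure_uniform_measure)

lemma product_sigma_finite_uniform_ball:
  "product_sigma_finite (\<lambda>_. uniform_measure lborel (ball (0::'a::euclidean_space) 1))"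
proof -
  interpret U: finite_measure "uniform_measure lborel (ball (0::'a) 1)"
    by (rule finite_measureI) (simp add: emeasure_uniform_ball_UNIV del: emeasure_uniform_measure)
  show ?thesis by unfold_locales
qed

lemma emeasure_frame_prob: "emeasure (frame_prob d) (space (frame_prob d)) = 1"
proof -
  interpret product_sigma_finite "\<lambda>_::nat. uniform_measure lborel (ball (0::'a) 1)"
    by (rule product_sigma_finite_uniform_ball)
  have "emeasure (frame_prob d) (Pi\<^sub>E {..<d} (\<lambda>_. UNIV :: 'a set)) = (\<Prod>i<d. 1)"
    unfolding frame_prob_def
    by (subst emeasure_PiM) (simp_all add: emeasure_uniform_ball_UNIV del: emeasure_uniform_measure)
  then show ?thesis by (simp add: frame_prob_def space_PiM)
qed

lemma sigma_finite_frame_prob: "sigma_finite_measure (frame_prob d :: (nat \<Rightarrow> 'a::euclidean_space) measure)"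
proof -
  interpret finite_measure "frame_prob d :: (nat \<Rightarrow> 'a) measure"
    by (rule finite_measureI) (simp add: emeasure_frame_prob)
  show ?thesis by unfold_locales
qed

lemma measurable_gram_schmidt_frame_prob [measurable]:
  "i < d \<Longrightarrow> (\<lambda>v. gram_schmidt v i) \<in> frame_prob d \<rightarrow>\<^sub>M borel"
  unfolding frame_prob_def by (rule measurable_gram_schmidt) simp_all

lemma measurable_independent_frame [measurable]:
  "Measurable.pred (frame_prob d :: (nat \<Rightarrow> 'a::euclidean_space) measure) (independent_frame d)"
proof -
  have [measurable]: "Measurable.pred (frame_prob d) (\<lambda>v :: nat \<Rightarrow> 'a. gram_schmidt v i \<noteq> 0)" if "i \<in> {..<d}" for i
    using that by simp
  have eq: "independent_frame d = (\<lambda>v :: nat \<Rightarrow> 'a. \<forall>i\<in>{..<d}. gram_schmidt v i \<noteq> 0)"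
    by (auto simp: independent_frame_def)
  show ?thesis unfolding eq by measurable
qed

text \<open>The law of the frame is rotation invariant, and the orthonormalisation is equivariant.\<close>

lemma gram_schmidt_orthogonal_transformation:
  assumes Q: "orthogonal_transformation Q" and "i < d"
  shows "gram_schmidt (\<lambda>i\<in>{..<d}. Q (v i)) i = Q (gram_schmidt v i)"
  using \<open>i < d\<close>
proof (induction i rule: less_induct)
  case (less i)
  have lin: "linear Q" by (rule orthogonal_transformation_linear[OF Q])
  have inner: "Q x \<bullet> Q y = x \<bullet> y" for x y
    using Q by (simp add: orthogonal_transformation_def)
  have "(\<Sum>j<i. (Q (v i) \<bullet> gram_schmidt (\<lambda>i\<in>{..<d}. Q (v i)) j) *\<^sub>R gram_schmidt (\<lambda>i\<in>{..<d}. Q (v i)) j)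
     = (\<Sum>j<i. Q ((v i \<bullet> gram_schmidt v j) *\<^sub>R gram_schmidt v j))"
  proof (rule sum.cong)
    fix j assume "j \<in> {..<i}"
    then have IH: "gram_schmidt (\<lambda>i\<in>{..<d}. Q (v i)) j = Q (gram_schmidt v j)"
      using less.prems by (intro less.IH) auto
    show "(Q (v i) \<bullet> gram_schmidt (\<lambda>i\<in>{..<d}. Q (v i)) j) *\<^sub>R gram_schmidt (\<lambda>i\<in>{..<d}. Q (v i)) j
        = Q ((v i \<bullet> gram_schmidt v j) *\<^sub>R gram_schmidt v j)"
      unfolding IH by (simp add: inner linear_scale[OF lin])
  qed simp
  note sum = this
  have r: "(\<lambda>i\<in>{..<d}. Q (v i)) i = Q (v i)" using less.prems by simp
  have sgn: "sgn (Q u) = Q (sgn u)" for u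
    by (simp add: sgn_div_norm linear_scale[OF lin] orthogonal_transformation_norm[OF Q])
  show ?case
    unfolding gram_schmidt.simps[of "\<lambda>i\<in>{..<d}. Q (v i)" i] r sum gram_schmidt.simps[of v i]
    by (simp only: linear_sum[OF lin, symmetric] linear_diff[OF lin, symmetric] sgn)
qed

lemma nn_integral_frame_prob_orthogonal_transformation:
  fixes Q :: "'a::euclidean_space \<Rightarrow> 'a"
  assumes Q: "orthogonal_transformation Q" and F: "F \<in> borel_measurable (frame_prob d)"
  shows "(\<integral>\<^sup>+v. F (\<lambda>i\<in>{..<d}. Q (v i)) \<partial>frame_prob d) = (\<integral>\<^sup>+v. F v \<partial>frame_prob d)"
proof -
  let ?U = "uniform_measure lborel (ball (0::'a) 1)" and ?T = "\<lambda>v. \<lambda>i\<in>{..<d}. Q (v i)"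
  interpret product_sigma_finite "\<lambda>_::nat. ?U" by (rule product_sigma_finite_uniform_ball)
  have lin: "linear Q" by (rule orthogonal_transformation_linear[OF Q])
  then have Qm [measurable]: "Q \<in> borel \<rightarrow>\<^sub>M borel"
    by (intro borel_measurable_continuous_onI linear_continuous_on)
       (simp add: linear_conv_bounded_linear)
  have T: "?T \<in> frame_prob d \<rightarrow>\<^sub>M frame_prob d"
    unfolding frame_prob_def
  proof (rule measurable_restrict)
    fix i assume "i \<in> {..<d}"
    then have "(\<lambda>v. v i) \<in> Pi\<^sub>M {..<d} (\<lambda>_. ?U) \<rightarrow>\<^sub>M ?U" by (rule measurable_component_singleton)
    moreover have "Q \<in> ?U \<rightarrow>\<^sub>M ?U" by (simp add: measurable_cong_sets[of ?U borel ?U borel])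
    ultimately show "(\<lambda>v. Q (v i)) \<in> Pi\<^sub>M {..<d} (\<lambda>_. ?U) \<rightarrow>\<^sub>M ?U" by (rule measurable_compose)
  qed
  have inv: "emeasure ?U (Q -` A) = emeasure ?U A" if [measurable]: "A \<in> sets borel" for A
  proof -
    have ind: "indicator (ball 0 1 \<inter> Q -` A) x = (indicator (ball 0 1 \<inter> A) (Q x) :: ennreal)" for x
      by (simp add: indicator_def orthogonal_transformation_norm[OF Q])
    have "emeasure lborel (ball 0 1 \<inter> Q -` A) = (\<integral>\<^sup>+x. indicator (ball 0 1 \<inter> Q -` A) x \<partial>lborel)"
      using measurable_sets[OF Qm that] by simp
    also have "\<dots> = (\<integral>\<^sup>+x. indicator (ball 0 1 \<inter> A) (Q x) \<partial>lborel)"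
      unfolding ind ..
    also have "\<dots> = emeasure lborel (ball 0 1 \<inter> A)"
      using that by (subst nn_integral_lborel_orthogonal_transformation[OF Q])
        (auto intro!: borel_measurable_indicator nn_integral_indicator)
    finally show ?thesis
      using measurable_sets[OF Qm that] by (subst (1 2) emeasure_uniform_measure) auto
  qed
  have "distr (frame_prob d) (frame_prob d) ?T = frame_prob d"
    unfolding frame_prob_def
  proof (rule PiM_eqI)
    fix A :: "nat \<Rightarrow> 'a set" assume "\<And>i. i \<in> {..<d} \<Longrightarrow> A i \<in> sets ?U"
    then have A: "A i \<in> sets borel" if "i < d" for i using that by simp
    have QA: "Q -` A i \<in> sets borel" if "i < d" for i
      using measurable_sets[OF Qm A[OF that]] by simp
    have "emeasure (distr (Pi\<^sub>M {..<d} (\<lambda>_. ?U)) (Pi\<^sub>M {..<d} (\<lambda>_. ?U)) ?T) (Pi\<^sub>E {..<d} A)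
        = emeasure (Pi\<^sub>M {..<d} (\<lambda>_. ?U)) (Pi\<^sub>E {..<d} (\<lambda>i. Q -` A i))"
      using T A unfolding frame_prob_def
      by (subst emeasure_distr)
         (auto intro!: arg_cong2[where f = emeasure] sets_PiM_I_finite simp: space_PiM PiE_iff)
    also have "\<dots> = (\<Prod>i<d. emeasure ?U (A i))"
      using QA A by (subst emeasure_PiM) (auto simp: inv simp del: emeasure_uniform_measure intro!: prod.cong)
    finally show "emeasure (distr (Pi\<^sub>M {..<d} (\<lambda>_. ?U)) (Pi\<^sub>M {..<d} (\<lambda>_. ?U)) ?T) (Pi\<^sub>E {..<d} A)
        = (\<Prod>i\<in>{..<d}. emeasure ?U (A i))" .
  qed simp_all
  then show ?thesis
    using nn_integral_distr[OF T, of F] F by simp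
qed


lemma measurable_lincomb_gram_schmidt [measurable (raw)]:
  fixes f :: "'z \<Rightarrow> nat \<Rightarrow> 'a::euclidean_space"
  assumes [measurable]: "f \<in> M \<rightarrow>\<^sub>M frame_prob d" and [measurable]: "g \<in> M \<rightarrow>\<^sub>M Pi\<^sub>M {..<d} (\<lambda>_. lborel)"
  shows "(\<lambda>x. lincomb {..<d} (gram_schmidt (f x)) (g x)) \<in> M \<rightarrow>\<^sub>M borel"
  unfolding lincomb_def
proof (rule borel_measurable_sum)
  fix i assume i: "i \<in> {..<d}"
  then have 1: "(\<lambda>x. gram_schmidt (f x) i) \<in> M \<rightarrow>\<^sub>M borel"
    by (intro measurable_compose[OF assms(1)] measurable_gram_schmidt_frame_prob) simp
  have 2: "(\<lambda>x. g x i) \<in> M \<rightarrow>\<^sub>M borel"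
    using measurable_compose[OF assms(2) measurable_component_singleton[OF i]] by simp
  show "(\<lambda>x. g x i *\<^sub>R gram_schmidt (f x) i) \<in> M \<rightarrow>\<^sub>M borel"
    by (rule borel_measurable_scaleR[OF 2 1])
qed

text \<open>Averaging the integral of a function over \<open>x + V\<close> over all \<open>x\<close> with \<open>\<bar>x\<bar> \<le> R\<close> integrates the
  function against this kernel, where \<open>V\<close> is the span of the frame \<open>v\<close>.\<close>

definition section_volume :: "nat \<Rightarrow> real \<Rightarrow> (nat \<Rightarrow> 'a::euclidean_space) \<Rightarrow> 'a \<Rightarrow> ennreal" where
  "section_volume d R v z =
     (\<integral>\<^sup>+t. indicator {u. norm u \<le> R} (z - lincomb {..<d} (gram_schmidt v) t) \<partial>Pi\<^sub>M {..<d} (\<lambda>_. lborel))"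

lemma sigma_finite_PiM_lborel: "finite I \<Longrightarrow> sigma_finite_measure (Pi\<^sub>M I (\<lambda>_. lborel :: real measure))"
  by (rule lborel_product.sigma_finite)

lemma measurable_section_volume [measurable (raw)]:
  fixes f :: "'z \<Rightarrow> nat \<Rightarrow> 'a::euclidean_space"
  assumes [measurable]: "f \<in> M \<rightarrow>\<^sub>M frame_prob d" "g \<in> M \<rightarrow>\<^sub>M borel"
  shows "(\<lambda>x. section_volume d R (f x) (g x)) \<in> borel_measurable M"
proof -
  interpret sigma_finite_measure "Pi\<^sub>M {..<d} (\<lambda>_. lborel :: real measure)"
    by (rule sigma_finite_PiM_lborel) simp
  show ?thesis unfolding section_volume_def by measurable
qed

context
  fixes d :: nat and v :: "nat \<Rightarrow> 'a::euclidean_space"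
  assumes indep: "independent_frame d v"
begin

lemma section_volume_eq:
  "section_volume d R v z = (\<integral>\<^sup>+y. indicator {u. norm u \<le> R} (z - y) \<partial>frame_lborel {..<d} (gram_schmidt v))"
  unfolding section_volume_def by (subst nn_integral_frame_lborel) auto

text \<open>The component of \<open>z\<close> in the subspace is removed by a translation; \<open>q\<close> is the orthogonal component.\<close>

lemma section_volume_perp:
  "\<exists>q::'a. \<forall>s. section_volume d R v (s *\<^sub>R z)
     = (\<integral>\<^sup>+y. indicator {y. s\<^sup>2 * (norm q)\<^sup>2 + (norm y)\<^sup>2 \<le> R\<^sup>2 \<and> 0 \<le> R} y \<partial>frame_lborel {..<d} (gram_schmidt v))"
proof -
  note o = orthonormal_family_gram_schmidt[OF indep]
  define a where "a = lincomb {..<d} (gram_schmidt v) (\<lambda>i. z \<bullet> gram_schmidt v i)"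
  let ?V = "span (gram_schmidt v ` {..<d})" and ?q = "z - a"
  have a: "a \<in> ?V" unfolding a_def by (rule lincomb_in_span[OF o])
  have "?q \<bullet> gram_schmidt v i = 0" if "i \<in> {..<d}" for i
    using lincomb_inner[OF o that, of "\<lambda>i. z \<bullet> gram_schmidt v i"] by (simp add: a_def inner_diff_left)
  then have q: "y \<bullet> ?q = 0" if "y \<in> ?V" for y
    using that by (intro orthogonal_to_span[of y "gram_schmidt v ` {..<d}" ?q, unfolded orthogonal_def, THEN trans[OF inner_commute]])
      (auto simp: inner_commute)
  have "section_volume d R v (s *\<^sub>R z)
      = (\<integral>\<^sup>+y. indicator {y. s\<^sup>2 * (norm ?q)\<^sup>2 + (norm y)\<^sup>2 \<le> R\<^sup>2 \<and> 0 \<le> R} y \<partial>frame_lborel {..<d} (gram_schmidt v))" for s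
  proof -
    have "section_volume d R v (s *\<^sub>R z) = (\<integral>\<^sup>+y. indicator {u. norm u \<le> R} (s *\<^sub>R z - (s *\<^sub>R a + y)) \<partial>frame_lborel {..<d} (gram_schmidt v))"
      unfolding section_volume_eq
      by (subst nn_integral_frame_lborel_affine[OF o, of 1 "s *\<^sub>R a"]) (auto intro: span_scale a)
    also have "\<dots> = (\<integral>\<^sup>+y. indicator {y. s\<^sup>2 * (norm ?q)\<^sup>2 + (norm y)\<^sup>2 \<le> R\<^sup>2 \<and> 0 \<le> R} y \<partial>frame_lborel {..<d} (gram_schmidt v))"
    proof (rule nn_integral_cong_AE, use AE_frame_lborel_span[OF o] in eventually_elim)
      case (elim y)
      have 1: "s *\<^sub>R z - (s *\<^sub>R a + y) = s *\<^sub>R ?q - y" by (simp add: scaleR_diff_right)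
      have 2: "(norm (s *\<^sub>R ?q - y))\<^sup>2 = s\<^sup>2 * (norm ?q)\<^sup>2 + (norm y)\<^sup>2"
        using dot_norm_neg[of "s *\<^sub>R ?q" y] q[OF elim]
        by (simp add: inner_commute power_mult_distrib)
      have 3: "norm u \<le> R \<longleftrightarrow> (norm u)\<^sup>2 \<le> R\<^sup>2 \<and> 0 \<le> R" for u :: 'a
        by (metis norm_ge_zero order_trans power2_le_imp_le power_mono)
      show ?case by (simp only: indicator_def mem_Collect_eq 1 3[of "s *\<^sub>R ?q - y"] 2)
    qed
    finally show ?thesis .
  qed
  then show ?thesis by blast
qed

lemma section_volume_decreasing:
  assumes "0 \<le> s" "s \<le> 1"
  shows "section_volume d R v z \<le> section_volume d R v (s *\<^sub>R z)"
proof -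
  obtain q :: 'a where q: "\<And>s. section_volume d R v (s *\<^sub>R z) = (\<integral>\<^sup>+y. indicator {y. s\<^sup>2 * (norm q)\<^sup>2 + (norm y)\<^sup>2 \<le> R\<^sup>2 \<and> 0 \<le> R} y \<partial>frame_lborel {..<d} (gram_schmidt v))"
    using section_volume_perp[of R z] by blast
  have "s\<^sup>2 * (norm q)\<^sup>2 \<le> 1 * (norm q)\<^sup>2"
    using assms by (intro mult_right_mono) (auto simp: power_le_one)
  then have "section_volume d R v (1 *\<^sub>R z) \<le> section_volume d R v (s *\<^sub>R z)"
    unfolding q by (intro nn_integral_mono) (auto simp: indicator_def)
  then show ?thesis by simp
qed

lemma section_volume_le:
  assumes "R > 0"
  shows "section_volume d R v z \<le> ennreal (unit_ball_vol d * R ^ d)"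
proof -
  have "section_volume d R v z \<le> section_volume d R v (0 *\<^sub>R z)"
    by (rule section_volume_decreasing) auto
  also have "\<dots> = (\<integral>\<^sup>+y. indicator (cball 0 R) y \<partial>frame_lborel {..<d} (gram_schmidt v))"
    unfolding section_volume_eq by (intro nn_integral_cong) (simp add: indicator_def)
  also have "\<dots> = emeasure (frame_lborel {..<d} (gram_schmidt v)) (cball 0 R)"
    by (rule nn_integral_indicator) simp
  also have "\<dots> = ennreal (unit_ball_vol d * R ^ d)"
    using emeasure_frame_lborel_cball[OF orthonormal_family_gram_schmidt[OF indep] assms] by simp
  finally show ?thesis .
qed

lemma nn_integral_section_volume_le:
  assumes "R > 0" "\<rho> > 0"
  shows "(\<integral>\<^sup>+z. indicator {z. norm z \<le> \<rho>} z * section_volume d R v z \<partial>lborel)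
    \<le> ennreal (unit_ball_vol d * (\<rho> + R) ^ d) * ennreal (unit_ball_vol DIM('a) * R ^ DIM('a))"
proof -
  note o = orthonormal_family_gram_schmidt[OF indep]
  interpret M: sigma_finite_measure "frame_lborel {..<d} (gram_schmidt v)" by (rule sigma_finite_frame_lborel[OF o])
  interpret P: pair_sigma_finite "frame_lborel {..<d} (gram_schmidt v)" "lborel :: 'a measure" ..
  have "(\<integral>\<^sup>+z. indicator {z. norm z \<le> \<rho>} z * section_volume d R v z \<partial>lborel)
      = (\<integral>\<^sup>+z. \<integral>\<^sup>+y. indicator {z. norm z \<le> \<rho>} z * indicator {u. norm u \<le> R} (z - y) \<partial>frame_lborel {..<d} (gram_schmidt v) \<partial>lborel)"
    unfolding section_volume_eq by (intro nn_integral_cong nn_integral_cmult[symmetric]) measurable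
  also have "\<dots> = (\<integral>\<^sup>+y. \<integral>\<^sup>+z. indicator {z. norm z \<le> \<rho>} z * indicator {u. norm u \<le> R} (z - y) \<partial>lborel \<partial>frame_lborel {..<d} (gram_schmidt v))"
    by (rule P.Fubini') measurable
  also have "\<dots> \<le> (\<integral>\<^sup>+y. \<integral>\<^sup>+z. indicator (cball 0 (\<rho> + R)) y * indicator (cball y R) z \<partial>lborel \<partial>frame_lborel {..<d} (gram_schmidt v))"
  proof (intro nn_integral_mono)
    fix y z :: 'a
    have "norm y \<le> norm z + norm (z - y)"
      by (metis norm_minus_commute norm_triangle_sub)
    then show "indicator {z. norm z \<le> \<rho>} z * indicator {u. norm u \<le> R} (z - y)
        \<le> indicator (cball 0 (\<rho> + R)) y * (indicator (cball y R) z :: ennreal)"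
      by (auto simp: indicator_def dist_norm norm_minus_commute)
  qed
  also have "\<dots> = (\<integral>\<^sup>+y. indicator (cball 0 (\<rho> + R)) y * ennreal (unit_ball_vol DIM('a) * R ^ DIM('a)) \<partial>frame_lborel {..<d} (gram_schmidt v))"
    using assms by (intro nn_integral_cong)
      (simp add: nn_integral_cmult emeasure_cball borel_measurable_indicator)
  also have "\<dots> = ennreal (unit_ball_vol d * (\<rho> + R) ^ d) * ennreal (unit_ball_vol DIM('a) * R ^ DIM('a))"
    using emeasure_frame_lborel_cball[OF o, of "\<rho> + R"] assms
    by (subst nn_integral_multc) (auto intro!: borel_measurable_indicator)
  finally show ?thesis .
qed

end

definition mean_section_volume :: "nat \<Rightarrow> real \<Rightarrow> 'a::euclidean_space \<Rightarrow> ennreal" where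
  "mean_section_volume d R z = (\<integral>\<^sup>+v. indicator (Collect (independent_frame d)) v * section_volume d R v z \<partial>frame_prob d)"

lemma measurable_mean_section_volume [measurable]: "mean_section_volume d R \<in> borel_measurable borel"
proof -
  interpret sigma_finite_measure "frame_prob d :: (nat \<Rightarrow> 'a) measure" by (rule sigma_finite_frame_prob)
  show ?thesis unfolding mean_section_volume_def[abs_def] by measurable
qed

lemma section_volume_orthogonal_transformation:
  assumes Q: "orthogonal_transformation Q"
  shows "section_volume d R (\<lambda>i\<in>{..<d}. Q (v i)) (Q z) = section_volume d R v z"
proof -
  have lin: "linear Q" by (rule orthogonal_transformation_linear[OF Q])
  have "lincomb {..<d} (gram_schmidt (\<lambda>i\<in>{..<d}. Q (v i))) t = Q (lincomb {..<d} (gram_schmidt v) t)" for t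
    unfolding lincomb_def linear_sum[OF lin] linear_scale[OF lin]
    by (intro sum.cong refl) (simp only: gram_schmidt_orthogonal_transformation[OF Q] lessThan_iff)
  then have "norm (Q z - lincomb {..<d} (gram_schmidt (\<lambda>i\<in>{..<d}. Q (v i))) t)
      = norm (z - lincomb {..<d} (gram_schmidt v) t)" for t
    by (simp only: orthogonal_transformation_norm[OF Q] linear_diff[OF lin, symmetric])
  then show ?thesis
    by (simp only: section_volume_def indicator_def mem_Collect_eq)
qed

lemma mean_section_volume_orthogonal_transformation:
  fixes Q :: "'a::euclidean_space \<Rightarrow> 'a"
  assumes Q: "orthogonal_transformation Q"
  shows "mean_section_volume d R (Q z) = mean_section_volume d R z"
proof -
  let ?F = "\<lambda>v. indicator (Collect (independent_frame d)) v * section_volume d R v (Q z)"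
  have indep: "independent_frame d (\<lambda>i\<in>{..<d}. Q (v i)) \<longleftrightarrow> independent_frame d v" for v
    unfolding independent_frame_def
    using orthogonal_transformation_norm[OF Q]
    by (simp only: gram_schmidt_orthogonal_transformation[OF Q] cong: conj_cong imp_cong) (metis norm_eq_zero)
  have "?F \<in> borel_measurable (frame_prob d)" by measurable
  from nn_integral_frame_prob_orthogonal_transformation[OF Q this]
  show ?thesis
    unfolding mean_section_volume_def
    by (simp only: section_volume_orthogonal_transformation[OF Q] indep indicator_def mem_Collect_eq)
qed

section \<open>The plane transform almost everywhere\<close>

context
  fixes d :: nat and R :: real
  assumes R: "1 \<le> R"
begin

lemma mean_section_volume_le_const:
  "mean_section_volume d R z \<le> ennreal (unit_ball_vol d * R ^ d)" for z :: "'a::euclidean_space"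
proof -
  have "mean_section_volume d R z \<le> (\<integral>\<^sup>+v. ennreal (unit_ball_vol d * R ^ d) \<partial>(frame_prob d :: (nat \<Rightarrow> 'a) measure))"
    unfolding mean_section_volume_def
    using section_volume_le[of d _ R z] R by (intro nn_integral_mono) (auto simp: indicator_def)
  also have "\<dots> = ennreal (unit_ball_vol d * R ^ d)"
    by (simp add: emeasure_frame_prob)
  finally show ?thesis .
qed

lemma mean_section_volume_antimono:
  fixes y z :: "real ^ 'n"
  assumes "norm y \<le> norm z"
  shows "mean_section_volume d R z \<le> mean_section_volume d R y"
proof (cases "z = 0")
  case False
  \<comment> \<open>Shrink \<open>z\<close> to the length of \<open>y\<close> and then rotate it to \<open>y\<close>.\<close>
  define s where "s = norm y / norm z"
  have s: "0 \<le> s" "s \<le> 1" using assms False by (auto simp: s_def divide_le_eq)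
  have "norm (s *\<^sub>R z) = norm y" using False by (simp add: s_def)
  then obtain Q where Q: "orthogonal_transformation Q" "Q (s *\<^sub>R z) = y"
    by (rule orthogonal_transformation_exists)
  have "mean_section_volume d R z \<le> mean_section_volume d R (s *\<^sub>R z)"
    unfolding mean_section_volume_def
    using section_volume_decreasing[OF _ s, of d _ R z] by (intro nn_integral_mono) (auto simp: indicator_def)
  also have "\<dots> = mean_section_volume d R y"
    using mean_section_volume_orthogonal_transformation[OF Q(1), of d R "s *\<^sub>R z"] Q(2) by simp
  finally show ?thesis .
qed (use assms in simp)

text \<open>The mean volume is a decreasing function of \<open>\<bar>z\<bar>\<close>, so it is bounded by its average over
  the ball of radius \<open>\<bar>z\<bar>\<close>; that average is computed by Fubini's theorem.\<close>

lemma mean_section_volume_average: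
  fixes z :: "real ^ 'n"
  assumes "z \<noteq> 0"
  shows "mean_section_volume d R z * ennreal (unit_ball_vol CARD('n) * norm z ^ CARD('n))
    \<le> ennreal (unit_ball_vol d * (norm z + R) ^ d) * ennreal (unit_ball_vol CARD('n) * R ^ CARD('n))"
    (is "_ \<le> ?B")
proof -
  let ?P = "frame_prob d :: (nat \<Rightarrow> real ^ 'n) measure" and ?I = "indicator {y. norm y \<le> norm z} :: real ^ 'n \<Rightarrow> ennreal"
  interpret P: sigma_finite_measure ?P by (rule sigma_finite_frame_prob)
  interpret PL: pair_sigma_finite ?P "lborel :: (real ^ 'n) measure" ..
  have "mean_section_volume d R z * ennreal (unit_ball_vol CARD('n) * norm z ^ CARD('n))
      = (\<integral>\<^sup>+y. mean_section_volume d R z * indicator (cball 0 (norm z)) (y :: real ^ 'n) \<partial>lborel)"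
    using emeasure_cball[of "norm z" "0 :: real ^ 'n"]
    by (subst nn_integral_cmult) (auto intro!: borel_measurable_indicator)
  also have "\<dots> \<le> (\<integral>\<^sup>+y. ?I y * mean_section_volume d R y \<partial>lborel)"
    using mean_section_volume_antimono by (intro nn_integral_mono) (auto simp: indicator_def)
  also have "\<dots> = (\<integral>\<^sup>+y. \<integral>\<^sup>+v. ?I y * (indicator (Collect (independent_frame d)) v * section_volume d R v y) \<partial>?P \<partial>lborel)"
    unfolding mean_section_volume_def by (intro nn_integral_cong nn_integral_cmult[symmetric]) measurable
  also have "\<dots> = (\<integral>\<^sup>+v. \<integral>\<^sup>+y. ?I y * (indicator (Collect (independent_frame d)) v * section_volume d R v y) \<partial>lborel \<partial>?P)"
    by (rule PL.Fubini') measurable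
  also have "\<dots> \<le> (\<integral>\<^sup>+v. ?B \<partial>?P)"
  proof (rule nn_integral_mono)
    fix v :: "nat \<Rightarrow> real ^ 'n"
    show "(\<integral>\<^sup>+y. ?I y * (indicator (Collect (independent_frame d)) v * section_volume d R v y) \<partial>lborel) \<le> ?B"
      using nn_integral_section_volume_le[of d v R "norm z"] R assms
      by (cases "independent_frame d v") simp_all
  qed
  also have "\<dots> = ?B" by (simp add: emeasure_frame_prob)
  finally show ?thesis .
qed

text \<open>For \<open>\<bar>z\<bar> \<le> R\<close> the volume of a ball of radius \<open>R\<close> is a sufficient bound, and for \<open>\<bar>z\<bar> > R\<close> the average
  over the ball of radius \<open>\<bar>z\<bar>\<close> is at most \<open>C \<bar>z\<bar>\<^bsup>d - n\<^esup>\<close>.\<close>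

lemma mean_section_volume_bound:
  assumes d: "d \<le> CARD('n)"
  obtains C where "\<And>z :: real ^ 'n. mean_section_volume d R z
    \<le> ennreal C * ennreal ((1 + (norm z)\<^sup>2) powr (- (real CARD('n) - real d) / 2))"
proof -
  define e where "e = (real CARD('n) - real d) / 2"
  have e: "0 \<le> e" "- (real CARD('n) - real d) / 2 = - e" using d by (auto simp: e_def field_simps)
  define A where "A = unit_ball_vol d * R ^ d * (1 + R\<^sup>2) powr e"
  define B where "B = unit_ball_vol d * (2 ^ d * R ^ CARD('n)) * 2 powr e"
  have A: "A \<ge> 0" and B: "B \<ge> 0" using R by (auto simp: A_def B_def)
  have "mean_section_volume d R z \<le> ennreal ((A + B) * (1 + (norm z)\<^sup>2) powr (- e))" for z :: "real ^ 'n"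
  proof (cases "norm z \<le> R")
    case True
    have "(norm z)\<^sup>2 \<le> R\<^sup>2" using True by (intro power_mono) auto
    then have "(1 + R\<^sup>2) powr (- e) \<le> (1 + (norm z)\<^sup>2) powr (- e)"
      using e by (intro powr_mono2') (auto simp: add_pos_nonneg)
    then have "A * (1 + R\<^sup>2) powr (- e) \<le> A * (1 + (norm z)\<^sup>2) powr (- e)"
      using A by (rule mult_left_mono)
    moreover have "A * (1 + R\<^sup>2) powr (- e) = unit_ball_vol d * R ^ d"
    proof -
      have "0 < 1 + R\<^sup>2" by (simp add: add_pos_nonneg)
      then show ?thesis by (simp add: A_def mult.assoc flip: powr_add)
    qed
    ultimately have "unit_ball_vol d * R ^ d \<le> (A + B) * (1 + (norm z)\<^sup>2) powr (- e)"
      using mult_nonneg_nonneg[OF B powr_ge_zero, of "1 + (norm z)\<^sup>2" "- e"] by (simp add: distrib_right)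
    with mean_section_volume_le_const[of z] show ?thesis
      by (meson ennreal_leI order_trans)
  next
    case False
    define \<rho> where "\<rho> = norm z"
    have \<rho>: "\<rho> > R" "\<rho> > 1" "\<rho> > 0" using False R by (auto simp: \<rho>_def)
    have "mean_section_volume d R z < top"
      using mean_section_volume_le_const[of z] by (rule le_less_trans) simp
    then obtain \<phi> where \<phi>: "\<phi> \<ge> 0" "mean_section_volume d R z = ennreal \<phi>"
      by (cases "mean_section_volume d R z") auto
    have vol: "unit_ball_vol CARD('n) > 0" by simp
    have "ennreal (\<phi> * (unit_ball_vol CARD('n) * \<rho> ^ CARD('n)))
        \<le> ennreal (unit_ball_vol d * (\<rho> + R) ^ d * (unit_ball_vol CARD('n) * R ^ CARD('n)))"
      using mean_section_volume_average[of z] \<phi> \<rho> R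
      by (subst (1 2) ennreal_mult) (auto simp: \<rho>_def)
    then have "\<phi> * (unit_ball_vol CARD('n) * \<rho> ^ CARD('n))
        \<le> unit_ball_vol d * (\<rho> + R) ^ d * (unit_ball_vol CARD('n) * R ^ CARD('n))"
      using \<rho> R by (subst (asm) ennreal_le_iff) auto
    then have "unit_ball_vol CARD('n) * (\<phi> * \<rho> ^ CARD('n))
        \<le> unit_ball_vol CARD('n) * (unit_ball_vol d * (\<rho> + R) ^ d * R ^ CARD('n))"
      by (simp only: mult_ac)
    then have "\<phi> * \<rho> ^ CARD('n) \<le> unit_ball_vol d * (\<rho> + R) ^ d * R ^ CARD('n)"
      using vol by (simp only: mult_le_cancel_left_pos)
    also have "\<dots> \<le> unit_ball_vol d * (2 * \<rho>) ^ d * R ^ CARD('n)"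
      using \<rho> R by (intro mult_right_mono mult_left_mono power_mono) auto
    also have "\<dots> = unit_ball_vol d * (2 ^ d * R ^ CARD('n)) * \<rho> ^ d"
      by (simp add: power_mult_distrib)
    finally have "\<phi> \<le> unit_ball_vol d * (2 ^ d * R ^ CARD('n)) * \<rho> ^ d / \<rho> ^ CARD('n)"
      using \<rho> by (simp add: pos_le_divide_eq)
    also have "\<dots> = unit_ball_vol d * (2 ^ d * R ^ CARD('n)) * (\<rho> ^ d / \<rho> ^ CARD('n))" by simp
    also have "\<rho> ^ d / \<rho> ^ CARD('n) = 2 powr e * (2 * \<rho>\<^sup>2) powr (- e)"
    proof -
      have "(2 * \<rho>\<^sup>2) powr (- e) = 2 powr (- e) * (\<rho> powr 2) powr (- e)"
        using \<rho> by (simp add: powr_mult powr_numeral)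
      also have "(\<rho> powr 2) powr (- e) = \<rho> powr (real d - real CARD('n))"
      proof -
        have "2 * e = real CARD('n) - real d" by (simp add: e_def)
        then have "2 * - e = real d - real CARD('n)" by linarith
        then show ?thesis unfolding powr_powr by simp
      qed
      also have "\<dots> = \<rho> ^ d / \<rho> ^ CARD('n)"
        unfolding powr_diff using \<rho> by (simp add: powr_realpow)
      finally have "2 powr e * (2 * \<rho>\<^sup>2) powr (- e) = (2 powr e * 2 powr (- e)) * (\<rho> ^ d / \<rho> ^ CARD('n))"
        by (simp only: mult.assoc)
      then show ?thesis by (simp flip: powr_add)
    qed
    also have "unit_ball_vol d * (2 ^ d * R ^ CARD('n)) * (2 powr e * (2 * \<rho>\<^sup>2) powr (- e)) = B * (2 * \<rho>\<^sup>2) powr (- e)"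
      by (simp add: B_def)
    also have "\<dots> \<le> B * (1 + \<rho>\<^sup>2) powr (- e)"
    proof (intro mult_left_mono B powr_mono2')
      have "1 \<le> \<rho>\<^sup>2" using \<rho> by simp
      then show "1 + \<rho>\<^sup>2 \<le> 2 * \<rho>\<^sup>2" by simp
    qed (use e in \<open>auto simp: add_pos_nonneg\<close>)
    also have "\<dots> \<le> (A + B) * (1 + \<rho>\<^sup>2) powr (- e)"
      using A by (simp add: distrib_right)
    finally show ?thesis unfolding \<phi> \<rho>_def by (rule ennreal_leI)
  qed
  then have "mean_section_volume d R z \<le> ennreal (A + B) * ennreal ((1 + (norm z)\<^sup>2) powr (- (real CARD('n) - real d) / 2))"
    for z :: "real ^ 'n"
    unfolding e(2) using A B by (simp add: ennreal_mult)
  then show ?thesis by (rule that)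
qed

end

lemma measurable_section_volume_fixed_frame [measurable]:
  "section_volume d R v \<in> borel_measurable borel"
proof -
  interpret sigma_finite_measure "Pi\<^sub>M {..<d} (\<lambda>_. lborel :: real measure)"
    by (rule sigma_finite_PiM_lborel) simp
  show ?thesis unfolding section_volume_def[abs_def] by measurable
qed

lemma nn_integral_lborel_shift:
  fixes a :: "'a::euclidean_space"
  assumes "h \<in> borel_measurable borel"
  shows "(\<integral>\<^sup>+x. h (a + x) \<partial>lborel) = (\<integral>\<^sup>+x. h x \<partial>lborel)"
  using nn_integral_subspace_lborel_affine[OF subspace_UNIV, of 1 a h] assms
  by (simp add: subspace_lborel_UNIV)

text \<open>For a fixed point \<open>u\<close> of the subspace, the translation \<open>z = x + u\<close> moves the condition \<open>\<bar>x\<bar> \<le> R\<close> to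
  \<open>\<bar>z - u\<bar> \<le> R\<close>; the rest is Fubini's theorem.\<close>

lemma nn_integral_planes:
  fixes h :: "'a::euclidean_space \<Rightarrow> ennreal"
  assumes [measurable]: "h \<in> borel_measurable borel"
  shows "(\<integral>\<^sup>+v. \<integral>\<^sup>+x. indicator (Collect (independent_frame d)) v * (indicator {x. norm x \<le> R} x *
      (\<integral>\<^sup>+t. h (x + lincomb {..<d} (gram_schmidt v) t) \<partial>Pi\<^sub>M {..<d} (\<lambda>_. lborel))) \<partial>lborel \<partial>frame_prob d)
    = (\<integral>\<^sup>+z. h z * mean_section_volume d R z \<partial>lborel)"
proof -
  let ?P = "frame_prob d :: (nat \<Rightarrow> 'a) measure" and ?L = "Pi\<^sub>M {..<d} (\<lambda>_. lborel :: real measure)"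
  let ?I = "indicator {x. norm x \<le> R} :: 'a \<Rightarrow> ennreal"
  interpret P: sigma_finite_measure ?P by (rule sigma_finite_frame_prob)
  interpret PL: pair_sigma_finite ?P "lborel :: 'a measure" ..
  interpret L: sigma_finite_measure ?L by (rule sigma_finite_PiM_lborel) simp
  interpret LL: pair_sigma_finite ?L "lborel :: 'a measure" ..
  have inner: "(\<integral>\<^sup>+x. ?I x * (\<integral>\<^sup>+t. h (x + lincomb {..<d} (gram_schmidt v) t) \<partial>?L) \<partial>lborel)
      = (\<integral>\<^sup>+z. h z * section_volume d R v z \<partial>lborel)" for v :: "nat \<Rightarrow> 'a"
  proof -
    let ?l = "lincomb {..<d} (gram_schmidt v)"
    have "(\<integral>\<^sup>+x. ?I x * (\<integral>\<^sup>+t. h (x + ?l t) \<partial>?L) \<partial>lborel) = (\<integral>\<^sup>+x. \<integral>\<^sup>+t. ?I x * h (x + ?l t) \<partial>?L \<partial>lborel)"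
      by (intro nn_integral_cong nn_integral_cmult[symmetric]) measurable
    also have "\<dots> = (\<integral>\<^sup>+t. \<integral>\<^sup>+x. ?I x * h (x + ?l t) \<partial>lborel \<partial>?L)"
      by (rule LL.Fubini') measurable
    also have "\<dots> = (\<integral>\<^sup>+t. \<integral>\<^sup>+z. h z * ?I (z - ?l t) \<partial>lborel \<partial>?L)"
    proof (rule nn_integral_cong)
      fix t
      show "(\<integral>\<^sup>+x. ?I x * h (x + ?l t) \<partial>lborel) = (\<integral>\<^sup>+z. h z * ?I (z - ?l t) \<partial>lborel)"
        by (subst nn_integral_lborel_shift[where a = "?l t", symmetric]) (auto simp: mult.commute add.commute)
    qed
    also have "\<dots> = (\<integral>\<^sup>+z. \<integral>\<^sup>+t. h z * ?I (z - ?l t) \<partial>?L \<partial>lborel)"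
      by (rule LL.Fubini'[symmetric]) measurable
    also have "\<dots> = (\<integral>\<^sup>+z. h z * section_volume d R v z \<partial>lborel)"
      unfolding section_volume_def by (intro nn_integral_cong nn_integral_cmult) measurable
    finally show ?thesis .
  qed
  have "(\<integral>\<^sup>+v. \<integral>\<^sup>+x. indicator (Collect (independent_frame d)) v * (?I x *
      (\<integral>\<^sup>+t. h (x + lincomb {..<d} (gram_schmidt v) t) \<partial>?L)) \<partial>lborel \<partial>?P)
    = (\<integral>\<^sup>+v. indicator (Collect (independent_frame d)) v * (\<integral>\<^sup>+z. h z * section_volume d R v z \<partial>lborel) \<partial>?P)"
    unfolding inner[symmetric] by (intro nn_integral_cong nn_integral_cmult) measurable
  also have "\<dots> = (\<integral>\<^sup>+v. \<integral>\<^sup>+z. h z * (indicator (Collect (independent_frame d)) v * section_volume d R v z) \<partial>lborel \<partial>?P)"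
    by (subst nn_integral_cmult[symmetric]) (auto intro!: nn_integral_cong simp: mult_ac)
  also have "\<dots> = (\<integral>\<^sup>+z. \<integral>\<^sup>+v. h z * (indicator (Collect (independent_frame d)) v * section_volume d R v z) \<partial>?P \<partial>lborel)"
    by (rule PL.Fubini'[symmetric]) measurable
  also have "\<dots> = (\<integral>\<^sup>+z. h z * mean_section_volume d R z \<partial>lborel)"
    unfolding mean_section_volume_def by (intro nn_integral_cong nn_integral_cmult) measurable
  finally show ?thesis .
qed

text \<open>Each plane meets one of countably many balls, and for each ball the mean over the planes \<open>x + V\<close>
  with \<open>x\<close> in the ball is finite.\<close>

lemma AE_plane_integral_finite:
  fixes h :: "real ^ 'n \<Rightarrow> ennreal"
  assumes [measurable]: "h \<in> borel_measurable borel" and d: "d \<le> CARD('n)"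
    and fin: "(\<integral>\<^sup>+z. h z * ennreal ((1 + (norm z)\<^sup>2) powr (- (real CARD('n) - real d) / 2)) \<partial>lborel) < \<infinity>"
  shows "AE (v, x) in frame_prob d \<Otimes>\<^sub>M lborel. independent_frame d v \<longrightarrow>
    (\<integral>\<^sup>+t. h (x + lincomb {..<d} (gram_schmidt v) t) \<partial>Pi\<^sub>M {..<d} (\<lambda>_. lborel)) < \<infinity>"
proof -
  let ?P = "frame_prob d :: (nat \<Rightarrow> real ^ 'n) measure" and ?L = "Pi\<^sub>M {..<d} (\<lambda>_. lborel :: real measure)"
  let ?\<omega> = "\<lambda>z :: real ^ 'n. (1 + (norm z)\<^sup>2) powr (- (real CARD('n) - real d) / 2)"
  interpret L: sigma_finite_measure ?L by (rule sigma_finite_PiM_lborel) simp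
  \<comment> \<open>The radius \<open>m + 1\<close> instead of \<open>m\<close>, because the bound on the mean volume is for radii at least 1.\<close>
  define F where "F m v x = indicator (Collect (independent_frame d)) v * (indicator {x. norm x \<le> real (Suc m)} x *
      (\<integral>\<^sup>+t. h (x + lincomb {..<d} (gram_schmidt v) t) \<partial>?L))" for m :: nat and v x
  have [measurable]: "(\<lambda>p. F m (fst p) (snd p)) \<in> borel_measurable (?P \<Otimes>\<^sub>M lborel)" for m
    unfolding F_def by measurable
  have "AE p in ?P \<Otimes>\<^sub>M lborel. F m (fst p) (snd p) \<noteq> \<infinity>" for m
  proof (rule nn_integral_PInf_AE)
    obtain C where C: "\<And>z :: real ^ 'n. mean_section_volume d (real (Suc m)) z \<le> ennreal C * ennreal (?\<omega> z)"
      using mean_section_volume_bound[of "real (Suc m)" d, OF _ d] by auto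
    have "(\<integral>\<^sup>+p. F m (fst p) (snd p) \<partial>(?P \<Otimes>\<^sub>M lborel)) = (\<integral>\<^sup>+v. \<integral>\<^sup>+x. F m v x \<partial>lborel \<partial>?P)"
      by (subst lborel.nn_integral_fst[symmetric]) auto
    also have "\<dots> = (\<integral>\<^sup>+z. h z * mean_section_volume d (real (Suc m)) z \<partial>lborel)"
      unfolding F_def by (rule nn_integral_planes) measurable
    also have "\<dots> \<le> (\<integral>\<^sup>+z. ennreal C * (h z * ennreal (?\<omega> z)) \<partial>lborel)"
      using C by (intro nn_integral_mono) (metis mult.left_commute mult_left_mono zero_le)
    also have "\<dots> = ennreal C * (\<integral>\<^sup>+z. h z * ennreal (?\<omega> z) \<partial>lborel)"
      by (rule nn_integral_cmult) measurable
    also have "\<dots> < \<infinity>"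
      using fin by (simp add: ennreal_mult_less_top)
    finally show "(\<integral>\<^sup>+p. F m (fst p) (snd p) \<partial>(?P \<Otimes>\<^sub>M lborel)) \<noteq> \<infinity>" by simp
  qed measurable
  then have "AE p in ?P \<Otimes>\<^sub>M lborel. \<forall>m. F m (fst p) (snd p) \<noteq> \<infinity>"
    unfolding AE_all_countable by blast
  then show ?thesis
  proof eventually_elim
    case (elim p)
    obtain v x where p: "p = (v, x)" by (cases p)
    obtain m :: nat where "norm x \<le> real m" using real_arch_simple by blast
    then have "norm x \<le> real (Suc m)" by simp
    with elim[rule_format, of m] show ?case
      by (auto simp: p F_def less_top)
  qed
qed

section \<open>Finiteness on almost all slices\<close>

lemma completion_ex_borel_measurable_euclidean:
  fixes g :: "'z \<Rightarrow> 'b::euclidean_space"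
  assumes "g \<in> borel_measurable (completion M)"
  obtains g' where "g' \<in> borel_measurable M" "AE x in M. g x = g' x"
proof -
  have "\<exists>g'. g' \<in> borel_measurable M \<and> (AE x in M. g x \<bullet> b = g' x)" for b
    using completion_ex_borel_measurable_real[of "\<lambda>x. g x \<bullet> b" M] assms by auto
  then obtain c where c: "\<And>b. c b \<in> borel_measurable M" "\<And>b. AE x in M. g x \<bullet> b = c b x"
    by metis
  have "AE x in M. \<forall>b\<in>Basis. g x \<bullet> b = c b x"
    using c(2) by (intro AE_finite_allI) auto
  then have "AE x in M. g x = (\<Sum>b\<in>Basis. c b x *\<^sub>R b)"
  proof eventually_elim
    case (elim x)
    have "g x = (\<Sum>b\<in>Basis. (g x \<bullet> b) *\<^sub>R b)" by (simp add: euclidean_representation)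
    also have "\<dots> = (\<Sum>b\<in>Basis. c b x *\<^sub>R b)" using elim by (intro sum.cong) auto
    finally show ?case .
  qed
  moreover have "(\<lambda>x. \<Sum>b\<in>Basis. c b x *\<^sub>R b) \<in> borel_measurable M"
    using c(1) by measurable
  ultimately show ?thesis by (intro that)
qed

lemma borel_measurable_completion_AE:
  assumes f': "f' \<in> borel_measurable M" and eq: "AE x in M. f x = f' x"
  shows "f \<in> borel_measurable (completion M)"
proof (rule measurableI)
  fix A :: "'b set" assume A: "A \<in> sets borel"
  show "f -` A \<inter> space (completion M) \<in> sets (completion M)"
  proof (rule completion.in_sets_AE)
    show "AE x in completion M. x \<in> f' -` A \<inter> space M \<longleftrightarrow> x \<in> f -` A \<inter> space (completion M)"
      using AE_completion[OF eq] by eventually_elim auto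
    show "f' -` A \<inter> space M \<in> sets (completion M)"
      using measurable_sets[OF f' A] by simp
  qed simp
qed simp

lemma sphere_measure_representative:
  fixes f :: "'a::euclidean_space \<Rightarrow> 'b::euclidean_space"
  assumes "f \<in> borel_measurable sphere_measure"
  obtains f' N where "f' \<in> borel_measurable borel" "N \<in> sets borel" "N \<in> null_sets (unit_sphere_measure UNIV)"
    "\<And>x. x \<in> sphere 0 1 \<Longrightarrow> x \<notin> N \<Longrightarrow> f x = f' x"
proof -
  let ?M = "unit_sphere_measure UNIV :: 'a measure"
  obtain g where g: "g \<in> borel_measurable ?M" "AE x in ?M. f x = g x"
    using assms completion_ex_borel_measurable_euclidean unfolding sphere_measure_def by blast
  obtain N where N: "N \<in> null_sets ?M" "{x \<in> space ?M. f x \<noteq> g x} \<subseteq> N"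
    using g(2) unfolding eventually_ae_filter by auto
  have "g \<in> borel_measurable (restrict_space borel (sphere 0 1))"
    using g(1) by (subst (asm) measurable_cong_sets[OF sets_unit_sphere_measure refl]) simp
  then have "(\<lambda>x. indicator (sphere 0 1) x *\<^sub>R g x) \<in> borel_measurable borel"
    by (subst (asm) borel_measurable_restrict_space_iff) auto
  moreover have "N \<in> sets borel"
    using N(1) by (auto simp: null_sets_def sets_restrict_space_iff)
  moreover have "f x = indicator (sphere 0 1) x *\<^sub>R g x" if "x \<in> sphere 0 1" "x \<notin> N" for x
    using N(2) that by auto
  ultimately show ?thesis using N(1) by (intro that)
qed

lemma emeasure_sphere_borel_null:
  assumes "N \<in> sets borel" "N \<in> null_sets (unit_sphere_measure V)"
  shows "emeasure (sphere_borel V) N = 0"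
proof -
  have "emeasure (sphere_borel V) N = (\<integral>\<^sup>+x. indicator N x \<partial>unit_sphere_measure V)"
    using assms by (subst nn_integral_unit_sphere_measure) (auto intro!: borel_measurable_indicator)
  also have "\<dots> = emeasure (unit_sphere_measure V) N"
    using assms by (intro nn_integral_indicator) auto
  finally show ?thesis using assms by auto
qed

lemma slice_cap_integral_eq:
  fixes f :: "'a::euclidean_space \<times> real \<Rightarrow> 'b::euclidean_space"
  assumes [measurable]: "f' \<in> borel_measurable borel" and N: "N \<in> null_sets (unit_sphere_measure UNIV)"
    and eq: "\<And>x. x \<in> sphere 0 1 \<Longrightarrow> x \<notin> N \<Longrightarrow> f x = f' x"
  shows "slice_cap_integral k f \<epsilon> = (\<integral>\<^sup>+\<eta>. indicator {\<eta>. snd \<eta> > 1 - \<epsilon>} \<eta> *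
      ennreal (norm (f' \<eta>) / (1 - snd \<eta>) powr ((real DIM('a) + 1 - real k) / 2)) \<partial>sphere_borel UNIV)"
proof -
  note [measurable] = measurable_snd_borel
  have "slice_cap_integral k f \<epsilon> = (\<integral>\<^sup>+\<eta>. indicator {\<eta>. snd \<eta> > 1 - \<epsilon>} \<eta> *
      ennreal (norm (f' \<eta>) / (1 - snd \<eta>) powr ((real DIM('a) + 1 - real k) / 2)) \<partial>unit_sphere_measure UNIV)"
    unfolding slice_cap_integral_def sphere_measure_def nn_integral_completion
  proof (rule nn_integral_cong_AE)
    show "AE \<eta> in unit_sphere_measure UNIV.
        ennreal (norm (f \<eta>) / (1 - snd \<eta>) powr ((real DIM('a) + 1 - real k) / 2)) * indicator {\<eta>. snd \<eta> > 1 - \<epsilon>} \<eta>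
      = indicator {\<eta>. snd \<eta> > 1 - \<epsilon>} \<eta> * ennreal (norm (f' \<eta>) / (1 - snd \<eta>) powr ((real DIM('a) + 1 - real k) / 2))"
      using AE_not_in[OF N] AE_space by eventually_elim (simp add: eq mult.commute)
  qed
  also have "\<dots> = (\<integral>\<^sup>+\<eta>. indicator {\<eta>. snd \<eta> > 1 - \<epsilon>} \<eta> *
      ennreal (norm (f' \<eta>) / (1 - snd \<eta>) powr ((real DIM('a) + 1 - real k) / 2)) \<partial>sphere_borel UNIV)"
  proof (rule nn_integral_unit_sphere_measure)
    have [measurable]: "(\<lambda>\<eta>::'a \<times> real. (1 - snd \<eta>) powr ((real DIM('a) + 1 - real k) / 2)) \<in> borel_measurable borel"
      by (intro powr_real_measurable borel_measurable_diff measurable_snd_borel) auto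
    have [measurable]: "{\<eta>::'a \<times> real. snd \<eta> > 1 - \<epsilon>} \<in> sets borel"
      using measurable_sets[OF measurable_snd_borel, of "{1 - \<epsilon><..}"] by (simp add: vimage_def greaterThan_def)
    show "(\<lambda>\<eta>. indicator {\<eta>. snd \<eta> > 1 - \<epsilon>} \<eta> *
        ennreal (norm (f' \<eta>) / (1 - snd \<eta>) powr ((real DIM('a) + 1 - real k) / 2))) \<in> borel_measurable borel"
      by (intro borel_measurable_times_ennreal borel_measurable_indicator measurable_compose[OF _ measurable_ennreal]
          borel_measurable_divide) measurable
  qed
  finally show ?thesis .
qed

text \<open>The growth condition is the condition for the density \<open>h\<close> of the slice transform in stereographic
  coordinates to be integrable against the weight of the plane transform.\<close>

lemma nn_integral_plane_weight:
  fixes g :: "'a::euclidean_space \<times> real \<Rightarrow> ennreal"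
  assumes g [measurable]: "g \<in> borel_measurable borel" and d: "d \<le> DIM('a)"
  shows "(\<integral>\<^sup>+z. (ennreal ((2 / (1 + (norm z)\<^sup>2)) ^ d) * g (stereo z)) *
        ennreal ((1 + (norm z)\<^sup>2) powr (- (real DIM('a) - real d) / 2)) \<partial>lborel)
    = ennreal (2 powr (- (real DIM('a) - real d) / 2)) *
      (\<integral>\<^sup>+\<eta>. g \<eta> * ennreal (1 / (1 - snd \<eta>) powr ((real DIM('a) - real d) / 2)) \<partial>sphere_borel UNIV)"
proof -
  define e where "e = (real DIM('a) - real d) / 2"
  have e: "- (real DIM('a) - real d) / 2 = - e" by (simp add: e_def field_simps)
  have [measurable]: "(\<lambda>\<eta>::'a \<times> real. (1 - snd \<eta>) powr e) \<in> borel_measurable borel"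
    by (intro powr_real_measurable borel_measurable_diff measurable_snd_borel) auto
  have w: "ennreal ((2 / q) ^ d) * ennreal (q powr (- e))
      = ennreal (2 powr (- e)) * (ennreal ((2 / q) ^ DIM('a)) * ennreal (1 / (2 / q) powr e))"
    if q: "q > 0" for q :: real
  proof -
    have "(2 / q) ^ DIM('a) * (1 / (2 / q) powr e) = (2 / q) powr (real DIM('a) - e)"
      unfolding powr_diff using q by (simp add: powr_realpow)
    also have "real DIM('a) - e = real d + e" by (simp add: e_def field_simps)
    also have "(2 / q) powr (real d + e) = (2 / q) ^ d * (2 powr e * q powr (- e))"
      using q by (simp add: powr_add powr_realpow powr_divide powr_minus_divide power_divide)
    finally have "2 powr (- e) * ((2 / q) ^ DIM('a) * (1 / (2 / q) powr e)) = (2 powr (- e) * 2 powr e) * ((2 / q) ^ d * q powr (- e))"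
      by (simp only: mult_ac)
    then have "2 powr (- e) * ((2 / q) ^ DIM('a) * (1 / (2 / q) powr e)) = (2 / q) ^ d * q powr (- e)"
      by (simp flip: powr_add)
    then show ?thesis using q by (simp flip: ennreal_mult)
  qed
  have "(\<integral>\<^sup>+\<eta>. g \<eta> * ennreal (1 / (1 - snd \<eta>) powr e) \<partial>sphere_borel UNIV)
      = (\<integral>\<^sup>+x. ennreal ((2 / (1 + (norm x)\<^sup>2)) ^ DIM('a)) * (g (stereo x) * ennreal (1 / (1 - snd (stereo x)) powr e)) \<partial>lborel)"
    by (rule nn_integral_sphere_stereo) measurable
  then have "ennreal (2 powr (- e)) * (\<integral>\<^sup>+\<eta>. g \<eta> * ennreal (1 / (1 - snd \<eta>) powr e) \<partial>sphere_borel UNIV)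
      = (\<integral>\<^sup>+x. ennreal (2 powr (- e)) * (ennreal ((2 / (1 + (norm x)\<^sup>2)) ^ DIM('a)) * (g (stereo x) * ennreal (1 / (1 - snd (stereo x)) powr e))) \<partial>lborel)"
    unfolding snd_stereo by (subst nn_integral_cmult) auto
  also have "\<dots> = (\<integral>\<^sup>+z. (ennreal ((2 / (1 + (norm z)\<^sup>2)) ^ d) * g (stereo z)) * ennreal ((1 + (norm z)\<^sup>2) powr (- e)) \<partial>lborel)"
  proof (rule nn_integral_cong)
    fix x :: 'a
    have "0 < 1 + (norm x)\<^sup>2" by (simp add: add_pos_nonneg)
    note w = w[OF this]
    have "(ennreal ((2 / (1 + (norm x)\<^sup>2)) ^ d) * g (stereo x)) * ennreal ((1 + (norm x)\<^sup>2) powr (- e))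
        = (ennreal ((2 / (1 + (norm x)\<^sup>2)) ^ d) * ennreal ((1 + (norm x)\<^sup>2) powr (- e))) * g (stereo x)"
      by (simp only: mult_ac)
    also have "\<dots> = ennreal (2 powr (- e)) * (ennreal ((2 / (1 + (norm x)\<^sup>2)) ^ DIM('a)) * (g (stereo x) * ennreal (1 / (1 - snd (stereo x)) powr e)))"
      unfolding w by (simp add: snd_stereo mult_ac)
    finally show "ennreal (2 powr (- e)) * (ennreal ((2 / (1 + (norm x)\<^sup>2)) ^ DIM('a)) * (g (stereo x) * ennreal (1 / (1 - snd (stereo x)) powr e)))
      = (ennreal ((2 / (1 + (norm x)\<^sup>2)) ^ d) * g (stereo x)) * ennreal ((1 + (norm x)\<^sup>2) powr (- e))" ..
  qed
  finally show ?thesis unfolding e by (simp add: e_def)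
qed

lemma AE_sphere_borel_not_south_pole: "AE \<eta> in sphere_borel (UNIV :: ('a::euclidean_space \<times> real) set). snd \<eta> > - 1"
proof -
  have [measurable]: "{\<eta>::'a \<times> real. \<not> snd \<eta> > - 1} \<in> sets borel"
    using measurable_sets[OF measurable_snd_borel, of "{..- 1}"] by (simp add: vimage_def atMost_def not_less)
  have "emeasure (sphere_borel UNIV) {\<eta>::'a \<times> real. \<not> snd \<eta> > - 1}
      = (\<integral>\<^sup>+\<eta>. indicator {\<eta>::'a \<times> real. \<not> snd \<eta> > - 1} \<eta> \<partial>sphere_borel UNIV)"
    by simp
  also have "\<dots> = (\<integral>\<^sup>+x. ennreal ((2 / (1 + (norm x)\<^sup>2)) ^ DIM('a)) * indicator {\<eta>. \<not> snd \<eta> > - 1} (stereo (x :: 'a)) \<partial>lborel)"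
    by (rule nn_integral_sphere_stereo) (auto intro!: borel_measurable_indicator)
  also have "\<dots> = (\<integral>\<^sup>+x. 0 \<partial>(lborel :: 'a measure))"
  proof (rule nn_integral_cong_AE)
    show "AE x::'a in lborel. ennreal ((2 / (1 + (norm x)\<^sup>2)) ^ DIM('a)) * indicator {\<eta>. \<not> snd \<eta> > - 1} (stereo x) = 0"
      using AE_lborel_singleton[of 0]
    proof eventually_elim
      case (elim x)
      then have 1: "1 < 1 + (norm x)\<^sup>2" by simp
      then have "0 < 1 + (norm x)\<^sup>2" by linarith
      with 1 have "2 / (1 + (norm x)\<^sup>2) < 2" by (simp only: pos_divide_less_eq) simp
      then have "snd (stereo x) > - 1" by (simp add: snd_stereo)
      then show ?case by simp
    qed
  qed
  finally show ?thesis by (intro AE_I'[of "{\<eta>. \<not> snd \<eta> > - 1}"]) (auto intro!: null_setsI)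
qed

text \<open>The value \<open>\<infinity>\<close> on \<open>N\<close> forces \<open>N\<close> to be a null set of the slice, so that \<open>f\<close> agrees there almost everywhere
  with a Borel function and is measurable for the completed measure.\<close>

lemma (in slice_plane) slice_transform_finite_dominated:
  fixes f :: "'a \<times> real \<Rightarrow> 'b::euclidean_space"
  assumes f': "f' \<in> borel_measurable borel" and N: "N \<in> sets borel"
    and eq: "\<And>x. x \<in> sphere 0 1 \<Longrightarrow> x \<notin> N \<Longrightarrow> f x = f' x"
    and fin: "slice_transform (\<lambda>\<eta>. ennreal (norm (f' \<eta>)) + top * indicator N \<eta>) \<tau> < \<infinity>"
  shows "slice_transform_finite f \<tau>"
proof -
  let ?g = "\<lambda>\<eta>. ennreal (norm (f' \<eta>)) + top * indicator N \<eta>"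
  have g: "?g \<in> borel_measurable slice_measure"
    using f' N by (intro measurable_slice_measure borel_measurable_add borel_measurable_times_ennreal
        borel_measurable_indicator measurable_compose[OF _ measurable_ennreal] borel_measurable_norm) auto
  have "AE \<eta> in slice_measure. ?g \<eta> \<noteq> \<infinity>"
    using fin by (intro nn_integral_PInf_AE g) (simp add: slice_transform_eq)
  then have ae: "AE \<eta> in slice_measure. f \<eta> = f' \<eta>"
    using AE_space
  proof eventually_elim
    case (elim \<eta>)
    have "\<eta> \<notin> N"
    proof
      assume "\<eta> \<in> N"
      then have "?g \<eta> = \<infinity>" by simp
      with elim(1) show False by simp
    qed
    then show ?case using elim(2) eq[of \<eta>] by simp
  qed
  have "slice_transform (\<lambda>\<eta>. ennreal (norm (f \<eta>))) \<tau> \<le> slice_transform ?g \<tau>"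
    unfolding slice_transform_eq
    by (rule nn_integral_mono_AE) (use ae in eventually_elim, auto)
  with fin have "slice_transform (\<lambda>\<eta>. ennreal (norm (f \<eta>))) \<tau> < \<infinity>" by (rule order_le_less_trans[rotated])
  moreover have "f \<in> borel_measurable (subsphere_measure \<tau>)"
    unfolding subsphere_measure_eq
    by (rule borel_measurable_completion_AE[OF measurable_slice_measure[OF f'] ae])
  ultimately show ?thesis by (simp add: slice_transform_finite_def)
qed


text \<open>The projection is thus a measurable function of the frame, and so the domain of the parametrisation of
  the planes is measurable.\<close>

lemma closest_point_span_gram_schmidt:
  assumes "independent_frame d v"
  shows "closest_point (span (v ` {..<d})) x = lincomb {..<d} (gram_schmidt v) (\<lambda>i. x \<bullet> gram_schmidt v i)"
    (is "_ = ?a")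
proof (rule closest_point_unique[symmetric])
  let ?V = "span (v ` {..<d})" and ?e = "gram_schmidt v"
  note o = orthonormal_family_gram_schmidt[OF assms]
  show a: "?a \<in> ?V"
    using lincomb_in_span[OF o] by (simp add: span_gram_schmidt)
  show "convex ?V" by (simp add: subspace_imp_convex)
  show "closed ?V" by (simp add: closed_subspace)
  have "?e i \<bullet> (x - ?a) = 0" if "i \<in> {..<d}" for i
    using lincomb_inner[OF o that, of "\<lambda>i. x \<bullet> ?e i"] by (simp add: inner_diff_right inner_commute)
  note e0 = this
  have perp: "orthogonal (x - ?a) y" if "y \<in> ?V" for y
  proof (rule orthogonal_to_span)
    show "y \<in> span (?e ` {..<d})" using that by (simp only: span_gram_schmidt)
    fix u assume "u \<in> ?e ` {..<d}"
    then obtain i where "i \<in> {..<d}" "u = ?e i" by blast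
    then show "orthogonal (x - ?a) u"
      using e0[of i] by (simp only: orthogonal_def inner_commute[of "x - ?a"])
  qed
  show "\<forall>z\<in>?V. dist x ?a \<le> dist x z"
  proof
    fix z assume "z \<in> ?V"
    then have "orthogonal (x - ?a) (?a - z)" by (intro perp span_diff a)
    then have "(norm ((x - ?a) + (?a - z)))\<^sup>2 = (norm (x - ?a))\<^sup>2 + (norm (?a - z))\<^sup>2"
      by (rule norm_add_Pythagorean)
    then have "(norm (x - ?a))\<^sup>2 \<le> (norm (x - z))\<^sup>2" by simp
    then show "dist x ?a \<le> dist x z" unfolding dist_norm by (rule power2_le_imp_le) simp
  qed
qed

definition frame_domain :: "nat \<Rightarrow> ((nat \<Rightarrow> 'a::euclidean_space) \<times> 'a) set" where
  "frame_domain d = {(v, x). dim (v ` {..<d}) = d \<and> norm (closest_point (span (v ` {..<d})) x) \<le> 1}"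

lemma frame_space_eq: "frame_space d = restrict_space (frame_prob d \<Otimes>\<^sub>M lborel) (frame_domain d)"
  by (simp add: frame_space_def frame_prob_def frame_domain_def)

lemma measurable_frame_projection:
  "(\<lambda>p :: (nat \<Rightarrow> 'a::euclidean_space) \<times> 'a. lincomb {..<d} (gram_schmidt (fst p)) (\<lambda>i. snd p \<bullet> gram_schmidt (fst p) i))
    \<in> frame_prob d \<Otimes>\<^sub>M lborel \<rightarrow>\<^sub>M borel"
  unfolding lincomb_def
proof (rule borel_measurable_sum)
  fix i assume "i \<in> {..<d}"
  then have [measurable]: "(\<lambda>p :: (nat \<Rightarrow> 'a) \<times> 'a. gram_schmidt (fst p) i) \<in> frame_prob d \<Otimes>\<^sub>M lborel \<rightarrow>\<^sub>M borel"
    by (intro measurable_compose[OF measurable_fst] measurable_gram_schmidt_frame_prob) simp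
  show "(\<lambda>p :: (nat \<Rightarrow> 'a) \<times> 'a. (snd p \<bullet> gram_schmidt (fst p) i) *\<^sub>R gram_schmidt (fst p) i)
      \<in> borel_measurable (frame_prob d \<Otimes>\<^sub>M lborel)"
    by measurable
qed

lemma frame_domain_measurable:
  "frame_domain d \<inter> space (frame_prob d \<Otimes>\<^sub>M lborel) \<in> sets (frame_prob d \<Otimes>\<^sub>M (lborel :: 'a::euclidean_space measure))"
proof -
  note measurable_frame_projection[measurable]
  have "frame_domain d \<inter> space (frame_prob d \<Otimes>\<^sub>M lborel)
      = {p \<in> space (frame_prob d \<Otimes>\<^sub>M (lborel :: 'a measure)). independent_frame d (fst p) \<and>
          norm (lincomb {..<d} (gram_schmidt (fst p)) (\<lambda>i. snd p \<bullet> gram_schmidt (fst p) i)) \<le> 1}"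
    by (auto simp: frame_domain_def independent_frame_iff closest_point_span_gram_schmidt)
  also have "\<dots> \<in> sets (frame_prob d \<Otimes>\<^sub>M lborel)" by measurable
  finally show ?thesis .
qed

lemma frame_plane_in_affine_planes:
  assumes "independent_frame d v"
  shows "frame_plane d (v, x) \<in> affine_planes d"
proof -
  have "aff_dim (span (v ` {..<d})) = int d"
    using assms by (simp add: aff_dim_subspace independent_frame_iff)
  moreover have "affine (span (v ` {..<d}))" by (simp add: subspace_imp_affine)
  ultimately show ?thesis
    by (simp add: frame_plane_def affine_planes_def aff_dim_translation_eq affine_translation[symmetric])
qed

text \<open>The \<open>\<sigma>\<close>-algebra on the planes consists of the sets with measurable preimage, so a set of planes can
  be shown to be null by means of a measurable function on the parameters.\<close>

lemma AE_affine_plane_measure: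
  fixes \<Phi> :: "'a::euclidean_space set \<Rightarrow> ennreal"
  assumes meas: "F \<in> borel_measurable (frame_prob d \<Otimes>\<^sub>M lborel)"
    and eq: "\<And>v x. independent_frame d v \<Longrightarrow> \<Phi> (frame_plane d (v, x)) = F (v, x)"
    and ae: "AE (v, x) in frame_prob d \<Otimes>\<^sub>M lborel. independent_frame d v \<longrightarrow> F (v, x) < \<infinity>"
  shows "AE \<zeta> in affine_plane_measure d. \<Phi> \<zeta> < \<infinity>"
proof -
  let ?S = "frame_space d :: ((nat \<Rightarrow> 'a) \<times> 'a) measure"
  let ?G = "{A. A \<subseteq> affine_planes d \<and> frame_plane d -` A \<inter> space ?S \<in> sets ?S}"
  let ?N = "sigma (affine_planes d) ?G"
  have space: "p \<in> space ?S \<Longrightarrow> independent_frame d (fst p)" for p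
    by (auto simp: frame_space_eq space_restrict_space frame_domain_def independent_frame_iff)
  have fp_in: "frame_plane d p \<in> affine_planes d" if "p \<in> space ?S" for p
    using frame_plane_in_affine_planes[OF space[OF that], of "snd p"] by simp
  have fp: "frame_plane d \<in> ?S \<rightarrow>\<^sub>M ?N"
    using fp_in by (intro measurable_measure_of) auto
  define B where "B = {\<zeta> \<in> affine_planes d. \<not> \<Phi> \<zeta> < \<infinity>}"
  have F: "F \<in> borel_measurable ?S"
    unfolding frame_space_eq by (rule measurable_restrict_space1[OF meas])
  have pre: "frame_plane d -` B \<inter> space ?S = {p \<in> space ?S. \<not> F p < \<infinity>}"
  proof -
    have "frame_plane d p \<in> B \<longleftrightarrow> \<not> F p < \<infinity>" if "p \<in> space ?S" for p
      using eq[OF space[OF that], of "snd p"] fp_in[OF that] by (simp add: B_def)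
    then show ?thesis by auto
  qed
  have preS: "frame_plane d -` B \<inter> space ?S \<in> sets ?S"
    unfolding pre using F by measurable
  have "B \<in> ?G" using preS by (auto simp: B_def)
  then have BN: "B \<in> sets ?N" by (subst sets_measure_of) auto
  have "AE p in ?S. F p < \<infinity>"
    unfolding frame_space_eq AE_restrict_space_iff[OF frame_domain_measurable]
    using ae by eventually_elim (auto simp: frame_domain_def independent_frame_iff)
  then have "emeasure ?S {p \<in> space ?S. \<not> F p < \<infinity>} = 0"
    using preS by (subst (asm) AE_iff_measurable[OF _ refl]) (auto simp: pre)
  then have "emeasure (distr ?S ?N (frame_plane d)) B = 0"
    using BN fp by (simp add: emeasure_distr pre)
  then have "B \<in> null_sets (affine_plane_measure d)"
    using BN by (intro null_setsI) (simp_all add: affine_plane_measure_def)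
  moreover have "space (affine_plane_measure d :: 'a set measure) = affine_planes d"
    unfolding affine_plane_measure_def space_scale_measure space_distr by (rule space_measure_of) auto
  ultimately show ?thesis
    by (intro AE_I'[of B]) (auto simp: B_def)
qed

lemma affine_planes_eq_trace_planes:
  assumes "1 \<le> k"
  shows "(affine_planes (k - 1) :: 'a::euclidean_space set set) \<subseteq> trace_plane ` slice_planes k"
proof
  fix \<zeta> :: "'a set" assume \<zeta>: "\<zeta> \<in> affine_planes (k - 1)"
  then have "affine \<zeta>" "aff_dim \<zeta> = int (k - 1)" by (auto simp: affine_planes_def)
  then obtain x where x: "x \<in> \<zeta>" by (cases "\<zeta> = {}") auto
  let ?W = "(\<lambda>y. y - x) ` \<zeta>"
  have W: "subspace ?W" by (rule affine_diffs_subspace_subtract[OF \<open>affine \<zeta>\<close> x])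
  have "int (dim ?W) = int (k - 1)"
    using aff_dim_subspace[OF W] \<open>aff_dim \<zeta> = int (k - 1)\<close> by (simp add: aff_dim_translation_eq_subtract)
  then obtain \<tau> where "\<tau> \<in> slice_planes k" "trace_plane \<tau> = (+) x ` ?W"
    using slice_plane_over_affine_plane[OF W assms, of x] by auto
  moreover have "(+) x ` ?W = \<zeta>" by (auto simp: image_image)
  ultimately show "\<zeta> \<in> trace_plane ` slice_planes k" by auto
qed

theorem slice_transform_finite_AE:
  fixes f :: "(real ^ 'n) \<times> real \<Rightarrow> 'b::euclidean_space"
  assumes k: "2 \<le> k" "k \<le> CARD('n)" and f: "f \<in> borel_measurable sphere_measure"
    and fin: "slice_cap_integral k f 2 < \<infinity>"
  shows "AE \<tau> in slice_plane_measure k. slice_transform_finite f \<tau>"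
proof -
  let ?d = "k - 1" and ?L = "Pi\<^sub>M {..<k - 1} (\<lambda>_. lborel :: real measure)"
  obtain f' N where f' [measurable]: "f' \<in> borel_measurable borel" and N [measurable]: "N \<in> sets borel"
    and null: "N \<in> null_sets (unit_sphere_measure UNIV)"
    and eq: "\<And>x. x \<in> sphere 0 1 \<Longrightarrow> x \<notin> N \<Longrightarrow> f x = f' x"
    using sphere_measure_representative[OF f] by metis
  define g where "g \<eta> = ennreal (norm (f' \<eta>)) + top * indicator N \<eta>" for \<eta>
  have g [measurable]: "g \<in> borel_measurable borel"
    unfolding g_def by measurable
  have e: "(real CARD('n) + 1 - real k) / 2 = (real CARD('n) - real ?d) / 2"
    using k by (simp add: of_nat_diff)
  have cap: "slice_cap_integral k f 2 = (\<integral>\<^sup>+\<eta>. indicator {\<eta>. snd \<eta> > 1 - 2} \<eta> *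
      ennreal (norm (f' \<eta>) / (1 - snd \<eta>) powr ((real CARD('n) - real ?d) / 2)) \<partial>sphere_borel UNIV)"
    unfolding e[symmetric] by (subst slice_cap_integral_eq[OF f' null eq]) simp_all
  have "(\<integral>\<^sup>+\<eta>. g \<eta> * ennreal (1 / (1 - snd \<eta>) powr ((real CARD('n) - real ?d) / 2)) \<partial>sphere_borel UNIV)
      = slice_cap_integral k f 2"
    unfolding cap
  proof (rule nn_integral_cong_AE)
    have "AE \<eta> in sphere_borel UNIV. \<eta> \<notin> N"
      using emeasure_sphere_borel_null[OF N null] N by (intro AE_not_in null_setsI) auto
    then show "AE \<eta> in sphere_borel UNIV. g \<eta> * ennreal (1 / (1 - snd \<eta>) powr ((real CARD('n) - real ?d) / 2))
      = indicator {\<eta>. snd \<eta> > 1 - 2} \<eta> * ennreal (norm (f' \<eta>) / (1 - snd \<eta>) powr ((real CARD('n) - real ?d) / 2))"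
      using AE_sphere_borel_not_south_pole
      by eventually_elim (simp add: g_def flip: ennreal_mult)
  qed
  then have w: "(\<integral>\<^sup>+z. (ennreal ((2 / (1 + (norm z)\<^sup>2)) ^ ?d) * g (stereo z)) *
        ennreal ((1 + (norm z)\<^sup>2) powr (- (real CARD('n) - real ?d) / 2)) \<partial>(lborel :: (real ^ 'n) measure)) < \<infinity>"
    using nn_integral_plane_weight[OF g, of ?d] k fin by (simp add: ennreal_mult_less_top)
  define h where "h z = ennreal ((2 / (1 + (norm z)\<^sup>2)) ^ ?d) * g (stereo z)" for z :: "real ^ 'n"
  have h [measurable]: "h \<in> borel_measurable borel" unfolding h_def by measurable
  interpret L: sigma_finite_measure ?L by (rule sigma_finite_PiM_lborel) simp
  define F where "F p = (\<integral>\<^sup>+t. h (snd p + lincomb {..<?d} (gram_schmidt (fst p)) t) \<partial>?L)" for p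
  have F: "F \<in> borel_measurable (frame_prob ?d \<Otimes>\<^sub>M lborel)" unfolding F_def[abs_def] by measurable
  let ?i = "inv_into (slice_planes k) trace_plane :: (real ^ 'n) set \<Rightarrow> _"
  have sub: "affine_planes ?d \<subseteq> trace_plane ` slice_planes k"
    using k by (intro affine_planes_eq_trace_planes) simp
  have space_planes: "space (affine_plane_measure ?d :: (real ^ 'n) set measure) = affine_planes ?d"
    unfolding affine_plane_measure_def space_scale_measure space_distr by (rule space_measure_of) auto
  have "AE \<zeta> in affine_plane_measure ?d. slice_transform g (?i \<zeta>) < \<infinity>"
  proof (rule AE_affine_plane_measure[OF F])
    show "AE (v, x) in frame_prob ?d \<Otimes>\<^sub>M lborel. independent_frame ?d v \<longrightarrow> F (v, x) < \<infinity>"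
      using AE_plane_integral_finite[OF h, of ?d] w k by (simp add: F_def h_def)
  next
    fix v :: "nat \<Rightarrow> real ^ 'n" and x assume v: "independent_frame ?d v"
    let ?W = "span (v ` {..<?d})" and ?\<tau> = "?i (frame_plane ?d (v, x))"
    have \<zeta>: "frame_plane ?d (v, x) \<in> trace_plane ` slice_planes k"
      using frame_plane_in_affine_planes[OF v] sub by blast
    interpret slice_plane k ?\<tau>
      using k inv_into_into[OF \<zeta>] by unfold_locales
    have trace: "trace_plane ?\<tau> = (+) x ` ?W"
      using f_inv_into_f[OF \<zeta>] by (simp add: frame_plane_def)
    have "slice_transform g ?\<tau> = (\<integral>\<^sup>+y. h (x + y) \<partial>subspace_lborel ?W)"
      unfolding h_def by (rule slice_transform_stereo[OF g _ trace]) simp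
    also have "\<dots> = (\<integral>\<^sup>+t. h (x + lincomb {..<?d} (gram_schmidt v) t) \<partial>?L)"
      unfolding subspace_lborel_eq_frame_lborel[OF orthonormal_family_gram_schmidt[OF v] span_gram_schmidt]
      by (rule nn_integral_frame_lborel) measurable
    finally show "slice_transform g ?\<tau> = F (v, x)" by (simp add: F_def)
  qed
  then have "AE \<zeta> in affine_plane_measure ?d. slice_transform_finite f (?i \<zeta>)"
    using AE_space
  proof eventually_elim
    case (elim \<zeta>)
    have "\<zeta> \<in> trace_plane ` slice_planes k" using elim(2) sub space_planes by auto
    then interpret slice_plane k "?i \<zeta>"
      using k inv_into_into by unfold_locales
    show ?case
      by (rule slice_transform_finite_dominated[OF f' N eq elim(1)[unfolded g_def[abs_def]]])
  qed
  moreover have "inj_on ?i (space (affine_plane_measure ?d))"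
    unfolding space_planes by (rule inj_on_inv_into[OF sub])
  ultimately show ?thesis
    unfolding slice_plane_measure_def by (subst AE_embed_measure')
qed

section \<open>One-dimensional integrals\<close>

lemma nn_integral_powr_at_1_finite:
  fixes s :: real
  assumes "s > -1"
  shows "(\<integral>\<^sup>+a. indicator {-1<..<1} a * ennreal ((1 - a) powr s) \<partial>lborel) < \<infinity>"
    and "(\<integral>\<^sup>+a. indicator {-1<..<1} a * ennreal ((1 + a) powr s) \<partial>lborel) < \<infinity>"
proof -
  let ?f = "\<lambda>x::real. ennreal (x powr s) * indicator {0..2} x"
  have fin: "(\<integral>\<^sup>+x. ?f x \<partial>lborel) < \<infinity>"
    by (subst nn_integral_has_integral_lebesgue'[OF _ has_integral_powr_from_0[OF assms]]) auto
  have "(\<integral>\<^sup>+a. indicator {-1<..<1} a * ennreal ((1 - a) powr s) \<partial>lborel) \<le> (\<integral>\<^sup>+a. ?f (1 + (-1) * a) \<partial>lborel)"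
    by (intro nn_integral_mono) (auto simp: indicator_def)
  also have "\<dots> = (\<integral>\<^sup>+x. ?f x \<partial>lborel)"
    by (subst nn_integral_real_affine[of ?f "-1" 1]) auto
  finally show "(\<integral>\<^sup>+a. indicator {-1<..<1} a * ennreal ((1 - a) powr s) \<partial>lborel) < \<infinity>"
    using fin by (rule le_less_trans)
  have "(\<integral>\<^sup>+a. indicator {-1<..<1} a * ennreal ((1 + a) powr s) \<partial>lborel) \<le> (\<integral>\<^sup>+a. ?f (1 + 1 * a) \<partial>lborel)"
    by (intro nn_integral_mono) (auto simp: indicator_def)
  also have "\<dots> = (\<integral>\<^sup>+x. ?f x \<partial>lborel)"
    by (subst nn_integral_real_affine[of ?f 1 1]) auto
  finally show "(\<integral>\<^sup>+a. indicator {-1<..<1} a * ennreal ((1 + a) powr s) \<partial>lborel) < \<infinity>"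
    using fin by (rule le_less_trans)
qed

lemma nn_integral_inverse_at_1_infinite:
  "(\<integral>\<^sup>+a. indicator {0<..<1} a * ennreal (1 / (1 - a)) \<partial>lborel) = \<infinity>"
proof -
  let ?f = "\<lambda>x::real. indicator {0<..<1} x * ennreal (1 / x)"
  have ge: "ennreal (real m) \<le> (\<integral>\<^sup>+x. ?f x \<partial>lborel)" for m :: nat
  proof -
    have "(\<integral>\<^sup>+x. ennreal (1 / x) * indicator {exp (- real m)..1} x \<partial>lborel) = ennreal (ln 1 - ln (exp (- real m)))"
    proof (rule nn_integral_FTC_Icc)
      fix x :: real assume "x \<in> {exp (- real m)..1}"
      then have x: "x > 0" using exp_gt_zero[of "- real m"] by (meson atLeastAtMost_iff less_le_trans)
      show "(ln has_real_derivative 1 / x) (at x)"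
        using x by (auto intro!: derivative_eq_intros simp: divide_inverse)
      show "0 \<le> 1 / x" using x by simp
    qed auto
    then have "ennreal (real m) = (\<integral>\<^sup>+x. ennreal (1 / x) * indicator {exp (- real m)..1} x \<partial>lborel)"
      by simp
    also have "\<dots> \<le> (\<integral>\<^sup>+x. ?f x \<partial>lborel)"
    proof (rule nn_integral_mono_AE)
      show "AE x in lborel. ennreal (1 / x) * indicator {exp (- real m)..1} x \<le> ?f x"
        using AE_lborel_singleton[of 1]
      proof eventually_elim
        case (elim x)
        show ?case
        proof (cases "x \<in> {exp (- real m)..1}")
          case True
          then have "0 < x" using exp_gt_zero[of "- real m"] by (meson atLeastAtMost_iff less_le_trans)
          then show ?thesis using True elim by (simp add: indicator_def)
        qed simp
      qed
    qed
    finally show ?thesis .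
  qed
  have "(\<integral>\<^sup>+x. ?f x \<partial>lborel) = \<infinity>"
  proof (rule ccontr)
    assume "(\<integral>\<^sup>+x. ?f x \<partial>lborel) \<noteq> \<infinity>"
    then obtain c where c: "(\<integral>\<^sup>+x. ?f x \<partial>lborel) = ennreal c" "0 \<le> c"
      by (cases "\<integral>\<^sup>+x. ?f x \<partial>lborel") auto
    obtain m :: nat where "c < real m" using reals_Archimedean2 by blast
    with ge[of m] c show False by (simp add: ennreal_le_iff)
  qed
  also have "(\<integral>\<^sup>+x. ?f x \<partial>lborel) = (\<integral>\<^sup>+a. ?f (1 + (-1) * a) \<partial>lborel)"
    by (subst nn_integral_real_affine[of ?f "-1" 1]) auto
  also have "\<dots> = (\<integral>\<^sup>+a. indicator {0<..<1} a * ennreal (1 / (1 - a)) \<partial>lborel)"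
    by (intro nn_integral_cong) (auto simp: indicator_def)
  finally show ?thesis by simp
qed

lemma powr_le_on_1_2:
  fixes x s :: real
  assumes "1 \<le> x" "x \<le> 2"
  shows "x powr s \<le> 2 powr \<bar>s\<bar>"
proof -
  have "x powr s \<le> x powr \<bar>s\<bar>" using assms by (intro powr_mono) auto
  also have "\<dots> \<le> 2 powr \<bar>s\<bar>" using assms by (intro powr_mono2) auto
  finally show ?thesis .
qed

section \<open>Functions with a power singularity at the pole\<close>

lemma snd_less_1_on_sphere:
  fixes \<eta> :: "'a::euclidean_space \<times> real"
  assumes "\<eta> \<in> sphere 0 1" "\<eta> \<noteq> north_pole"
  shows "snd \<eta> < 1"
proof -
  obtain x t where \<eta>: "\<eta> = (x, t)" by (cases \<eta>)
  have "(norm x)\<^sup>2 + t\<^sup>2 = 1"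
    using assms(1) by (simp add: \<eta> norm_Pair)
  moreover have "t < 1" if "x \<noteq> 0"
  proof -
    have "0 < (norm x)\<^sup>2" using that by simp
    with calculation have "t\<^sup>2 < 1\<^sup>2" unfolding one_power2 by linarith
    then show ?thesis by (rule power_less_imp_less_base) simp
  qed
  moreover have "t < 1" if "x = 0"
    using calculation(1) assms(2) that by (auto simp: \<eta> north_pole_def power2_eq_1_iff)
  ultimately show ?thesis by (auto simp: \<eta>)
qed

context slice_plane
begin

lemma radius_le_1: "radius\<^sup>2 \<le> 1"
  using radius_sq by simp

lemma exponent_gt: "(real k - 3) / 2 > - 1"
  using k by simp

text \<open>In terms of the latitude the integrand is a constant times \<open>(1 - a)\<^bsup>q - \<mu>\<^esup> (1 + a)\<^sup>q\<close> with
  \<open>q = (k - 3)/2\<close>. Each of the two powers is bounded where the other one is singular, and both exponents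
  exceed \<open>-1\<close>. The value \<open>\<infinity>\<close> at the pole makes the function an upper bound on
  the whole sphere; the latitude 1 is a null set.\<close>

lemma slice_transform_powr_finite:
  fixes C \<mu> :: real
  assumes C: "0 \<le> C" and \<mu>: "\<mu> < (real k - 1) / 2"
  shows "slice_transform (\<lambda>\<eta>. if snd \<eta> = 1 then \<infinity> else ennreal (C * (1 - snd \<eta>) powr (- \<mu>))) \<tau> < \<infinity>"
proof -
  let ?q = "(real k - 3) / 2"
  let ?x = "\<lambda>a. (1 - a) powr (?q - \<mu>)" and ?y = "\<lambda>a. (1 + a) powr ?q"
    and ?z = "\<lambda>a. (1 - (1 - radius\<^sup>2 * (1 - a))) powr (- \<mu>)" and ?c = "2 powr \<bar>?q\<bar> + 2 powr \<bar>?q - \<mu>\<bar>"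
  let ?i = "\<lambda>a::real. indicator {-1<..<1} a :: ennreal"
  define M where "M = C * (radius\<^sup>2) powr (- \<mu>) * (2 powr \<bar>?q\<bar> + 2 powr \<bar>?q - \<mu>\<bar>)"
  have M: "0 \<le> M" using C by (simp add: M_def)
  let ?g = "\<lambda>b::real. if b = 1 then \<infinity> else ennreal (C * (1 - b) powr (- \<mu>))"
  have "(\<integral>\<^sup>+a. ?i a * ennreal ((1 - a\<^sup>2) powr ?q) * ?g (1 - radius\<^sup>2 * (1 - a)) \<partial>lborel)
     \<le> (\<integral>\<^sup>+a. ennreal M * (?i a * ennreal (?x a) + ?i a * ennreal (?y a)) \<partial>lborel)"
  proof (rule nn_integral_mono)
    fix a :: real
    show "?i a * ennreal ((1 - a\<^sup>2) powr ?q) * ?g (1 - radius\<^sup>2 * (1 - a))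
      \<le> ennreal M * (?i a * ennreal (?x a) + ?i a * ennreal (?y a))"
    proof (cases "a \<in> {-1<..<1}")
      case True
      then have a: "0 < 1 - a" "0 < 1 + a" by auto
      have "radius\<^sup>2 * (1 - a) \<noteq> 0" using radius_pos a by auto
      then have ne: "1 - radius\<^sup>2 * (1 - a) \<noteq> 1" by linarith
      have "1 - a\<^sup>2 = (1 - a) * (1 + a)" by (simp add: algebra_simps power2_eq_square)
      then have e1: "(1 - a\<^sup>2) powr ?q = (1 - a) powr ?q * ?y a"
        using a by (simp add: powr_mult)
      have e2: "?z a = (radius\<^sup>2) powr (- \<mu>) * (1 - a) powr (- \<mu>)"
        using a radius_pos by (simp add: powr_mult)
      have e3: "?x a = (1 - a) powr ?q * (1 - a) powr (- \<mu>)"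
        by (simp flip: powr_add)
      have eq: "(1 - a\<^sup>2) powr ?q * (C * ?z a)
          = C * (radius\<^sup>2) powr (- \<mu>) * (?x a * ?y a)"
        unfolding e1 e2 e3 by (simp only: mult_ac)
      have "?x a * ?y a
          \<le> ?c * (?x a + ?y a)"
      proof (cases "a \<ge> 0")
        case True
        then have "?x a * ?y a \<le> ?x a * 2 powr \<bar>?q\<bar>"
          using a by (intro mult_left_mono powr_le_on_1_2) auto
        also have "\<dots> \<le> ?c * (?x a + ?y a)"
          by (simp add: algebra_simps)
        finally show ?thesis .
      next
        case False
        then have "?x a * ?y a \<le> 2 powr \<bar>?q - \<mu>\<bar> * ?y a"
          using a by (intro mult_right_mono powr_le_on_1_2) auto
        also have "\<dots> \<le> ?c * (?x a + ?y a)"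
          by (simp add: algebra_simps)
        finally show ?thesis .
      qed
      then have "(1 - a\<^sup>2) powr ?q * (C * ?z a)
          \<le> M * (?x a + ?y a)"
        unfolding eq M_def mult.assoc[of "C * (radius\<^sup>2) powr (- \<mu>)"] using C by (intro mult_left_mono) auto
      then have "ennreal ((1 - a\<^sup>2) powr ?q) * ennreal (C * ?z a)
          \<le> ennreal M * (ennreal (?x a) + ennreal (?y a))"
        using C M by (simp flip: ennreal_mult ennreal_plus)
      then show ?thesis using True ne by simp
    qed simp
  qed
  also have "\<dots> = ennreal M * ((\<integral>\<^sup>+a. ?i a * ennreal (?x a) \<partial>lborel)
      + (\<integral>\<^sup>+a. ?i a * ennreal (?y a) \<partial>lborel))"
    by (subst nn_integral_cmult, measurable) (subst nn_integral_add, auto)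
  also have "\<dots> < \<infinity>"
    using nn_integral_powr_at_1_finite(1)[of "?q - \<mu>"] nn_integral_powr_at_1_finite(2)[OF exponent_gt] \<mu>
    by (simp add: ennreal_mult_less_top field_simps)
  finally have "(\<integral>\<^sup>+a. ?i a * ennreal ((1 - a\<^sup>2) powr ?q) * ?g (1 - radius\<^sup>2 * (1 - a)) \<partial>lborel) < \<infinity>" .
  moreover have "?g \<in> borel_measurable borel" by measurable
  ultimately show ?thesis
    using slice_transform_zonal[of ?g] by (simp add: ennreal_mult_less_top)
qed

lemma slice_transform_finite_continuous:
  fixes f :: "'a \<times> real \<Rightarrow> 'b::euclidean_space"
  assumes cont: "continuous_on (sphere 0 1 - {north_pole}) f"
    and \<mu>: "\<mu> < (real k - 1) / 2"
    and bdd: "bdd_above ((\<lambda>\<eta>. (1 - snd \<eta>) powr \<mu> * norm (f \<eta>)) ` (sphere 0 1 - {north_pole}))"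
  shows "slice_transform_finite f \<tau>"
proof -
  obtain C\<^sub>0 where "\<forall>y \<in> (\<lambda>\<eta>. (1 - snd \<eta>) powr \<mu> * norm (f \<eta>)) ` (sphere 0 1 - {north_pole}). y \<le> C\<^sub>0"
    using bdd unfolding bdd_above_def by blast
  then have C\<^sub>0: "(1 - snd \<eta>) powr \<mu> * norm (f \<eta>) \<le> C\<^sub>0" if "\<eta> \<in> sphere 0 1 - {north_pole}" for \<eta>
    using that by blast
  define C where "C = max 0 C\<^sub>0"
  let ?G = "\<lambda>\<eta> :: 'a \<times> real. if snd \<eta> = 1 then \<infinity> else ennreal (C * (1 - snd \<eta>) powr (- \<mu>))"
  have le: "ennreal (norm (f \<eta>)) \<le> ?G \<eta>" if "\<eta> \<in> sphere 0 1" for \<eta>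
  proof (cases "\<eta> = north_pole")
    case True
    then show ?thesis by (simp add: north_pole_def)
  next
    case False
    with that have lt: "snd \<eta> < 1" by (rule snd_less_1_on_sphere)
    have "norm (f \<eta>) = (1 - snd \<eta>) powr \<mu> * norm (f \<eta>) * (1 - snd \<eta>) powr (- \<mu>)"
      using lt by (simp add: powr_minus field_simps)
    also have "\<dots> \<le> C * (1 - snd \<eta>) powr (- \<mu>)"
      using C\<^sub>0[of \<eta>] that False by (intro mult_right_mono) (auto simp: C_def)
    finally show ?thesis using lt by (simp add: ennreal_leI)
  qed
  have "slice_transform (\<lambda>\<eta>. ennreal (norm (f \<eta>))) \<tau> \<le> slice_transform ?G \<tau>"
    unfolding slice_transform_eq using le by (intro nn_integral_mono) auto
  also have "\<dots> < \<infinity>"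
    by (rule slice_transform_powr_finite[OF _ \<mu>]) (simp add: C_def)
  finally have "slice_transform (\<lambda>\<eta>. ennreal (norm (f \<eta>))) \<tau> < \<infinity>" .
  moreover have "f \<in> borel_measurable (subsphere_measure \<tau>)"
  proof -
    let ?S = "sphere 0 1 - {north_pole} :: ('a \<times> real) set"
    let ?f = "\<lambda>\<eta>. indicator ?S \<eta> *\<^sub>R f \<eta> + indicator {north_pole} \<eta> *\<^sub>R f north_pole"
    have off_pole: "(\<lambda>\<eta>. indicator ?S \<eta> *\<^sub>R f \<eta>) \<in> borel_measurable borel"
      by (rule borel_measurable_continuous_on_indicator[OF _ cont]) auto
    have at_pole: "(\<lambda>\<eta>. indicator {north_pole} \<eta> *\<^sub>R f north_pole) \<in> borel_measurable borel"
      by (intro borel_measurable_scaleR borel_measurable_indicator) auto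
    have "?f \<in> borel_measurable borel"
      by (rule borel_measurable_add[OF off_pole at_pole])
    then have "?f \<in> borel_measurable slice_measure" by (rule measurable_slice_measure)
    moreover have "f \<in> borel_measurable slice_measure \<longleftrightarrow> ?f \<in> borel_measurable slice_measure"
      by (rule measurable_cong) (simp add: indicator_def)
    ultimately have "f \<in> borel_measurable slice_measure" by (simp only:)
    then show ?thesis unfolding subsphere_measure_eq by (rule measurable_completion)
  qed
  ultimately show ?thesis by (simp add: slice_transform_finite_def)
qed

text \<open>At the critical exponent the integral over the slice diverges logarithmically at the pole.\<close>

lemma slice_transform_powr_critical:
  "slice_transform (\<lambda>\<eta>. ennreal ((1 - snd \<eta>) powr (- ((real k - 1) / 2)))) \<tau> = \<infinity>"
proof -
  let ?q = "(real k - 3) / 2" and ?m = "(real k - 1) / 2"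
  let ?g = "\<lambda>b::real. ennreal ((1 - b) powr (- ?m))"
  let ?c = "1 / 2 * (radius\<^sup>2) powr (- ?m)"
  have c: "?c > 0" using radius_pos by simp
  have "\<infinity> = ennreal ?c * (\<integral>\<^sup>+a. indicator {0<..<1} a * ennreal (1 / (1 - a)) \<partial>lborel)"
    unfolding nn_integral_inverse_at_1_infinite using c by (simp add: ennreal_mult_top)
  also have "\<dots> = (\<integral>\<^sup>+a. ennreal ?c * (indicator {0<..<1} a * ennreal (1 / (1 - a))) \<partial>lborel)"
    by (rule nn_integral_cmult[symmetric]) measurable
  also have "\<dots> \<le> (\<integral>\<^sup>+a. indicator {-1<..<1} a * ennreal ((1 - a\<^sup>2) powr ?q) * ?g (1 - radius\<^sup>2 * (1 - a)) \<partial>lborel)"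
  proof (rule nn_integral_mono)
    fix a :: real
    show "ennreal ?c * (indicator {0<..<1} a * ennreal (1 / (1 - a)))
       \<le> indicator {-1<..<1} a * ennreal ((1 - a\<^sup>2) powr ?q) * ?g (1 - radius\<^sup>2 * (1 - a))"
    proof (cases "a \<in> {0<..<1}")
      case True
      then have a: "0 < 1 - a" "1 < 1 + a" "1 + a < 2" by auto
      have "(1 + a) powr (- 1) \<le> (1 + a) powr ?q"
        using a exponent_gt by (intro powr_mono) auto
      moreover have "1 / 2 \<le> (1 + a) powr (- 1)"
        using a by (simp add: powr_minus_divide field_simps)
      ultimately have half: "1 / 2 \<le> (1 + a) powr ?q" by linarith
      have "1 - a\<^sup>2 = (1 - a) * (1 + a)" by (simp add: algebra_simps power2_eq_square)
      then have 1: "(1 - a\<^sup>2) powr ?q = (1 - a) powr ?q * (1 + a) powr ?q"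
        using a by (simp add: powr_mult)
      have 2: "(1 - (1 - radius\<^sup>2 * (1 - a))) powr (- ?m) = (radius\<^sup>2) powr (- ?m) * (1 - a) powr (- ?m)"
        using a radius_pos by (simp add: powr_mult)
      have "(1 - a) powr ?q * (1 - a) powr (- ?m) = (1 - a) powr (?q - ?m)"
        by (simp flip: powr_add)
      also have "?q - ?m = - 1" by (simp add: field_simps)
      finally have 3: "(1 - a) powr ?q * (1 - a) powr (- ?m) = 1 / (1 - a)"
        using a by (simp add: powr_minus_divide)
      have "?c * (1 / (1 - a)) \<le> (1 + a) powr ?q * (radius\<^sup>2) powr (- ?m) * (1 / (1 - a))"
        using half a by (intro mult_right_mono) auto
      also have "\<dots> = (1 - a\<^sup>2) powr ?q * (1 - (1 - radius\<^sup>2 * (1 - a))) powr (- ?m)"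
        unfolding 1 2 3[symmetric] by (simp only: mult_ac)
      finally have "ennreal (?c * (1 / (1 - a))) \<le> ennreal ((1 - a\<^sup>2) powr ?q * (1 - (1 - radius\<^sup>2 * (1 - a))) powr (- ?m))"
        by (rule ennreal_leI)
      moreover have "ennreal (?c * (1 / (1 - a))) = ennreal ?c * ennreal (1 / (1 - a))"
        using c a by (intro ennreal_mult) auto
      moreover have "ennreal ((1 - a\<^sup>2) powr ?q * (1 - (1 - radius\<^sup>2 * (1 - a))) powr (- ?m))
          = ennreal ((1 - a\<^sup>2) powr ?q) * ?g (1 - radius\<^sup>2 * (1 - a))"
        by (intro ennreal_mult) auto
      ultimately show ?thesis using True by (simp only:) (simp add: indicator_def)
    qed simp
  qed
  finally have inf: "(\<integral>\<^sup>+a. indicator {-1<..<1} a * ennreal ((1 - a\<^sup>2) powr ?q) * ?g (1 - radius\<^sup>2 * (1 - a)) \<partial>lborel) = \<infinity>"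
    by (simp add: top_unique)
  have "?g \<in> borel_measurable borel" by measurable
  from slice_transform_zonal[OF this, unfolded inf] show ?thesis
    using radius_pos k by (simp add: ennreal_mult_top ennreal_mult_eq_top_iff ennreal_eq_0_iff not_le)
qed

end


section \<open>Zonal functions\<close>

lemma zonal_eq:
  fixes f :: "(real ^ 'n) \<times> real \<Rightarrow> 'b"
  assumes "zonal f" and n: "2 \<le> CARD('n)" and xt: "(x, t) \<in> sphere 0 1" and eq: "norm x = norm y"
  shows "f (y, t) = f (x, t)"
proof -
  obtain Q where Q: "orthogonal_transformation Q" "det (matrix Q) = 1" "Q x = y"
    by (rule rotation_exists[OF n eq])
  have "linear Q" by (rule orthogonal_transformation_linear[OF Q(1)])
  then have "matrix Q *v x = y" using Q(3) by (simp add: matrix_works)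
  moreover have "rotation_matrix (matrix Q)"
    using Q by (simp add: rotation_matrix_def orthogonal_transformation_matrix)
  ultimately show ?thesis
    using \<open>zonal f\<close> xt unfolding zonal_def by metis
qed

text \<open>A zonal function that is only Lebesgue measurable has a profile that agrees with a Borel function
  almost everywhere; averaging over parallels produces it.\<close>

lemma zonal_borel_profile:
  fixes f :: "(real ^ 'n) \<times> real \<Rightarrow> 'b::euclidean_space"
  assumes n: "2 \<le> CARD('n)" and f: "f \<in> borel_measurable sphere_measure" and zonal: "zonal f"
  obtains \<psi> C where "\<psi> \<in> borel_measurable borel"
    "\<And>\<eta>. \<eta> \<in> sphere 0 1 \<Longrightarrow> \<psi> (snd \<eta>) \<le> ennreal (norm (f \<eta>))"
    "\<And>k \<epsilon>. slice_cap_integral k f \<epsilon> = ennreal C *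
        (\<integral>\<^sup>+a. indicator {-1<..<1} a * indicator {a. a > 1 - \<epsilon>} a *
          (ennreal ((1 - a\<^sup>2) powr ((real CARD('n) - 2) / 2)) *
           ennreal (1 / (1 - a) powr ((real CARD('n) + 1 - real k) / 2))) * \<psi> a \<partial>lborel)"
proof -
  let ?W = "(UNIV :: (real ^ 'n) set) \<times> {0::real}" and ?\<sigma> = "sphere_borel ((UNIV :: (real ^ 'n) set) \<times> {0::real})"
  let ?v = "\<lambda>k a. ennreal (1 / (1 - a) powr ((real CARD('n) + 1 - real k) / 2))"
  interpret hyperplane_split ?W north_pole UNIV by (rule hyperplane_split_UNIV)
  interpret S: sigma_finite_measure ?\<sigma> by (rule sigma_finite_sphere_borel[OF W])
  have dimW: "dim ?W = CARD('n)" by (simp add: dim_UNIV_Times_0)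
  define K where "K = real CARD('n) * unit_ball_vol (real CARD('n))"
  have K: "0 < K" "emeasure ?\<sigma> UNIV = ennreal K"
    using emeasure_sphere_borel[OF W dim_W] by (simp_all add: K_def dimW)
  obtain f' N where f' [measurable]: "f' \<in> borel_measurable borel" and N [measurable]: "N \<in> sets borel"
    and null: "N \<in> null_sets (unit_sphere_measure UNIV)"
    and eq: "\<And>x. x \<in> sphere 0 1 \<Longrightarrow> x \<notin> N \<Longrightarrow> f x = f' x"
    using sphere_measure_representative[OF f] by metis
  let ?pt = "\<lambda>a \<theta>. a *\<^sub>R north_pole + sqrt (1 - a\<^sup>2) *\<^sub>R \<theta> :: (real ^ 'n) \<times> real"
  let ?w = "\<lambda>a::real. (1 - a\<^sup>2) powr ((real CARD('n) - 2) / 2)"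
  \<comment> \<open>Any fixed unit vector of \<open>\<real>\<^sup>n\<close> serves to define the profile.\<close>
  define \<phi> where "\<phi> t = norm (f (sqrt (1 - t\<^sup>2) *\<^sub>R axis undefined 1, t))" for t
  have \<phi>: "norm (f (x, t)) = \<phi> t" if xt: "(x, t) \<in> sphere 0 1" for x t
  proof -
    have 1: "(norm x)\<^sup>2 = 1 - t\<^sup>2" using xt by (simp add: norm_Pair)
    then have "norm x = sqrt (1 - t\<^sup>2)" by (metis norm_ge_zero real_sqrt_unique)
    moreover have "0 \<le> 1 - t\<^sup>2" unfolding 1[symmetric] by simp
    ultimately have "norm x = norm (sqrt (1 - t\<^sup>2) *\<^sub>R (axis undefined 1 :: real ^ 'n))" by simp
    then have e: "f (sqrt (1 - t\<^sup>2) *\<^sub>R axis undefined 1, t) = f (x, t)"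
      by (rule zonal_eq[OF zonal n xt])
    show ?thesis unfolding \<phi>_def e ..
  qed
  have pt: "?pt a \<theta> \<in> sphere 0 1 \<and> norm (f (?pt a \<theta>)) = \<phi> a \<and> snd (?pt a \<theta>) = a"
    if a: "a \<in> {-1<..<1}" and \<theta>: "\<theta> \<in> ?W" "norm \<theta> = 1" for a \<theta>
  proof -
    have "\<bar>a\<bar> < 1" using a by auto
    then have a2: "0 \<le> 1 - a\<^sup>2" by (simp add: abs_square_le_1)
    obtain y where y: "\<theta> = (y, 0)" "norm y = 1" using \<theta> by auto
    have p: "?pt a \<theta> = (sqrt (1 - a\<^sup>2) *\<^sub>R y, a)" by (simp add: y north_pole_def)
    have "?pt a \<theta> \<in> sphere 0 1" unfolding p using a2 y by (simp add: norm_Pair power_mult_distrib)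
    with \<phi>[of "sqrt (1 - a\<^sup>2) *\<^sub>R y" a] show ?thesis unfolding p by simp
  qed
  let ?W' = "\<lambda>a::real. indicator {-1<..<1} a * ennreal (?w a)"
  have lat: "(\<integral>\<^sup>+x. G x \<partial>sphere_borel UNIV) = (\<integral>\<^sup>+a. ?W' a * (\<integral>\<^sup>+\<theta>. G (?pt a \<theta>) \<partial>?\<sigma>) \<partial>lborel)"
    if "G \<in> borel_measurable borel" for G :: "(real ^ 'n) \<times> real \<Rightarrow> ennreal"
    using nn_integral_sphere_latitude[OF that] by (simp only: dimW)
  define A where "A a = (\<integral>\<^sup>+\<theta>. ennreal (norm (f' (?pt a \<theta>))) \<partial>?\<sigma>)" for a
  have A [measurable]: "A \<in> borel_measurable borel" unfolding A_def[abs_def] by measurable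
  let ?\<nu> = "\<lambda>a. \<integral>\<^sup>+\<theta>. indicator N (?pt a \<theta>) \<partial>?\<sigma>"
  have indN [measurable]: "indicator N \<in> borel_measurable (borel :: ((real ^ 'n) \<times> real) measure)"
    by (rule borel_measurable_indicator[OF N])
  have "(\<integral>\<^sup>+a. ?W' a * ?\<nu> a \<partial>lborel) = 0"
    using emeasure_sphere_borel_null[OF N null] lat[OF indN] N by simp
  moreover have "(\<lambda>a. ?W' a * ?\<nu> a) \<in> borel_measurable lborel"
    by measurable
  ultimately have "AE a in lborel. ?W' a * ?\<nu> a = 0"
    by (subst (asm) nn_integral_0_iff_AE) auto
  then have AE_A: "AE a in lborel. a \<in> {-1<..<1} \<longrightarrow> A a = ennreal K * ennreal (\<phi> a)"
  proof eventually_elim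
    case (elim a)
    show ?case
    proof
      assume a: "a \<in> {-1<..<1}"
      then have "\<bar>a\<bar> < 1" by auto
      then have "0 < ?w a" by (simp add: abs_square_eq_1 less_imp_neq)
      then have "?\<nu> a = 0"
        using elim a by (auto simp: ennreal_eq_0_iff)
      then have "AE \<theta> in ?\<sigma>. indicator N (?pt a \<theta>) = (0 :: ennreal)"
        by (subst (asm) nn_integral_0_iff_AE) auto
      then have "AE \<theta> in ?\<sigma>. ennreal (norm (f' (?pt a \<theta>))) = ennreal (\<phi> a)"
        using AE_sphere_borel[OF W]
      proof eventually_elim
        case (elim \<theta>)
        then have "?pt a \<theta> \<notin> N" by (simp add: indicator_def split: if_splits)
        then show ?case using pt[OF a, of \<theta>] elim(2) eq[of "?pt a \<theta>"] by simp
      qed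
      then have "A a = (\<integral>\<^sup>+\<theta>. ennreal (\<phi> a) \<partial>?\<sigma>)"
        unfolding A_def by (rule nn_integral_cong_AE)
      then show "A a = ennreal K * ennreal (\<phi> a)" by (simp add: K mult.commute)
    qed
  qed
  then obtain Z where Z: "Z \<in> null_sets lborel" "{a. \<not> (a \<in> {-1<..<1} \<longrightarrow> A a = ennreal K * ennreal (\<phi> a))} \<subseteq> Z"
    unfolding eventually_ae_filter by auto
  have [measurable]: "Z \<in> sets borel" using Z(1) by auto
  \<comment> \<open>The value 0 on the exceptional set makes \<open>\<psi>\<close> a lower bound of the profile everywhere.\<close>
  define \<psi> where "\<psi> a = (if a \<in> {-1<..<1} - Z then A a / ennreal K else 0)" for a
  have \<psi>_borel: "\<psi> \<in> borel_measurable borel" unfolding \<psi>_def[abs_def] by measurable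
  have \<psi>: "\<psi> a = ennreal (\<phi> a)" "A a = ennreal K * \<psi> a" if "a \<in> {-1<..<1} - Z" for a
  proof -
    have Aa: "A a = ennreal K * ennreal (\<phi> a)" using that Z(2) by auto
    have "ennreal K * ennreal (\<phi> a) / ennreal K = ennreal (\<phi> a)"
      using K(1) by (simp add: \<phi>_def divide_ennreal flip: ennreal_mult)
    then show 1: "\<psi> a = ennreal (\<phi> a)" using that Aa by (simp add: \<psi>_def)
    show "A a = ennreal K * \<psi> a" unfolding 1 Aa ..
  qed
  have le: "\<psi> (snd \<eta>) \<le> ennreal (norm (f \<eta>))" if "\<eta> \<in> sphere 0 1" for \<eta>
  proof (cases "snd \<eta> \<in> {-1<..<1} - Z")
    case True
    then show ?thesis using \<psi>(1)[OF True] \<phi>[of "fst \<eta>" "snd \<eta>"] that by simp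
  next
    case False
    then have "\<psi> (snd \<eta>) = 0" unfolding \<psi>_def by (rule if_not_P)
    then show ?thesis by simp
  qed
  have cap: "slice_cap_integral k f \<epsilon> = ennreal K *
        (\<integral>\<^sup>+a. indicator {-1<..<1} a * indicator {a. a > 1 - \<epsilon>} a *
          (ennreal (?w a) * ?v k a) * \<psi> a \<partial>lborel)" for k \<epsilon>
  proof -
    let ?e = "(real CARD('n) + 1 - real k) / 2"
    let ?G = "\<lambda>\<eta> :: (real ^ 'n) \<times> real. indicator {\<eta>. snd \<eta> > 1 - \<epsilon>} \<eta> * ennreal (norm (f' \<eta>) / (1 - snd \<eta>) powr ?e)"
    have [measurable]: "(\<lambda>\<eta> :: (real ^ 'n) \<times> real. indicator {a. a > 1 - \<epsilon>} (snd \<eta>) :: ennreal) \<in> borel_measurable borel"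
      by (rule measurable_compose[OF measurable_snd_borel]) measurable
    have [measurable]: "(\<lambda>\<eta> :: (real ^ 'n) \<times> real. (1 - snd \<eta>) powr ?e) \<in> borel_measurable borel"
      by (rule measurable_compose[OF measurable_snd_borel]) measurable
    have Geq: "?G = (\<lambda>\<eta>. indicator {a. a > 1 - \<epsilon>} (snd \<eta>) * ennreal (norm (f' \<eta>) / (1 - snd \<eta>) powr ?e))"
      by (simp add: indicator_def fun_eq_iff)
    have G: "?G \<in> borel_measurable borel" unfolding Geq by measurable
    have "slice_cap_integral k f \<epsilon> = (\<integral>\<^sup>+x. ?G x \<partial>sphere_borel UNIV)"
      by (subst slice_cap_integral_eq[OF f' null eq]) simp_all
    also have "\<dots> = (\<integral>\<^sup>+a. ?W' a * (\<integral>\<^sup>+\<theta>. ?G (?pt a \<theta>) \<partial>?\<sigma>) \<partial>lborel)"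
      by (rule lat[OF G])
    also have "\<dots> = (\<integral>\<^sup>+a. ennreal K * (indicator {-1<..<1} a * indicator {a. a > 1 - \<epsilon>} a *
          (ennreal (?w a) * ?v k a) * \<psi> a) \<partial>lborel)"
    proof (rule nn_integral_cong_AE, use AE_not_in[OF Z(1)] in eventually_elim)
      case (elim a)
      show ?case
      proof (cases "a \<in> {-1<..<1}")
        case True
        have "(\<integral>\<^sup>+\<theta>. ?G (?pt a \<theta>) \<partial>?\<sigma>)
            = (\<integral>\<^sup>+\<theta>. (indicator {a. a > 1 - \<epsilon>} a * ?v k a) * ennreal (norm (f' (?pt a \<theta>))) \<partial>?\<sigma>)"
        proof (rule nn_integral_sphere_borel_cong[OF W])
          fix \<theta> assume \<theta>: "\<theta> \<in> ?W" "norm \<theta> = 1"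
          then have "snd (?pt a \<theta>) = a" using pt[OF True] by blast
          then show "?G (?pt a \<theta>) = (indicator {a. a > 1 - \<epsilon>} a * ?v k a) * ennreal (norm (f' (?pt a \<theta>)))"
            by (simp only: indicator_def mem_Collect_eq mult.assoc) (simp flip: ennreal_mult)
        qed
        also have "\<dots> = (indicator {a. a > 1 - \<epsilon>} a * ?v k a) * A a"
          unfolding A_def by (rule nn_integral_cmult) measurable
        also have "A a = ennreal K * \<psi> a" using True elim by (intro \<psi>) simp
        finally show ?thesis by (simp only: mult_ac)
      qed simp
    qed
    also have "\<dots> = ennreal K * (\<integral>\<^sup>+a. indicator {-1<..<1} a * indicator {a. a > 1 - \<epsilon>} a *
          (ennreal (?w a) * ?v k a) * \<psi> a \<partial>lborel)"
      using \<psi>_borel by (intro nn_integral_cmult) measurable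
    finally show ?thesis .
  qed
  show ?thesis
  proof (rule that)
    show "\<psi> \<in> borel_measurable borel" by (rule \<psi>_borel)
    show "\<And>\<eta>. \<eta> \<in> sphere 0 1 \<Longrightarrow> \<psi> (snd \<eta>) \<le> ennreal (norm (f \<eta>))" by (rule le)
  qed (rule cap)
qed


text \<open>The height \<open>a\<close> is an affine function of the latitude \<open>b\<close>, and the factor \<open>(1 + b)\<^bsup>(k - 3)/2\<^esup>\<close> of the density
  is bounded below for \<open>b > 0\<close>. So, up to a constant, the slice transform dominates an integral whose
  integrand is the same for all slices.\<close>

lemma (in slice_plane) slice_transform_zonal_infinite:
  assumes \<psi> [measurable]: "\<psi> \<in> borel_measurable borel"
    and inf: "(\<integral>\<^sup>+a. indicator {1 - radius\<^sup>2<..<1} a * (ennreal ((1 - a) powr ((real k - 3) / 2)) * \<psi> a) \<partial>lborel) = \<infinity>"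
  shows "slice_transform (\<lambda>\<eta>. \<psi> (snd \<eta>)) \<tau> = \<infinity>"
proof -
  let ?q = "(real k - 3) / 2" and ?R = "radius\<^sup>2"
  let ?F = "\<lambda>a. indicator {1 - ?R<..<1} a * (ennreal ((1 - a) powr ?q) * \<psi> a)"
  let ?H = "\<lambda>b. indicator {-1<..<1} b * ennreal ((1 - b\<^sup>2) powr ?q) * \<psi> (1 - ?R * (1 - b))"
  let ?c = "2 * ?R powr ?q"
  have R: "?R > 0" using radius_pos by simp
  have F: "?F \<in> borel_measurable borel" by measurable
  have subst: "(\<integral>\<^sup>+a. ?F a \<partial>lborel) = ennreal \<bar>?R\<bar> * (\<integral>\<^sup>+b. ?F ((1 - ?R) + ?R * b) \<partial>lborel)"
    by (rule nn_integral_real_affine[OF F]) (use R in simp)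
  have "(\<integral>\<^sup>+b. ?F ((1 - ?R) + ?R * b) \<partial>lborel) \<le> (\<integral>\<^sup>+b. ennreal ?c * ?H b \<partial>lborel)"
  proof (rule nn_integral_mono)
    fix b :: real
    have a: "(1 - ?R) + ?R * b = 1 - ?R * (1 - b)" by (simp add: algebra_simps)
    show "?F ((1 - ?R) + ?R * b) \<le> ennreal ?c * ?H b"
    proof (cases "b \<in> {0<..<1}")
      case True
      then have b: "0 < 1 - b" "1 < 1 + b" "1 + b < 2" by auto
      have "(1 + b) powr (- 1) \<le> (1 + b) powr ?q"
        using b exponent_gt by (intro powr_mono) auto
      moreover have "1 / 2 \<le> (1 + b) powr (- 1)"
        using b by (simp add: powr_minus_divide field_simps)
      ultimately have half: "1 \<le> 2 * (1 + b) powr ?q" by linarith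
      have "1 - b\<^sup>2 = (1 - b) * (1 + b)" by (simp add: algebra_simps power2_eq_square)
      then have 1: "(1 - b\<^sup>2) powr ?q = (1 - b) powr ?q * (1 + b) powr ?q"
        using b by (simp add: powr_mult)
      have "(1 - (1 - ?R * (1 - b))) powr ?q = ?R powr ?q * (1 - b) powr ?q * 1"
        using b R by (simp add: powr_mult)
      also have "\<dots> \<le> ?R powr ?q * (1 - b) powr ?q * (2 * (1 + b) powr ?q)"
        using half by (intro mult_left_mono) auto
      also have "\<dots> = ?c * (1 - b\<^sup>2) powr ?q" unfolding 1 by (simp only: mult_ac)
      finally have "ennreal ((1 - (1 - ?R * (1 - b))) powr ?q) \<le> ennreal (?c * (1 - b\<^sup>2) powr ?q)"
        by (rule ennreal_leI)
      also have "\<dots> = ennreal ?c * ennreal ((1 - b\<^sup>2) powr ?q)" by (intro ennreal_mult) auto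
      finally have le: "ennreal ((1 - (1 - ?R * (1 - b))) powr ?q) * \<psi> (1 - ?R * (1 - b))
          \<le> ennreal ?c * ennreal ((1 - b\<^sup>2) powr ?q) * \<psi> (1 - ?R * (1 - b))"
        by (rule mult_right_mono) simp
      have "indicator {1 - ?R<..<1} (1 - ?R * (1 - b)) \<le> (1 :: ennreal)" by (simp add: indicator_def)
      then have "?F (1 - ?R * (1 - b)) \<le> 1 * (ennreal ?c * ennreal ((1 - b\<^sup>2) powr ?q) * \<psi> (1 - ?R * (1 - b)))"
        using le by (rule mult_mono) auto
      moreover have "b \<in> {-1<..<1}" using True by auto
      ultimately show ?thesis unfolding a by (simp add: mult.assoc)
    next
      case False
      have "1 - ?R * (1 - b) \<notin> {1 - ?R<..<1}"
      proof
        assume "1 - ?R * (1 - b) \<in> {1 - ?R<..<1}"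
        then have "?R * (1 - b) < ?R * 1" "0 < ?R * (1 - b)" by auto
        then have "1 - b < 1" "0 < 1 - b"
          using R by (simp_all only: mult_less_cancel_left_pos zero_less_mult_iff) auto
        with False show False by auto
      qed
      then show ?thesis unfolding a by simp
    qed
  qed
  also have "\<dots> = ennreal ?c * (\<integral>\<^sup>+b. ?H b \<partial>lborel)"
    by (rule nn_integral_cmult) measurable
  finally have "(\<integral>\<^sup>+a. ?F a \<partial>lborel) \<le> ennreal \<bar>?R\<bar> * (ennreal ?c * (\<integral>\<^sup>+b. ?H b \<partial>lborel))"
    unfolding subst by (rule mult_left_mono) simp
  then have top: "ennreal \<bar>?R\<bar> * (ennreal ?c * (\<integral>\<^sup>+b. ?H b \<partial>lborel)) = \<infinity>"
    unfolding inf infinity_ennreal_def by (rule top_le)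
  have "(\<integral>\<^sup>+b. ?H b \<partial>lborel) = \<infinity>"
  proof (rule ccontr)
    assume "(\<integral>\<^sup>+b. ?H b \<partial>lborel) \<noteq> \<infinity>"
    then have "(\<integral>\<^sup>+b. ?H b \<partial>lborel) < top" by (simp only: less_top infinity_ennreal_def)
    then have "ennreal \<bar>?R\<bar> * (ennreal ?c * (\<integral>\<^sup>+b. ?H b \<partial>lborel)) < top"
      by (simp only: ennreal_mult_less_top ennreal_less_top simp_thms)
    then show False unfolding top by simp
  qed
  then show ?thesis
    using slice_transform_zonal[OF \<psi>] radius_pos k
    by (simp add: ennreal_mult_top ennreal_mult_eq_top_iff ennreal_eq_0_iff not_le)
qed

text \<open>With \<open>\<epsilon> = r\<^sup>2\<close> the cap meets the slice in the latitudes \<open>b > 0\<close>, where the factor \<open>1 + b\<close> of \<open>1 - b\<^sup>2\<close>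
  lies between 1 and 2. Such an \<open>\<epsilon>\<close> depends on the slice, which is why the growth condition has to fail
  for every \<open>\<epsilon>\<close>.\<close>

theorem slice_transform_infinite_zonal:
  fixes f :: "(real ^ 'n) \<times> real \<Rightarrow> 'b::euclidean_space"
  assumes n: "2 \<le> CARD('n)" and k: "2 \<le> k" and f: "f \<in> borel_measurable sphere_measure" and zonal: "zonal f"
    and inf: "\<And>\<epsilon>. 0 < \<epsilon> \<Longrightarrow> \<epsilon> \<le> 2 \<Longrightarrow> slice_cap_integral k f \<epsilon> = \<infinity>"
    and \<tau>: "\<tau> \<in> slice_planes k"
  shows "slice_transform (\<lambda>\<eta>. ennreal (norm (f \<eta>))) \<tau> = \<infinity>"
proof -
  interpret slice_plane k \<tau> by unfold_locales (fact k \<tau>)+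
  let ?R = "radius\<^sup>2" and ?q = "(real k - 3) / 2" and ?m = "(real CARD('n) - 2) / 2"
    and ?e = "(real CARD('n) + 1 - real k) / 2"
  have R: "0 < ?R" "?R \<le> 1" using radius_pos radius_le_1 by auto
  obtain \<psi> C where \<psi> [measurable]: "\<psi> \<in> borel_measurable borel"
    and le: "\<And>\<eta>. \<eta> \<in> sphere 0 1 \<Longrightarrow> \<psi> (snd \<eta>) \<le> ennreal (norm (f \<eta>))"
    and cap: "\<And>k \<epsilon>. slice_cap_integral k f \<epsilon> = ennreal C *
        (\<integral>\<^sup>+a. indicator {-1<..<1} a * indicator {a. a > 1 - \<epsilon>} a *
          (ennreal ((1 - a\<^sup>2) powr ?m) *
           ennreal (1 / (1 - a) powr ((real CARD('n) + 1 - real k) / 2))) * \<psi> a \<partial>lborel)"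
    by (rule zonal_borel_profile[OF n f zonal]) blast
  let ?F = "\<lambda>a. indicator {1 - ?R<..<1} a * (ennreal ((1 - a) powr ?q) * \<psi> a)"
  have "\<infinity> = slice_cap_integral k f ?R" using inf[of ?R] R by simp
  also have "\<dots> \<le> ennreal C * (\<integral>\<^sup>+a. ennreal (2 powr ?m) * ?F a \<partial>lborel)"
    unfolding cap
  proof (intro mult_left_mono nn_integral_mono)
    fix a :: real
    show "indicator {-1<..<1} a * indicator {a. a > 1 - ?R} a *
          (ennreal ((1 - a\<^sup>2) powr ?m) * ennreal (1 / (1 - a) powr ?e)) * \<psi> a
        \<le> ennreal (2 powr ?m) * ?F a"
    proof (cases "a \<in> {1 - ?R<..<1}")
      case True
      then have a: "0 < 1 - a" "0 < a" using R by auto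
      have "1 - a\<^sup>2 = (1 - a) * (1 + a)" by (simp add: algebra_simps power2_eq_square)
      then have 1: "(1 - a\<^sup>2) powr ?m = (1 - a) powr ?m * (1 + a) powr ?m"
        using a by (simp add: powr_mult)
      have "(1 + a) powr ?m \<le> 2 powr ?m"
        using a n by (intro powr_mono2) auto
      then have "(1 - a\<^sup>2) powr ?m * (1 / (1 - a) powr ?e) \<le> (1 - a) powr ?m * 2 powr ?m * (1 / (1 - a) powr ?e)"
        unfolding 1 by (intro mult_right_mono mult_left_mono) auto
      also have "\<dots> = 2 powr ?m * (1 - a) powr (?m - ?e)"
        by (simp add: powr_diff)
      also have "?m - ?e = ?q" by (simp add: field_simps)
      finally have "ennreal ((1 - a\<^sup>2) powr ?m * (1 / (1 - a) powr ?e)) \<le> ennreal (2 powr ?m * (1 - a) powr ?q)"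
        by (rule ennreal_leI)
      then have "ennreal ((1 - a\<^sup>2) powr ?m) * ennreal (1 / (1 - a) powr ?e) \<le> ennreal (2 powr ?m) * ennreal ((1 - a) powr ?q)"
        by (simp only: ennreal_mult' powr_ge_zero)
      then have "(ennreal ((1 - a\<^sup>2) powr ?m) * ennreal (1 / (1 - a) powr ?e)) * \<psi> a \<le> (ennreal (2 powr ?m) * ennreal ((1 - a) powr ?q)) * \<psi> a"
        by (rule mult_right_mono) simp
      moreover have "a \<in> {-1<..<1}" using a by auto
      ultimately show ?thesis using True by (simp add: mult.assoc)
    qed (auto simp: indicator_def)
  qed simp
  also have "(\<integral>\<^sup>+a. ennreal (2 powr ?m) * ?F a \<partial>lborel) = ennreal (2 powr ?m) * (\<integral>\<^sup>+a. ?F a \<partial>lborel)"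
    by (rule nn_integral_cmult) measurable
  finally have top: "ennreal C * (ennreal (2 powr ?m) * (\<integral>\<^sup>+a. ?F a \<partial>lborel)) = \<infinity>"
    by (simp add: top_unique)
  have "(\<integral>\<^sup>+a. ?F a \<partial>lborel) = \<infinity>"
  proof (rule ccontr)
    assume "(\<integral>\<^sup>+a. ?F a \<partial>lborel) \<noteq> \<infinity>"
    then have "ennreal C * (ennreal (2 powr ?m) * (\<integral>\<^sup>+a. ?F a \<partial>lborel)) < \<infinity>"
      by (simp add: ennreal_mult_less_top less_top)
    with top show False by simp
  qed
  then have "\<infinity> = slice_transform (\<lambda>\<eta>. \<psi> (snd \<eta>)) \<tau>"
    using slice_transform_zonal_infinite[OF \<psi>] by simp
  also have "\<dots> \<le> slice_transform (\<lambda>\<eta>. ennreal (norm (f \<eta>))) \<tau>"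
    unfolding slice_transform_eq using le by (intro nn_integral_mono) auto
  finally show ?thesis by (simp add: top_unique)
qed

section \<open>Sharpness of the exponent\<close>

lemma slice_planes_nonempty:
  assumes "1 \<le> k" "k - 1 \<le> DIM('a::euclidean_space)"
  obtains \<tau> :: "('a::euclidean_space \<times> real) set" where "\<tau> \<in> slice_planes k"
proof -
  have "k - 1 \<le> dim (UNIV :: 'a set)" using assms by simp
  then obtain W :: "'a set" where "subspace W" "dim W = k - 1"
    by (metis choose_subspace_of_subspace)
  then show ?thesis
    using slice_plane_over_affine_plane[of W k 0] assms that by metis
qed

theorem critical_growth_not_sufficient:
  assumes k: "2 \<le> k" "k \<le> DIM('a::euclidean_space)"
  obtains g :: "'a::euclidean_space \<times> real \<Rightarrow> 'b::{real_normed_field,euclidean_space}" and \<tau>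
  where "continuous_on (sphere 0 1 - {north_pole}) g"
    "bdd_above ((\<lambda>\<eta>. (1 - snd \<eta>) powr ((real k - 1) / 2) * norm (g \<eta>)) ` (sphere 0 1 - {north_pole}))"
    "\<tau> \<in> slice_planes k" "\<not> slice_transform_finite g \<tau>"
proof -
  let ?m = "(real k - 1) / 2"
  let ?g = "\<lambda>\<eta> :: 'a \<times> real. of_real ((1 - snd \<eta>) powr (- ?m)) :: 'b"
  obtain \<tau> :: "('a \<times> real) set" where \<tau>: "\<tau> \<in> slice_planes k"
    by (rule slice_planes_nonempty[where 'a = 'a and k = k]) (use k in auto)
  interpret slice_plane k \<tau> by unfold_locales (fact k \<tau>)+
  have lt: "snd \<eta> < 1" if "\<eta> \<in> sphere 0 1 - {north_pole}" for \<eta> :: "'a \<times> real"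
    using that by (intro snd_less_1_on_sphere) auto
  show ?thesis
  proof (rule that)
    show "continuous_on (sphere 0 1 - {north_pole}) ?g"
      using lt by (intro continuous_intros) force+
    have "(1 - snd \<eta>) powr ?m * norm (?g \<eta>) = 1" if "\<eta> \<in> sphere 0 1 - {north_pole}" for \<eta>
      using lt[OF that] by (simp flip: powr_add)
    then show "bdd_above ((\<lambda>\<eta>. (1 - snd \<eta>) powr ?m * norm (?g \<eta>)) ` (sphere 0 1 - {north_pole}))"
      by (intro bdd_aboveI2[of _ _ 1]) simp
    show "\<tau> \<in> slice_planes k" by (rule \<tau>)
    have "slice_transform (\<lambda>\<eta>. ennreal (norm (?g \<eta>))) \<tau> = \<infinity>"
      using slice_transform_powr_critical by simp
    then show "\<not> slice_transform_finite ?g \<tau>"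
      by (simp add: slice_transform_finite_def)
  qed
qed

section \<open>The four assertions together\<close>

theorem proposition4p2:
  fixes k :: nat
    and f :: "(real^'n) \<times> real \<Rightarrow> 'b::{real_normed_field,euclidean_space}"
  assumes "2 \<le> CARD('n)" and "2 \<le> k" and "k \<le> CARD('n)"
    and "f \<in> borel_measurable sphere_measure"
  shows
    "((\<forall>\<epsilon>. 0 < \<epsilon> \<and> \<epsilon> \<le> 2 \<longrightarrow> slice_cap_integral k f \<epsilon> < \<infinity>) \<longrightarrow>
        (AE \<tau> in slice_plane_measure k. slice_transform_finite f \<tau>))
     \<and>
     ((\<forall>\<eta>\<in>sphere 0 1. f \<eta> \<in> \<real>\<^sub>\<ge>\<^sub>0) \<and> zonal f \<and>
        (\<forall>\<epsilon>. 0 < \<epsilon> \<and> \<epsilon> \<le> 2 \<longrightarrow> slice_cap_integral k f \<epsilon> = \<infinity>) \<longrightarrow>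
        (\<forall>\<tau>\<in>slice_planes k. slice_transform (\<lambda>\<eta>. ennreal (norm (f \<eta>))) \<tau> = \<infinity>))
     \<and>
     (continuous_on (sphere 0 1 - {north_pole}) f \<and>
        (\<exists>\<mu> < (real k - 1) / 2.
           bdd_above ((\<lambda>\<eta>. (1 - snd \<eta>) powr \<mu> * norm (f \<eta>)) ` (sphere 0 1 - {north_pole}))) \<longrightarrow>
        (\<forall>\<tau>\<in>slice_planes k. slice_transform_finite f \<tau>))
     \<and>
     \<not> (\<forall>g :: (real^'n) \<times> real \<Rightarrow> 'b.
          continuous_on (sphere 0 1 - {north_pole}) g \<and>
          (\<exists>\<mu> \<le> (real k - 1) / 2.
             bdd_above ((\<lambda>\<eta>. (1 - snd \<eta>) powr \<mu> * norm (g \<eta>)) ` (sphere 0 1 - {north_pole}))) \<longrightarrow>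
          (\<forall>\<tau>\<in>slice_planes k. slice_transform_finite g \<tau>))"
proof (intro conjI impI)
  assume "\<forall>\<epsilon>. 0 < \<epsilon> \<and> \<epsilon> \<le> 2 \<longrightarrow> slice_cap_integral k f \<epsilon> < \<infinity>"
  then have "slice_cap_integral k f 2 < \<infinity>" by simp
  then show "AE \<tau> in slice_plane_measure k. slice_transform_finite f \<tau>"
    by (rule slice_transform_finite_AE[OF assms(2,3,4)])
next
  assume *: "(\<forall>\<eta>\<in>sphere 0 1. f \<eta> \<in> \<real>\<^sub>\<ge>\<^sub>0) \<and> zonal f \<and>
      (\<forall>\<epsilon>. 0 < \<epsilon> \<and> \<epsilon> \<le> 2 \<longrightarrow> slice_cap_integral k f \<epsilon> = \<infinity>)"
  show "\<forall>\<tau>\<in>slice_planes k. slice_transform (\<lambda>\<eta>. ennreal (norm (f \<eta>))) \<tau> = \<infinity>"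
    using slice_transform_infinite_zonal[OF assms(1,2,4)] * by blast
next
  assume *: "continuous_on (sphere 0 1 - {north_pole}) f \<and>
      (\<exists>\<mu> < (real k - 1) / 2.
         bdd_above ((\<lambda>\<eta>. (1 - snd \<eta>) powr \<mu> * norm (f \<eta>)) ` (sphere 0 1 - {north_pole})))"
  show "\<forall>\<tau>\<in>slice_planes k. slice_transform_finite f \<tau>"
  proof
    fix \<tau> :: "((real^'n) \<times> real) set" assume "\<tau> \<in> slice_planes k"
    then interpret slice_plane k \<tau> using assms(2) by unfold_locales
    show "slice_transform_finite f \<tau>"
      using * slice_transform_finite_continuous by blast
  qed
next
  have "k \<le> DIM(real^'n)" using assms(3) by simp
  then show "\<not> (\<forall>g :: (real^'n) \<times> real \<Rightarrow> 'b.
          continuous_on (sphere 0 1 - {north_pole}) g \<and>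
          (\<exists>\<mu> \<le> (real k - 1) / 2.
             bdd_above ((\<lambda>\<eta>. (1 - snd \<eta>) powr \<mu> * norm (g \<eta>)) ` (sphere 0 1 - {north_pole}))) \<longrightarrow>
          (\<forall>\<tau>\<in>slice_planes k. slice_transform_finite g \<tau>))"
    by (rule critical_growth_not_sufficient[OF assms(2)]) blast
qed

end
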